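(* Let $K$ be a field. The operad $2as$ of (nonunital) 2-associative algebras over $K$ is a Koszul operad.
   Context: A (nonunital) 2-associative algebra is a $K$-vector space with two associative binary operations $*$ and $\cdot$ (no relation between them is imposed). The operad $2as$ governing these algebras is a binary quadratic operad, and it is regular (nonsymmetric: it comes from a non-$\Sigma$-operad). "Koszul" is in the sense of Ginzburg and Kapranov. *)

theory Defs
  imports "HOL-Library.Poly_Mapping" "HOL-Library.FuncSet"
begin

section \<open>Symmetric operads over a field\<close>

text \<open>
  Operads are written in coordinate-free form: a space \<open>P(A)\<close> for every finite set \<open>A\<close> of labels
  of the inputs (\<open>P(n)\<close> being \<open>P({1..n})\<close>), bijections of label sets acting by relabelling (this is
  the action of the symmetric groups), and partial compositions
  \<open>P(A) \<times> P(B) \<rightarrow> P((A - {a}) \<union> B)\<close> for \<open>a \<in> A\<close>, plugging the output of the second factor into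
  the input \<open>a\<close> of the first one.
\<close>

record ('k, 'l, 'p) operad_data =
  comps :: "'l set \<Rightarrow> 'p set"
  vzero :: "'l set \<Rightarrow> 'p"
  vadd :: "'l set \<Rightarrow> 'p \<Rightarrow> 'p \<Rightarrow> 'p"
  vscale :: "'l set \<Rightarrow> 'k \<Rightarrow> 'p \<Rightarrow> 'p"
  relabel :: "('l \<Rightarrow> 'l) \<Rightarrow> 'l set \<Rightarrow> 'p \<Rightarrow> 'p"
  pcomp :: "'l set \<Rightarrow> 'l \<Rightarrow> 'l set \<Rightarrow> 'p \<Rightarrow> 'p \<Rightarrow> 'p"
  ounit :: "'l \<Rightarrow> 'p"

locale carrier_vector_space =
  fixes V :: "'p set" and zero :: 'p and add :: "'p \<Rightarrow> 'p \<Rightarrow> 'p"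
    and scale :: "'k::field \<Rightarrow> 'p \<Rightarrow> 'p"
  assumes zero_closed: "zero \<in> V"
    and add_closed: "x \<in> V \<Longrightarrow> y \<in> V \<Longrightarrow> add x y \<in> V"
    and scale_closed: "x \<in> V \<Longrightarrow> scale c x \<in> V"
    and add_assoc: "x \<in> V \<Longrightarrow> y \<in> V \<Longrightarrow> z \<in> V \<Longrightarrow> add (add x y) z = add x (add y z)"
    and add_comm: "x \<in> V \<Longrightarrow> y \<in> V \<Longrightarrow> add x y = add y x"
    and add_zero: "x \<in> V \<Longrightarrow> add zero x = x"
    and add_inverse: "x \<in> V \<Longrightarrow> \<exists>y\<in>V. add x y = zero"
    and scale_add: "x \<in> V \<Longrightarrow> y \<in> V \<Longrightarrow> scale c (add x y) = add (scale c x) (scale c y)"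
    and add_scale: "x \<in> V \<Longrightarrow> scale (c + d) x = add (scale c x) (scale d x)"
    and scale_scale: "x \<in> V \<Longrightarrow> scale c (scale d x) = scale (c * d) x"
    and scale_one: "x \<in> V \<Longrightarrow> scale 1 x = x"

text \<open>\<open>h\<close> restricts to a linear map \<open>P(A) \<rightarrow> P(B)\<close>.\<close>

definition linear_comps ::
  "('k, 'l, 'p) operad_data \<Rightarrow> 'l set \<Rightarrow> 'l set \<Rightarrow> ('p \<Rightarrow> 'p) \<Rightarrow> bool" where
  "linear_comps P A B h \<longleftrightarrow>
     (\<forall>x\<in>comps P A. h x \<in> comps P B) \<and>
     (\<forall>x\<in>comps P A. \<forall>y\<in>comps P A. h (vadd P A x y) = vadd P B (h x) (h y)) \<and>
     (\<forall>c. \<forall>x\<in>comps P A. h (vscale P A c x) = vscale P B c (h x))"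

locale operad =
  fixes P :: "('k::field, 'l, 'p) operad_data"
  assumes vector_space_comps:
      "finite A \<Longrightarrow> carrier_vector_space (comps P A) (vzero P A) (vadd P A) (vscale P A)"
    and relabel_linear:
      "finite A \<Longrightarrow> inj_on \<sigma> A \<Longrightarrow> linear_comps P A (\<sigma> ` A) (relabel P \<sigma> A)"
    and relabel_cong:
      "finite A \<Longrightarrow> inj_on \<sigma> A \<Longrightarrow> (\<And>a. a \<in> A \<Longrightarrow> \<tau> a = \<sigma> a) \<Longrightarrow> f \<in> comps P A \<Longrightarrow>
         relabel P \<tau> A f = relabel P \<sigma> A f"
    and relabel_id:
      "finite A \<Longrightarrow> f \<in> comps P A \<Longrightarrow> relabel P id A f = f"
    and relabel_relabel:
      "finite A \<Longrightarrow> inj_on \<sigma> A \<Longrightarrow> inj_on \<tau> (\<sigma> ` A) \<Longrightarrow> f \<in> comps P A \<Longrightarrow>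
         relabel P \<tau> (\<sigma> ` A) (relabel P \<sigma> A f) = relabel P (\<tau> \<circ> \<sigma>) A f"
    and pcomp_linear_left:
      "finite A \<Longrightarrow> finite B \<Longrightarrow> a \<in> A \<Longrightarrow> (A - {a}) \<inter> B = {} \<Longrightarrow> g \<in> comps P B \<Longrightarrow>
         linear_comps P A (A - {a} \<union> B) (\<lambda>f. pcomp P A a B f g)"
    and pcomp_linear_right:
      "finite A \<Longrightarrow> finite B \<Longrightarrow> a \<in> A \<Longrightarrow> (A - {a}) \<inter> B = {} \<Longrightarrow> f \<in> comps P A \<Longrightarrow>
         linear_comps P B (A - {a} \<union> B) (pcomp P A a B f)"
    and pcomp_sequential:
      "finite A \<Longrightarrow> finite B \<Longrightarrow> finite C \<Longrightarrow> a \<in> A \<Longrightarrow> b \<in> B \<Longrightarrow>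
       (A - {a}) \<inter> B = {} \<Longrightarrow> (A - {a} \<union> B - {b}) \<inter> C = {} \<Longrightarrow>
       f \<in> comps P A \<Longrightarrow> g \<in> comps P B \<Longrightarrow> h \<in> comps P C \<Longrightarrow>
         pcomp P (A - {a} \<union> B) b C (pcomp P A a B f g) h
         = pcomp P A a (B - {b} \<union> C) f (pcomp P B b C g h)"
    and pcomp_parallel:
      "finite A \<Longrightarrow> finite B \<Longrightarrow> finite C \<Longrightarrow> a \<in> A \<Longrightarrow> a' \<in> A \<Longrightarrow> a \<noteq> a' \<Longrightarrow>
       (A - {a}) \<inter> B = {} \<Longrightarrow> (A - {a'}) \<inter> C = {} \<Longrightarrow> B \<inter> C = {} \<Longrightarrow>
       f \<in> comps P A \<Longrightarrow> g \<in> comps P B \<Longrightarrow> h \<in> comps P C \<Longrightarrow>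
         pcomp P (A - {a} \<union> B) a' C (pcomp P A a B f g) h
         = pcomp P (A - {a'} \<union> C) a B (pcomp P A a' C f h) g"
    and pcomp_equivariant:
      "finite A \<Longrightarrow> finite B \<Longrightarrow> a \<in> A \<Longrightarrow> (A - {a}) \<inter> B = {} \<Longrightarrow>
       inj_on \<sigma> A \<Longrightarrow> inj_on \<tau> B \<Longrightarrow> \<sigma> ` (A - {a}) \<inter> \<tau> ` B = {} \<Longrightarrow>
       f \<in> comps P A \<Longrightarrow> g \<in> comps P B \<Longrightarrow>
         relabel P (\<lambda>l. if l \<in> B then \<tau> l else \<sigma> l) (A - {a} \<union> B) (pcomp P A a B f g)
         = pcomp P (\<sigma> ` A) (\<sigma> a) (\<tau> ` B) (relabel P \<sigma> A f) (relabel P \<tau> B g)"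
    and ounit_closed: "ounit P a \<in> comps P {a}"
    and relabel_ounit: "relabel P \<sigma> {a} (ounit P a) = ounit P (\<sigma> a)"
    and pcomp_ounit_left:
      "finite B \<Longrightarrow> g \<in> comps P B \<Longrightarrow> pcomp P {a} a B (ounit P a) g = g"
    and pcomp_ounit_right:
      "finite A \<Longrightarrow> a \<in> A \<Longrightarrow> b \<notin> A - {a} \<Longrightarrow> f \<in> comps P A \<Longrightarrow>
         pcomp P A a {b} f (ounit P b) = relabel P (id(a := b)) A f"


section \<open>Operads presented by binary generators and relators\<close>

text \<open>
  \<open>'g\<close> is the type of names of the binary generating operations, which carry no symmetry: the
  generating \<open>\<Sigma>\<^sub>2\<close>-module is the free one on \<open>'g\<close>. A monomial whose leaves are labelled
  bijectively by \<open>A\<close> is a basis vector of the free operad in arity \<open>A\<close>; exchanging the two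
  arguments of an operation is a special case of permuting the labels.
\<close>

datatype ('g, 'l) monomial = Leaf 'l | Node 'g "('g, 'l) monomial" "('g, 'l) monomial"

fun leaves :: "('g, 'l) monomial \<Rightarrow> 'l list" where
  "leaves (Leaf l) = [l]"
| "leaves (Node g s t) = leaves s @ leaves t"

fun graft :: "'l \<Rightarrow> ('g, 'l) monomial \<Rightarrow> ('g, 'l) monomial \<Rightarrow> ('g, 'l) monomial" where
  "graft a (Leaf l) t = (if l = a then t else Leaf l)"
| "graft a (Node g s1 s2) t = Node g (graft a s1 t) (graft a s2 t)"

definition free_comps :: "'l set \<Rightarrow> (('g, 'l) monomial \<Rightarrow>\<^sub>0 'k::field) set" where
  "free_comps A = {f. \<forall>t\<in>Poly_Mapping.keys f. distinct (leaves t) \<and> set (leaves t) = A}"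

definition free_scale :: "'k::field \<Rightarrow> ('m \<Rightarrow>\<^sub>0 'k) \<Rightarrow> ('m \<Rightarrow>\<^sub>0 'k)" where
  "free_scale c f = Poly_Mapping.map ((*) c) f"

definition free_relabel ::
  "('l \<Rightarrow> 'l) \<Rightarrow> (('g, 'l) monomial \<Rightarrow>\<^sub>0 'k::field) \<Rightarrow> (('g, 'l) monomial \<Rightarrow>\<^sub>0 'k)" where
  "free_relabel \<sigma> f =
     (\<Sum>t\<in>Poly_Mapping.keys f. Poly_Mapping.single (map_monomial id \<sigma> t) (Poly_Mapping.lookup f t))"

definition free_pcomp ::
  "'l \<Rightarrow> (('g, 'l) monomial \<Rightarrow>\<^sub>0 'k::field) \<Rightarrow> (('g, 'l) monomial \<Rightarrow>\<^sub>0 'k) \<Rightarrow>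
     (('g, 'l) monomial \<Rightarrow>\<^sub>0 'k)" where
  "free_pcomp a f g =
     (\<Sum>s\<in>Poly_Mapping.keys f. \<Sum>t\<in>Poly_Mapping.keys g.
        Poly_Mapping.single (graft a s t) (Poly_Mapping.lookup f s * Poly_Mapping.lookup g t))"

text \<open>\<open>operadic_ideal R A f\<close>: \<open>f\<close> lies in the arity \<open>A\<close> part of the operadic ideal \<open>(R)\<close> of the
  free operad.\<close>

inductive operadic_ideal ::
  "(('g, 'l) monomial \<Rightarrow>\<^sub>0 'k::field) set \<Rightarrow> 'l set \<Rightarrow> (('g, 'l) monomial \<Rightarrow>\<^sub>0 'k) \<Rightarrow> bool"
  for R where
  generator: "r \<in> R \<Longrightarrow> r \<in> free_comps A \<Longrightarrow> operadic_ideal R A r"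
| zero: "operadic_ideal R A 0"
| add: "operadic_ideal R A f \<Longrightarrow> operadic_ideal R A g \<Longrightarrow> operadic_ideal R A (f + g)"
| scale: "operadic_ideal R A f \<Longrightarrow> operadic_ideal R A (free_scale c f)"
| relabel: "operadic_ideal R A f \<Longrightarrow> inj_on \<sigma> A \<Longrightarrow> operadic_ideal R (\<sigma> ` A) (free_relabel \<sigma> f)"
| pcomp_left: "operadic_ideal R A f \<Longrightarrow> g \<in> free_comps B \<Longrightarrow> a \<in> A \<Longrightarrow> (A - {a}) \<inter> B = {} \<Longrightarrow>
     operadic_ideal R (A - {a} \<union> B) (free_pcomp a f g)"
| pcomp_right: "f \<in> free_comps A \<Longrightarrow> operadic_ideal R B g \<Longrightarrow> a \<in> A \<Longrightarrow> (A - {a}) \<inter> B = {} \<Longrightarrow>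
     operadic_ideal R (A - {a} \<union> B) (free_pcomp a f g)"

definition ideal_coset ::
  "(('g, 'l) monomial \<Rightarrow>\<^sub>0 'k::field) set \<Rightarrow> 'l set \<Rightarrow> (('g, 'l) monomial \<Rightarrow>\<^sub>0 'k) \<Rightarrow>
     (('g, 'l) monomial \<Rightarrow>\<^sub>0 'k) set" where
  "ideal_coset R A f = {f + w | w. operadic_ideal R A w}"

text \<open>The quotient of the free operad by \<open>(R)\<close>. Its elements are cosets; each operation is the
  induced one, written as the union of the cosets obtained from all representatives.\<close>

definition presented_operad ::
  "(('g, 'l) monomial \<Rightarrow>\<^sub>0 'k::field) set \<Rightarrow>
     ('k, 'l, (('g, 'l) monomial \<Rightarrow>\<^sub>0 'k) set) operad_data" where
  "presented_operad R =
    \<lparr> comps = (\<lambda>A. ideal_coset R A ` free_comps A),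
      vzero = (\<lambda>A. ideal_coset R A 0),
      vadd = (\<lambda>A X Y. \<Union>f\<in>X. \<Union>g\<in>Y. ideal_coset R A (f + g)),
      vscale = (\<lambda>A c X. \<Union>f\<in>X. ideal_coset R A (free_scale c f)),
      relabel = (\<lambda>\<sigma> A X. \<Union>f\<in>X. ideal_coset R (\<sigma> ` A) (free_relabel \<sigma> f)),
      pcomp = (\<lambda>A a B X Y. \<Union>f\<in>X. \<Union>g\<in>Y. ideal_coset R (A - {a} \<union> B) (free_pcomp a f g)),
      ounit = (\<lambda>a. ideal_coset R {a} (Poly_Mapping.single (Leaf a) 1)) \<rparr>"

text \<open>
  A (finitely generated binary) quadratic operad is \<open>F(E)/(R)\<close> with \<open>E\<close> in arity 2 and \<open>R\<close> in
  arity 3. Relators of arity 2 are admitted as well, since an arbitrary \<open>\<Sigma>\<^sub>2\<close>-module \<open>E\<close> is a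
  quotient of a free one. In particular \<open>P({}) = 0\<close> and \<open>P({a})\<close> is spanned by the unit.
\<close>

definition quadratic_operad ::
  "('k::field, 'l, (('g::finite, 'l) monomial \<Rightarrow>\<^sub>0 'k) set) operad_data \<Rightarrow> bool" where
  "quadratic_operad P \<longleftrightarrow>
     (\<exists>R. (\<forall>r\<in>R. \<exists>A. card A \<in> {2, 3} \<and> r \<in> free_comps A) \<and> P = presented_operad R)"


section \<open>The cobar complex and Koszulness\<close>

text \<open>
  A rooted tree with leaf set \<open>A\<close>, all of whose vertices have at least two inputs, is encoded as
  the set of its vertices, a vertex being identified with the set of leaves above it. So a tree is
  a laminar family of subsets of \<open>A\<close>, the root is \<open>A\<close>, and the internal edges correspond to the
  vertices other than the root (the edge going out of that vertex). Contracting
  an internal edge amounts to deleting the corresponding set from the family.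
\<close>

definition is_tree :: "'x set \<Rightarrow> 'x set set \<Rightarrow> bool" where
  "is_tree A T \<longleftrightarrow> A \<in> T \<and> (\<forall>v\<in>T. v \<subseteq> A \<and> 2 \<le> card v) \<and>
     (\<forall>u\<in>T. \<forall>v\<in>T. u \<subseteq> v \<or> v \<subseteq> u \<or> u \<inter> v = {})"

text \<open>An input of a vertex is labelled by the vertex it comes from, or by \<open>{a}\<close> if it is the
  leaf \<open>a\<close>. This is why the operads below have label type \<open>'x set\<close>.\<close>

definition inputs :: "'x set set \<Rightarrow> 'x set \<Rightarrow> 'x set set" where
  "inputs T v = {u \<in> T \<union> {{a} | a. a \<in> v}. u \<subset> v \<and> \<not> (\<exists>w\<in>T. u \<subset> w \<and> w \<subset> v)}"

definition parent :: "'x set set \<Rightarrow> 'x set \<Rightarrow> 'x set" where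
  "parent T e = (THE v. v \<in> T \<and> e \<in> inputs T v)"

definition decorations ::
  "('k::field, 'x set, 'p) operad_data \<Rightarrow> 'x set set \<Rightarrow> ('x set \<Rightarrow> 'p) set" where
  "decorations P T = (\<Pi>\<^sub>E v\<in>T. comps P (inputs T v))"

definition contract ::
  "('k::field, 'x set, 'p) operad_data \<Rightarrow> 'x set set \<Rightarrow> 'x set \<Rightarrow> ('x set \<Rightarrow> 'p) \<Rightarrow> 'x set \<Rightarrow> 'p" where
  "contract P T e x =
     (let v = parent T e
      in restrict (x(v := pcomp P (inputs T v) e (inputs T e) (x v) (x e))) (T - {e}))"

text \<open>Ordered enumerations of the internal edges of the trees with leaf set \<open>A\<close> and \<open>k\<close> internal
  edges.\<close>

definition edge_order :: "'x set \<Rightarrow> nat \<Rightarrow> 'x set list \<Rightarrow> bool" where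
  "edge_order A k es \<longleftrightarrow>
     length es = k \<and> distinct es \<and> A \<notin> set es \<and> is_tree A (insert A (set es))"

definition multilinear_form ::
  "('k::field, 'x set, 'p) operad_data \<Rightarrow> 'x set set \<Rightarrow> (('x set \<Rightarrow> 'p) \<Rightarrow> 'k) \<Rightarrow> bool" where
  "multilinear_form P T \<phi> \<longleftrightarrow>
     (\<forall>x\<in>decorations P T. \<forall>v\<in>T. \<forall>y\<in>comps P (inputs T v).
        (\<forall>z\<in>comps P (inputs T v).
           \<phi> (x(v := vadd P (inputs T v) y z)) = \<phi> (x(v := y)) + \<phi> (x(v := z))) \<and>
        (\<forall>c. \<phi> (x(v := vscale P (inputs T v) c y)) = c * \<phi> (x(v := y))))"

text \<open>
  The degree \<open>k\<close> part of the cobar complex \<open>D(P)(A)\<close> is the sum, over the trees \<open>T\<close> with leaf set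
  \<open>A\<close> and \<open>k\<close> internal edges, of \<open>P(T)\<^sup>* \<otimes> Det(T)\<close>. Here \<open>P(T)\<close> is the tensor product of the spaces
  \<open>P(inputs T v)\<close> over the vertices \<open>v\<close>, so \<open>P(T)\<^sup>*\<close> is the space of multilinear forms on decorations,
  and \<open>Det(T)\<close> is the top exterior power of the space spanned by the internal edges, which is
  rendered by alternating dependence on an ordering of these edges. (The element
  \<open>\<phi> \<otimes> (e\<^sub>1 \<and> \<dots> \<and> e\<^sub>k)\<close> corresponds to the cochain with value \<open>\<phi>\<close> at \<open>[e\<^sub>1, \<dots>, e\<^sub>k]\<close>.)
\<close>

definition cochain ::
  "('k::field, 'x set, 'p) operad_data \<Rightarrow> 'x set \<Rightarrow> nat \<Rightarrow>
     ('x set list \<Rightarrow> ('x set \<Rightarrow> 'p) \<Rightarrow> 'k) \<Rightarrow> bool" where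
  "cochain P A k \<phi> \<longleftrightarrow>
     (\<forall>es. edge_order A k es \<longrightarrow> multilinear_form P (insert A (set es)) (\<phi> es)) \<and>
     (\<forall>es1 e e' es2. edge_order A k (es1 @ e # e' # es2) \<longrightarrow>
        (\<forall>x\<in>decorations P (insert A (set (es1 @ e # e' # es2))).
           \<phi> (es1 @ e' # e # es2) x = - \<phi> (es1 @ e # e' # es2) x))"

text \<open>The differential is dual to the contraction of internal edges, combined with the maps
  \<open>\<omega> \<mapsto> e \<and> \<omega>\<close> from \<open>Det(T/e)\<close> to \<open>Det(T)\<close>.\<close>

definition cobar_d ::
  "('k::field, 'x set, 'p) operad_data \<Rightarrow> 'x set \<Rightarrow>
     ('x set list \<Rightarrow> ('x set \<Rightarrow> 'p) \<Rightarrow> 'k) \<Rightarrow> ('x set list \<Rightarrow> ('x set \<Rightarrow> 'p) \<Rightarrow> 'k)" where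
  "cobar_d P A \<phi> es x =
     (\<Sum>i<length es. (- 1) ^ i *
        \<phi> (take i es @ drop (Suc i) es) (contract P (insert A (set es)) (es ! i) x))"

definition cochain_eq ::
  "('k::field, 'x set, 'p) operad_data \<Rightarrow> 'x set \<Rightarrow> nat \<Rightarrow>
     ('x set list \<Rightarrow> ('x set \<Rightarrow> 'p) \<Rightarrow> 'k) \<Rightarrow> ('x set list \<Rightarrow> ('x set \<Rightarrow> 'p) \<Rightarrow> 'k) \<Rightarrow> bool" where
  "cochain_eq P A k \<phi> \<psi> \<longleftrightarrow>
     (\<forall>es. edge_order A k es \<longrightarrow> (\<forall>x\<in>decorations P (insert A (set es)). \<phi> es x = \<psi> es x))"

definition cobar_exact_at ::
  "('k::field, 'x set, 'p) operad_data \<Rightarrow> 'x set \<Rightarrow> nat \<Rightarrow> bool" where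
  "cobar_exact_at P A k \<longleftrightarrow>
     (\<forall>\<phi>. cochain P A k \<phi> \<and> cochain_eq P A (Suc k) (cobar_d P A \<phi>) (\<lambda>_ _. 0) \<longrightarrow>
        (case k of
           0 \<Rightarrow> cochain_eq P A 0 \<phi> (\<lambda>_ _. 0)
         | Suc j \<Rightarrow> \<exists>\<psi>. cochain P A j \<psi> \<and> cochain_eq P A k \<phi> (cobar_d P A \<psi>)))"

text \<open>
  Ginzburg and Kapranov: a quadratic operad \<open>P\<close> is Koszul if \<open>D(P)\<close> is quasi-isomorphic to its
  quadratic dual, that is, if every complex \<open>D(P)(n)\<close> is exact everywhere but at its right end. For
  \<open>n \<ge> 2\<close> the right end is in degree \<open>n - 2\<close>, where the trees are binary; the regrading and the twist
  by the sign representation in their definition of \<open>D(P)\<close> do not affect exactness, and the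
  complex for \<open>n = 1\<close> is concentrated in one degree.
\<close>

definition koszul_operad ::
  "('k::field, 'x set, (('g::finite, 'x set) monomial \<Rightarrow>\<^sub>0 'k) set) operad_data \<Rightarrow> bool" where
  "koszul_operad P \<longleftrightarrow> operad P \<and> quadratic_operad P \<and>
     (\<forall>A. finite A \<and> 2 \<le> card A \<longrightarrow> (\<forall>k. k \<noteq> card A - 2 \<longrightarrow> cobar_exact_at P A k))"


section \<open>The operad of 2-associative algebras\<close>

datatype two_ops = Star | Dot

instance two_ops :: finite
proof
  have "(UNIV :: two_ops set) = {Star, Dot}"
    using two_ops.exhaust by auto
  then show "finite (UNIV :: two_ops set)"
    by (metis finite.emptyI finite.insertI)
qed

definition associator :: "'g \<Rightarrow> 'l \<Rightarrow> 'l \<Rightarrow> 'l \<Rightarrow> (('g, 'l) monomial \<Rightarrow>\<^sub>0 'k::field)" where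
  "associator g x y z =
     Poly_Mapping.single (Node g (Node g (Leaf x) (Leaf y)) (Leaf z)) 1
     - Poly_Mapping.single (Node g (Leaf x) (Node g (Leaf y) (Leaf z))) 1"

definition two_as_relators :: "((two_ops, 'l) monomial \<Rightarrow>\<^sub>0 'k::field) set" where
  "two_as_relators = {associator g x y z | g x y z. distinct [x, y, z]}"

definition two_as :: "('k::field, 'l, ((two_ops, 'l) monomial \<Rightarrow>\<^sub>0 'k) set) operad_data" where
  "two_as = presented_operad two_as_relators"

end

theory Submission
  imports Defs
begin

text \<open>
  Modulo associativity, a monomial is determined by the relation telling for each pair of leaves which
  of them stands on the left and which operation is performed where they meet. These classes form a
  basis of the operad, and composition maps basis vectors to basis vectors. The cobar complex
  therefore splits according to the total composite \<open>\<rho>\<close> of a decorated tree. A tree decorated by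
  basis vectors with composite \<open>\<rho>\<close> is the same as a laminar family of modules of \<open>\<rho>\<close> (sets of leaves
  that no outside leaf can tell apart), so the summand of \<open>\<rho>\<close> is the augmented cochain complex of the
  flag complex of proper modules with at least two elements. If more than one operation occurs in \<open>\<rho>\<close>,
  a strong module makes this flag complex a cone, which is acyclic. Otherwise the modules are the
  intervals of a linear order and the complex is the dual of the boundary of an associahedron, a
  sphere, whose cohomology lives in top degree only; this is proved by deleting one by one the
  intervals that contain the last leaf.
\<close>

section \<open>Linear maps on formal sums of monomials\<close>

text \<open>Independence and spanning of the basis are separate arguments. A linear functional that
  depends only on \<open>rel\<close> kills each associator; the property survives relabelling and
  grafting, so such a functional kills the ideal. Conversely, two monomials with the same
  \<open>rel\<close> have nested root cuts, and cutting along both at once relates them by one use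
  of associativity. Splitting the complex needs more than a basis: a multilinear form on the
  decorations of a tree must be determined by its values at the decorations indexed by composites
  \<open>\<rho>\<close>, and these values must be free. Hence the bijection between labellings of a
  tree by realizable relations and the \<open>\<rho>\<close> adapted to it. The order of deleting
  intervals keeps every link under control. The first to go omits only the first leaf; its link is
  the same complex with one leaf less, which shifts the top degree by one. Each later one has a
  conical link whose apex is its complement, an initial interval, and what is left at the end is a
  cone. Exactness is tracked degree by degree, the link entering one degree lower.\<close>

lemma lookup_free_scale [simp]:
  "Poly_Mapping.lookup (free_scale c f) t = c * Poly_Mapping.lookup f t"
  by (simp add: free_scale_def map.rep_eq when_def)

lemma free_scale_single [simp]:
  "free_scale c (Poly_Mapping.single t d) = Poly_Mapping.single t (c * d)"
  by (rule poly_mapping_eqI) (simp add: lookup_single when_def)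

lemma free_scale_add: "free_scale c (f + g) = free_scale c f + free_scale c g"
  by (rule poly_mapping_eqI) (simp add: lookup_add algebra_simps)

lemma free_scale_diff: "free_scale c (f - g) = free_scale c f - free_scale c g"
  by (rule poly_mapping_eqI) (simp add: lookup_minus algebra_simps)

lemma free_scale_add_left: "free_scale (c + d) f = free_scale c f + free_scale d f"
  by (rule poly_mapping_eqI) (simp add: lookup_add algebra_simps)

lemma free_scale_zero [simp]: "free_scale c 0 = 0"
  by (rule poly_mapping_eqI) simp

lemma free_scale_one [simp]: "free_scale 1 f = f"
  by (rule poly_mapping_eqI) simp

lemma free_scale_scale: "free_scale c (free_scale d f) = free_scale (c * d) f"
  by (rule poly_mapping_eqI) (simp add: algebra_simps)

lemma free_scale_minus_one: "free_scale (- 1) f = - f"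
  by (rule poly_mapping_eqI) simp

definition valid :: "'l set \<Rightarrow> ('g, 'l) monomial \<Rightarrow> bool" where
  "valid A t \<longleftrightarrow> distinct (leaves t) \<and> set (leaves t) = A"

lemma free_comps_iff: "f \<in> free_comps A \<longleftrightarrow> (\<forall>t\<in>Poly_Mapping.keys f. valid A t)"
  by (simp add: free_comps_def valid_def)

lemma free_comps_zero [simp]: "0 \<in> free_comps A"
  by (simp add: free_comps_iff)

lemma free_comps_add: "f \<in> free_comps A \<Longrightarrow> g \<in> free_comps A \<Longrightarrow> f + g \<in> free_comps A"
  using Poly_Mapping.keys_add[of f g] by (auto simp: free_comps_iff)

lemma free_comps_scale: "f \<in> free_comps A \<Longrightarrow> free_scale c f \<in> free_comps A"
  by (auto simp: free_comps_iff Poly_Mapping.in_keys_iff)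

lemma free_comps_uminus: "f \<in> free_comps A \<Longrightarrow> - f \<in> free_comps A"
  by (auto simp: free_comps_iff)

lemma free_comps_diff: "f \<in> free_comps A \<Longrightarrow> g \<in> free_comps A \<Longrightarrow> f - g \<in> free_comps A"
  using free_comps_add[of f A "- g"] free_comps_uminus[of g A] by simp

lemma free_comps_single [simp]: "valid A t \<Longrightarrow> Poly_Mapping.single t c \<in> free_comps A"
  by (auto simp: free_comps_iff)

text \<open>Induction on the set of keys, splitting off one monomial with its coefficient at each
  step. Linear identities between operations on formal sums are thereby reduced to single
  monomials.\<close>

lemma free_comps_induct [consumes 1, case_names zero single add]:
  assumes "f \<in> free_comps A" and "Q 0"
    and "\<And>t c. valid A t \<Longrightarrow> Q (Poly_Mapping.single t c)"
    and "\<And>f g. f \<in> free_comps A \<Longrightarrow> g \<in> free_comps A \<Longrightarrow> Q f \<Longrightarrow> Q g \<Longrightarrow> Q (f + g)"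
  shows "Q f"
  using assms(1)
proof (induction "Poly_Mapping.keys f" arbitrary: f rule: infinite_finite_induct)
  case infinite
  then show ?case by simp
next
  case empty
  then show ?case using assms(2) by (metis keys_eq_empty)
next
  case (insert t T)
  let ?s = "Poly_Mapping.single t (Poly_Mapping.lookup f t)"
  have keys: "Poly_Mapping.keys (f - ?s) = T"
    using insert.hyps(2,4) by (auto simp: Poly_Mapping.in_keys_iff lookup_minus lookup_single when_def set_eq_iff)
  have v: "valid A t" using insert.prems insert.hyps(4) by (auto simp: free_comps_iff)
  have "f - ?s \<in> free_comps A" by (intro free_comps_diff insert.prems free_comps_single v)
  then have "Q (?s + (f - ?s))"
    using insert.hyps(3)[OF keys[symmetric]] v assms(3,4) by (metis free_comps_single)
  then show ?case by simp
qed

text \<open>The linear extension of \<open>F\<close> from monomials to formal sums; such functionals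
  are the means to separate elements modulo the ideal.\<close>

definition lin :: "('m \<Rightarrow> 'k) \<Rightarrow> ('m \<Rightarrow>\<^sub>0 'k) \<Rightarrow> 'k::field" where
  "lin F f = (\<Sum>t\<in>Poly_Mapping.keys f. Poly_Mapping.lookup f t * F t)"

lemma lin_zero [simp]: "lin F 0 = 0"
  by (simp add: lin_def)

lemma lin_add: "lin F (f + g) = lin F f + lin F g"
  unfolding lin_def by (rule setsum_keys_plus_distrib) (auto simp: algebra_simps)

lemma lin_single [simp]: "lin F (Poly_Mapping.single t c) = c * F t"
  by (simp add: lin_def)

lemma lin_scale: "lin F (free_scale c f) = c * lin F f"
proof (cases "c = 0")
  case True
  then have "free_scale c f = 0" by (intro poly_mapping_eqI) simp
  with True show ?thesis by simp
next
  case False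
  then have "Poly_Mapping.keys (free_scale c f) = Poly_Mapping.keys f"
    by (auto simp: Poly_Mapping.in_keys_iff)
  then show ?thesis by (simp add: lin_def sum_distrib_left mult.assoc)
qed

lemma lin_uminus: "lin F (- f) = - lin F f"
  using lin_scale[of F "- 1" f] by (simp add: free_scale_minus_one)

lemma lin_diff: "lin F (f - g) = lin F f - lin F g"
  using lin_add[of F f "- g"] by (simp add: lin_uminus)

lemma lin_cong: "f \<in> free_comps A \<Longrightarrow> (\<And>t. valid A t \<Longrightarrow> F t = G t) \<Longrightarrow> lin F f = lin G f"
  by (auto simp: lin_def free_comps_iff)

lemma lin_zero_fun [simp]: "lin (\<lambda>t. 0) f = 0"
  by (simp add: lin_def)

section \<open>Relabelling and composition of formal sums\<close>

lemma free_relabel_zero [simp]: "free_relabel \<sigma> 0 = 0"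
  by (simp add: free_relabel_def)

lemma free_relabel_single [simp]:
  "free_relabel \<sigma> (Poly_Mapping.single t c) = Poly_Mapping.single (map_monomial id \<sigma> t) c"
  by (simp add: free_relabel_def)

lemma free_relabel_add: "free_relabel \<sigma> (f + g) = free_relabel \<sigma> f + free_relabel \<sigma> g"
  unfolding free_relabel_def by (rule setsum_keys_plus_distrib) (auto simp: single_add)

lemma free_pcomp_add_left: "free_pcomp a (f + f') g = free_pcomp a f g + free_pcomp a f' g"
  unfolding free_pcomp_def
  by (rule setsum_keys_plus_distrib) (auto simp: single_add algebra_simps sum.distrib)

lemma free_pcomp_add_right: "free_pcomp a f (g + g') = free_pcomp a f g + free_pcomp a f g'"
  unfolding free_pcomp_def sum.distrib[symmetric]
  by (intro sum.cong refl setsum_keys_plus_distrib) (auto simp: single_add algebra_simps)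

lemma free_pcomp_zero_left [simp]: "free_pcomp a 0 g = 0"
  by (simp add: free_pcomp_def)

lemma free_pcomp_zero_right [simp]: "free_pcomp a f 0 = 0"
  by (simp add: free_pcomp_def)

lemma free_pcomp_single [simp]:
  "free_pcomp a (Poly_Mapping.single s c) (Poly_Mapping.single t d)
   = Poly_Mapping.single (graft a s t) (c * d)"
  by (cases "c = 0"; cases "d = 0") (simp_all add: free_pcomp_def)

section \<open>Leaves under relabelling and grafting\<close>

lemma leaves_map_monomial [simp]: "leaves (map_monomial h \<sigma> t) = map \<sigma> (leaves t)"
  by (induction t) auto

lemma set_leaves_nonempty [simp]: "leaves t \<noteq> []"
  by (induction t) auto

lemma valid_map_monomial: "valid A t \<Longrightarrow> inj_on \<sigma> A \<Longrightarrow> valid (\<sigma> ` A) (map_monomial id \<sigma> t)"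
  by (auto simp: valid_def distinct_map)

lemma graft_notin: "a \<notin> set (leaves s) \<Longrightarrow> graft a s t = s"
  by (induction s) auto

lemma set_leaves_graft:
  "distinct (leaves s) \<Longrightarrow> a \<in> set (leaves s) \<Longrightarrow>
     set (leaves (graft a s t)) = set (leaves s) - {a} \<union> set (leaves t)"
proof (induction s)
  case (Node g s1 s2)
  show ?case
  proof (cases "a \<in> set (leaves s1)")
    case True
    then have "a \<notin> set (leaves s2)" using Node.prems by auto
    then show ?thesis using True Node by (auto simp: graft_notin)
  next
    case False
    then show ?thesis using Node by (auto simp: graft_notin)
  qed
qed auto

lemma distinct_leaves_graft:
  "distinct (leaves s) \<Longrightarrow> distinct (leaves t) \<Longrightarrow> (set (leaves s) - {a}) \<inter> set (leaves t) = {} \<Longrightarrow>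
     distinct (leaves (graft a s t))"
proof (induction s)
  case (Node g s1 s2)
  then have "distinct (leaves (graft a s1 t))" "distinct (leaves (graft a s2 t))" by auto
  moreover have "set (leaves (graft a s1 t)) \<inter> set (leaves (graft a s2 t)) = {}"
    using Node.prems set_leaves_graft[of s1 a t] set_leaves_graft[of s2 a t]
    by (cases "a \<in> set (leaves s1)"; cases "a \<in> set (leaves s2)") (auto simp: graft_notin)
  ultimately show ?case by simp
qed auto

lemma valid_graft:
  "valid A s \<Longrightarrow> valid B t \<Longrightarrow> a \<in> A \<Longrightarrow> (A - {a}) \<inter> B = {} \<Longrightarrow> valid (A - {a} \<union> B) (graft a s t)"
  by (auto simp: valid_def distinct_leaves_graft set_leaves_graft)

lemma free_comps_relabel:
  assumes "f \<in> free_comps A" "inj_on \<sigma> A"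
  shows "free_relabel \<sigma> f \<in> free_comps (\<sigma> ` A)"
  using assms(1)
  by (induction rule: free_comps_induct)
     (auto simp: free_relabel_add free_comps_add valid_map_monomial assms(2))

lemma free_comps_pcomp:
  assumes "f \<in> free_comps A" "g \<in> free_comps B" "a \<in> A" "(A - {a}) \<inter> B = {}"
  shows "free_pcomp a f g \<in> free_comps (A - {a} \<union> B)"
  using assms(1)
proof (induction rule: free_comps_induct)
  case (single s c)
  show ?case
    using assms(2)
    by (induction rule: free_comps_induct)
       (use valid_graft[OF single _ assms(3,4)] in \<open>auto simp: free_pcomp_add_right free_comps_add\<close>)
qed (auto simp: free_pcomp_add_left free_comps_add)

lemma free_relabel_scale:
  assumes "f \<in> free_comps A"
  shows "free_relabel \<sigma> (free_scale c f) = free_scale c (free_relabel \<sigma> f)"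
  using assms by (induction rule: free_comps_induct) (auto simp: free_relabel_add free_scale_add)

lemma free_pcomp_scale_left:
  assumes "f \<in> free_comps A" "g \<in> free_comps B"
  shows "free_pcomp a (free_scale c f) g = free_scale c (free_pcomp a f g)"
  using assms(1)
proof (induction rule: free_comps_induct)
  case (single s d)
  show ?case using assms(2)
    by (induction rule: free_comps_induct) (auto simp: free_pcomp_add_right free_scale_add algebra_simps)
qed (auto simp: free_pcomp_add_left free_scale_add)

lemma free_pcomp_scale_right:
  assumes "f \<in> free_comps A" "g \<in> free_comps B"
  shows "free_pcomp a f (free_scale c g) = free_scale c (free_pcomp a f g)"
  using assms(1)
proof (induction rule: free_comps_induct)
  case (single s d)
  show ?case using assms(2)
    by (induction rule: free_comps_induct) (auto simp: free_pcomp_add_right free_scale_add algebra_simps)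
qed (auto simp: free_pcomp_add_left free_scale_add)

lemma lin_relabel:
  assumes "f \<in> free_comps A"
  shows "lin F (free_relabel \<sigma> f) = lin (\<lambda>t. F (map_monomial id \<sigma> t)) f"
  using assms by (induction rule: free_comps_induct) (auto simp: free_relabel_add lin_add id_def)

text \<open>Writing the value on a composite as an iterated functional turns composition with a
  fixed factor into a new functional of the other factor; the induction over the ideal rests on
  this.\<close>

lemma lin_pcomp:
  assumes "f \<in> free_comps A" "g \<in> free_comps B"
  shows "lin F (free_pcomp a f g) = lin (\<lambda>s. lin (\<lambda>t. F (graft a s t)) g) f"
  using assms(1)
proof (induction rule: free_comps_induct)
  case (single s d)
  show ?case using assms(2)
    by (induction rule: free_comps_induct) (auto simp: free_pcomp_add_right lin_add algebra_simps)
qed (auto simp: free_pcomp_add_left lin_add)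

section \<open>Presented operads are operads\<close>

lemma operadic_ideal_free_comps: "operadic_ideal R A f \<Longrightarrow> f \<in> free_comps A"
  by (induction rule: operadic_ideal.induct)
     (auto simp: free_comps_add free_comps_scale free_comps_relabel intro!: free_comps_pcomp)

lemma operadic_ideal_uminus: "operadic_ideal R A f \<Longrightarrow> operadic_ideal R A (- f)"
  using operadic_ideal.scale[of R A f "- 1"] by (simp add: free_scale_minus_one)

lemma operadic_ideal_diff:
  "operadic_ideal R A f \<Longrightarrow> operadic_ideal R A g \<Longrightarrow> operadic_ideal R A (f - g)"
  using operadic_ideal.add[of R A f "- g"] operadic_ideal_uminus[of R A g] by simp

lemma ideal_coset_iff: "g \<in> ideal_coset R A f \<longleftrightarrow> operadic_ideal R A (g - f)"
  unfolding ideal_coset_def by (auto, metis add.commute diff_add_cancel)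

lemma ideal_coset_eq_iff: "ideal_coset R A f = ideal_coset R A g \<longleftrightarrow> operadic_ideal R A (f - g)"
proof
  assume "ideal_coset R A f = ideal_coset R A g"
  moreover have "f \<in> ideal_coset R A f" by (simp add: ideal_coset_iff operadic_ideal.zero)
  ultimately show "operadic_ideal R A (f - g)" by (simp add: ideal_coset_iff)
next
  assume *: "operadic_ideal R A (f - g)"
  have "operadic_ideal R A (h - f) \<longleftrightarrow> operadic_ideal R A (h - g)" for h
    using operadic_ideal.add[OF _ *, of "h - f"] operadic_ideal_diff[OF _ *, of "h - g"] by auto
  then show "ideal_coset R A f = ideal_coset R A g" by (auto simp: ideal_coset_iff)
qed

text \<open>The operations of \<open>presented_operad\<close> are unions over all representatives.
  If \<open>h\<close> respects the ideal, all these cosets coincide, so the union is the coset of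
  any one representative.\<close>

lemma UN_ideal_coset:
  assumes "\<And>f'. operadic_ideal R A (f' - f) \<Longrightarrow> operadic_ideal R B (h f' - h f)"
  shows "(\<Union>f'\<in>ideal_coset R A f. ideal_coset R B (h f')) = ideal_coset R B (h f)"
proof -
  have "ideal_coset R B (h f') = ideal_coset R B (h f)" if "f' \<in> ideal_coset R A f" for f'
    using that assms by (simp add: ideal_coset_iff ideal_coset_eq_iff)
  moreover have "f \<in> ideal_coset R A f" by (simp add: ideal_coset_iff operadic_ideal.zero)
  ultimately show ?thesis by blast
qed

lemma comps_presented: "comps (presented_operad R) A = ideal_coset R A ` free_comps A"
  by (simp add: presented_operad_def)

lemma vzero_presented: "vzero (presented_operad R) A = ideal_coset R A 0"
  by (simp add: presented_operad_def)

lemma ounit_presented: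
  "ounit (presented_operad R) a = ideal_coset R {a} (Poly_Mapping.single (Leaf a) 1)"
  by (simp add: presented_operad_def)

lemma vadd_presented:
  "vadd (presented_operad R) A (ideal_coset R A f) (ideal_coset R A g) = ideal_coset R A (f + g)"
proof -
  have "(\<Union>g'\<in>ideal_coset R A g. ideal_coset R A (f' + g')) = ideal_coset R A (f' + g)" for f'
    by (rule UN_ideal_coset) simp
  moreover have "(\<Union>f'\<in>ideal_coset R A f. ideal_coset R A (f' + g)) = ideal_coset R A (f + g)"
    by (rule UN_ideal_coset) simp
  ultimately show ?thesis by (simp add: presented_operad_def)
qed

lemma vscale_presented:
  "vscale (presented_operad R) A c (ideal_coset R A f) = ideal_coset R A (free_scale c f)"
proof -
  have "(\<Union>f'\<in>ideal_coset R A f. ideal_coset R A (free_scale c f')) = ideal_coset R A (free_scale c f)"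
    by (rule UN_ideal_coset) (metis free_scale_diff operadic_ideal.scale)
  then show ?thesis by (simp add: presented_operad_def)
qed

lemma free_relabel_diff: "free_relabel \<sigma> (f - g) = free_relabel \<sigma> f - free_relabel \<sigma> g"
  by (metis add_diff_cancel_right' diff_add_cancel free_relabel_add)

lemma free_pcomp_diff_left: "free_pcomp a (f - f') g = free_pcomp a f g - free_pcomp a f' g"
  by (metis add_diff_cancel_right' diff_add_cancel free_pcomp_add_left)

lemma free_pcomp_diff_right: "free_pcomp a f (g - g') = free_pcomp a f g - free_pcomp a f g'"
  by (metis add_diff_cancel_right' diff_add_cancel free_pcomp_add_right)

lemma relabel_presented:
  assumes "inj_on \<sigma> A"
  shows "relabel (presented_operad R) \<sigma> A (ideal_coset R A f) = ideal_coset R (\<sigma> ` A) (free_relabel \<sigma> f)"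
proof -
  have "(\<Union>f'\<in>ideal_coset R A f. ideal_coset R (\<sigma> ` A) (free_relabel \<sigma> f'))
        = ideal_coset R (\<sigma> ` A) (free_relabel \<sigma> f)"
    by (rule UN_ideal_coset) (metis free_relabel_diff operadic_ideal.relabel assms)
  then show ?thesis by (simp add: presented_operad_def)
qed

lemma pcomp_presented:
  assumes f: "f \<in> free_comps A" and g: "g \<in> free_comps B" and a: "a \<in> A" "(A - {a}) \<inter> B = {}"
  shows "pcomp (presented_operad R) A a B (ideal_coset R A f) (ideal_coset R B g)
    = ideal_coset R (A - {a} \<union> B) (free_pcomp a f g)"
proof -
  let ?C = "A - {a} \<union> B"
  have 1: "(\<Union>g'\<in>ideal_coset R B g. ideal_coset R ?C (free_pcomp a f' g')) = ideal_coset R ?C (free_pcomp a f' g)"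
    if "f' \<in> ideal_coset R A f" for f'
  proof (rule UN_ideal_coset)
    fix g' assume g': "operadic_ideal R B (g' - g)"
    \<comment> \<open>The ideal absorbs composition only with left factors from
      \<open>free_comps A\<close>; \<open>f'\<close> is such a factor, being \<open>f\<close> plus
      an element of the ideal.\<close>
    have "f' - f \<in> free_comps A" using that by (simp add: ideal_coset_iff operadic_ideal_free_comps)
    then have "f' \<in> free_comps A" using free_comps_add[OF _ f, of "f' - f"] by simp
    then show "operadic_ideal R ?C (free_pcomp a f' g' - free_pcomp a f' g)"
      using operadic_ideal.pcomp_right[OF _ g' a, of f'] by (simp add: free_pcomp_diff_right)
  qed
  have 2: "(\<Union>f'\<in>ideal_coset R A f. ideal_coset R ?C (free_pcomp a f' g)) = ideal_coset R ?C (free_pcomp a f g)"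
    using operadic_ideal.pcomp_left[OF _ g a] by (intro UN_ideal_coset) (simp flip: free_pcomp_diff_left)
  show ?thesis using 1 2 by (simp add: presented_operad_def)
qed

lemma free_relabel_cong:
  assumes "f \<in> free_comps A" "\<And>a. a \<in> A \<Longrightarrow> \<tau> a = \<sigma> a"
  shows "free_relabel \<tau> f = free_relabel \<sigma> f"
  using assms(1)
proof (induction rule: free_comps_induct)
  case (single t c)
  have "map_monomial id \<tau> t = map_monomial id \<sigma> t"
    if "\<And>a. a \<in> set (leaves t) \<Longrightarrow> \<tau> a = \<sigma> a" using that by (induction t) auto
  with single assms(2) show ?case by (simp add: valid_def)
qed (auto simp: free_relabel_add)

lemma free_relabel_id: "f \<in> free_comps A \<Longrightarrow> free_relabel id f = f"
  by (induction rule: free_comps_induct) (auto simp: free_relabel_add id_def monomial.map_ident)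

lemma free_relabel_relabel: "f \<in> free_comps A \<Longrightarrow> free_relabel \<tau> (free_relabel \<sigma> f) = free_relabel (\<tau> \<circ> \<sigma>) f"
  by (induction rule: free_comps_induct) (auto simp: free_relabel_add monomial.map_comp id_def comp_def)

text \<open>Additivity suffices because the monomials in \<open>eq\<close> carry arbitrary
  coefficients; vanishing at 0 follows from additivity. It serves the two associativity axioms of
  partial composition.\<close>

lemma trilinear_eq_on_free_comps:
  assumes fgh: "f \<in> free_comps A" "g \<in> free_comps B" "h \<in> free_comps C"
    and D: "\<And>f f' g h. D (f + f') g h = D f g h + D f' g h"
      "\<And>f g g' h. D f (g + g') h = D f g h + D f g' h"
      "\<And>f g h h'. D f g (h + h') = D f g h + D f g h'"
    and E: "\<And>f f' g h. E (f + f') g h = E f g h + E f' g h"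
      "\<And>f g g' h. E f (g + g') h = E f g h + E f g' h"
      "\<And>f g h h'. E f g (h + h') = E f g h + E f g h'"
    and eq: "\<And>r s t x y z. valid A r \<Longrightarrow> valid B s \<Longrightarrow> valid C t \<Longrightarrow>
      D (Poly_Mapping.single r x) (Poly_Mapping.single s y) (Poly_Mapping.single t z)
      = (E (Poly_Mapping.single r x) (Poly_Mapping.single s y) (Poly_Mapping.single t z) :: _ \<Rightarrow>\<^sub>0 'k::field)"
  shows "D f g h = E f g h"
proof -
  have z: "D 0 g h = 0" "D f 0 h = 0" "D f g 0 = 0" "E 0 g h = 0" "E f 0 h = 0" "E f g 0 = 0" for f g h
    using D(1)[of 0 0 g h] D(2)[of f 0 0 h] D(3)[of f g 0 0]
      E(1)[of 0 0 g h] E(2)[of f 0 0 h] E(3)[of f g 0 0] by simp_all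
  show ?thesis using fgh(1)
  proof (induction rule: free_comps_induct)
    case (single r x)
    note r = this
    show ?case using fgh(2)
    proof (induction rule: free_comps_induct)
      case (single s y)
      note s = this
      show ?case using fgh(3)
        by (induction rule: free_comps_induct) (use r s eq in \<open>auto simp: z D E\<close>)
    qed (auto simp: z D E)
  qed (auto simp: z D E)
qed

lemma graft_graft_sequential:
  "distinct (leaves s) \<Longrightarrow> b \<notin> set (leaves s) - {a} \<Longrightarrow> b \<in> set (leaves t) \<Longrightarrow>
     graft b (graft a s t) u = graft a s (graft b t u)"
proof (induction s)
  case (Node g s1 s2)
  have "graft b (graft a s1 t) u = graft a s1 (graft b t u)"
    by (rule Node.IH(1)) (use Node.prems in auto)
  moreover have "graft b (graft a s2 t) u = graft a s2 (graft b t u)"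
    by (rule Node.IH(2)) (use Node.prems in auto)
  ultimately show ?case by simp
qed auto

lemma graft_graft_parallel:
  "a \<noteq> a' \<Longrightarrow> a' \<notin> set (leaves t) \<Longrightarrow> a \<notin> set (leaves u) \<Longrightarrow>
     graft a' (graft a s t) u = graft a (graft a' s u) t"
  by (induction s) (auto simp: graft_notin)

lemma graft_leaf: "graft a s (Leaf b) = map_monomial id (id(a := b)) s"
  by (induction s) auto

lemma map_monomial_cong_leaves:
  "(\<And>a. a \<in> set (leaves t) \<Longrightarrow> \<tau> a = \<sigma> a) \<Longrightarrow> map_monomial id \<tau> t = map_monomial id \<sigma> t"
  by (induction t) auto

lemma map_graft:
  assumes "set (leaves t) = B" "(set (leaves s) - {a}) \<inter> B = {}" "inj_on \<sigma> A" "set (leaves s) \<subseteq> A" "a \<in> A"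
  shows "map_monomial id (\<lambda>l. if l \<in> B then \<tau> l else \<sigma> l) (graft a s t)
     = graft (\<sigma> a) (map_monomial id \<sigma> s) (map_monomial id \<tau> t)"
  using assms(2,4)
proof (induction s)
  case (Leaf l)
  have "map_monomial id (\<lambda>l. if l \<in> B then \<tau> l else \<sigma> l) t = map_monomial id \<tau> t"
    by (rule map_monomial_cong_leaves) (simp add: assms(1))
  moreover have "\<sigma> l = \<sigma> a \<longleftrightarrow> l = a"
    using Leaf assms(3,5) by (auto simp: inj_on_eq_iff)
  moreover have "l \<noteq> a \<Longrightarrow> l \<notin> B" using Leaf by auto
  ultimately show ?case by (cases "l = a") (simp_all add: id_def)
next
  case (Node g s1 s2)
  have "(set (leaves s1) - {a}) \<inter> B = {}" "(set (leaves s2) - {a}) \<inter> B = {}"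
    "set (leaves s1) \<subseteq> A" "set (leaves s2) \<subseteq> A" using Node.prems by auto
  then show ?case using Node.IH by simp
qed

theorem operad_presented:
  fixes R :: "(('g, 'l) monomial \<Rightarrow>\<^sub>0 'k::field) set"
  shows "operad (presented_operad R)"
proof (rule operad.intro)
  fix A B C :: "'l set" and a a' b c :: 'l and \<sigma> \<tau> :: "'l \<Rightarrow> 'l" and f g h
  let ?P = "presented_operad R"
  show "carrier_vector_space (comps ?P A) (vzero ?P A) (vadd ?P A) (vscale ?P A)"
  proof
    fix x assume "x \<in> comps ?P A"
    then obtain f where f: "f \<in> free_comps A" "x = ideal_coset R A f" by (auto simp: comps_presented)
    have "vadd ?P A x (ideal_coset R A (- f)) = vzero ?P A"
      by (simp add: f vadd_presented vzero_presented)
    then show "\<exists>y\<in>comps ?P A. vadd ?P A x y = vzero ?P A"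
      using f(1) by (auto simp: comps_presented free_comps_uminus)
  qed (auto simp: comps_presented vadd_presented vzero_presented vscale_presented
         free_comps_add free_comps_scale free_scale_add free_scale_add_left free_scale_scale add_ac)
next
  fix A B C :: "'l set" and a a' b c :: 'l and \<sigma> \<tau> :: "'l \<Rightarrow> 'l" and f g h
  let ?P = "presented_operad R"
  assume "inj_on \<sigma> A"
  then show "linear_comps ?P A (\<sigma> ` A) (relabel ?P \<sigma> A)"
    by (auto simp: linear_comps_def comps_presented relabel_presented free_comps_relabel
       vadd_presented vscale_presented free_relabel_add free_relabel_scale)
next
  fix A B C :: "'l set" and a a' b c :: 'l and \<sigma> \<tau> :: "'l \<Rightarrow> 'l" and f g h
  let ?P = "presented_operad R"
  assume *: "inj_on \<sigma> A" "\<And>a. a \<in> A \<Longrightarrow> \<tau> a = \<sigma> a" "f \<in> comps ?P A"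
  then have "inj_on \<tau> A" "\<tau> ` A = \<sigma> ` A" by (auto simp: inj_on_def)
  moreover obtain f' where "f = ideal_coset R A f'" "f' \<in> free_comps A"
    using *(3) by (auto simp: comps_presented)
  ultimately show "relabel ?P \<tau> A f = relabel ?P \<sigma> A f"
    using *(1) free_relabel_cong[of f' A \<tau> \<sigma>] *(2) by (simp add: relabel_presented)
next
  fix A :: "'l set" and f
  let ?P = "presented_operad R"
  assume "f \<in> comps ?P A"
  then show "relabel ?P id A f = f"
    by (auto simp: comps_presented relabel_presented free_relabel_id)
next
  fix A :: "'l set" and \<sigma> \<tau> :: "'l \<Rightarrow> 'l" and f
  let ?P = "presented_operad R"
  assume "inj_on \<sigma> A" "inj_on \<tau> (\<sigma> ` A)" "f \<in> comps ?P A"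
  then show "relabel ?P \<tau> (\<sigma> ` A) (relabel ?P \<sigma> A f) = relabel ?P (\<tau> \<circ> \<sigma>) A f"
    by (auto simp: comps_presented relabel_presented free_relabel_relabel comp_inj_on image_comp)
next
  fix A B :: "'l set" and a and g
  let ?P = "presented_operad R"
  assume "a \<in> A" "(A - {a}) \<inter> B = {}" "g \<in> comps ?P B"
  then show "linear_comps ?P A (A - {a} \<union> B) (\<lambda>f. pcomp ?P A a B f g)"
    by (auto simp: linear_comps_def comps_presented pcomp_presented free_comps_pcomp free_comps_add
       free_comps_scale vadd_presented vscale_presented free_pcomp_add_left free_pcomp_scale_left)
next
  fix A B :: "'l set" and a and f
  let ?P = "presented_operad R"
  assume "a \<in> A" "(A - {a}) \<inter> B = {}" "f \<in> comps ?P A"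
  then show "linear_comps ?P B (A - {a} \<union> B) (pcomp ?P A a B f)"
    by (auto simp: linear_comps_def comps_presented pcomp_presented free_comps_pcomp free_comps_add
       free_comps_scale vadd_presented vscale_presented free_pcomp_add_right free_pcomp_scale_right)
next
  fix A B C :: "'l set" and a b and f g h
  let ?P = "presented_operad R"
  assume as: "a \<in> A" "b \<in> B" "(A - {a}) \<inter> B = {}" "(A - {a} \<union> B - {b}) \<inter> C = {}"
     "f \<in> comps ?P A" "g \<in> comps ?P B" "h \<in> comps ?P C"
  have b: "b \<notin> A - {a}" using as by auto
  have sets: "A - {a} \<union> B - {b} \<union> C = A - {a} \<union> (B - {b} \<union> C)" "(B - {b}) \<inter> C = {}"
    "(A - {a}) \<inter> (B - {b} \<union> C) = {}" "b \<in> A - {a} \<union> B" using as(1-4) by auto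
  have "free_pcomp b (free_pcomp a f g) h = free_pcomp a f (free_pcomp b g h)"
    if "f \<in> free_comps A" "g \<in> free_comps B" "h \<in> free_comps C" for f g h :: "('g, 'l) monomial \<Rightarrow>\<^sub>0 'k"
    using that
  proof (rule trilinear_eq_on_free_comps)
    fix r s t :: "('g, 'l) monomial" and x y z :: 'k
    assume "valid A r" "valid B s" "valid C t"
    then have "graft b (graft a r s) t = graft a r (graft b s t)"
      using b as(2) by (intro graft_graft_sequential) (auto simp: valid_def)
    then show "free_pcomp b (free_pcomp a (Poly_Mapping.single r x) (Poly_Mapping.single s y)) (Poly_Mapping.single t z)
       = free_pcomp a (Poly_Mapping.single r x) (free_pcomp b (Poly_Mapping.single s y) (Poly_Mapping.single t z))"
      by (simp add: mult.assoc)
  qed (simp_all add: free_pcomp_add_left free_pcomp_add_right)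
  then show "pcomp ?P (A - {a} \<union> B) b C (pcomp ?P A a B f g) h = pcomp ?P A a (B - {b} \<union> C) f (pcomp ?P B b C g h)"
    using as sets by (auto simp: comps_presented pcomp_presented free_comps_pcomp)
next
  fix A B C :: "'l set" and a a' and f g h
  let ?P = "presented_operad R"
  assume as: "a \<in> A" "a' \<in> A" "a \<noteq> a'" "(A - {a}) \<inter> B = {}" "(A - {a'}) \<inter> C = {}" "B \<inter> C = {}"
     "f \<in> comps ?P A" "g \<in> comps ?P B" "h \<in> comps ?P C"
  have b: "a' \<notin> B" "a \<notin> C" using as by auto
  have sets: "A - {a} \<union> B - {a'} \<union> C = A - {a'} \<union> C - {a} \<union> B"
    "(A - {a} \<union> B - {a'}) \<inter> C = {}" "(A - {a'} \<union> C - {a}) \<inter> B = {}" "a' \<in> A - {a} \<union> B" "a \<in> A - {a'} \<union> C"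
    using as(1-6) by auto
  have "free_pcomp a' (free_pcomp a f g) h = free_pcomp a (free_pcomp a' f h) g"
    if "f \<in> free_comps A" "g \<in> free_comps B" "h \<in> free_comps C" for f g h :: "('g, 'l) monomial \<Rightarrow>\<^sub>0 'k"
    using that
  proof (rule trilinear_eq_on_free_comps)
    fix r s t :: "('g, 'l) monomial" and x y z :: 'k
    assume "valid A r" "valid B s" "valid C t"
    then have "graft a' (graft a r s) t = graft a (graft a' r t) s"
      using b as(3) by (intro graft_graft_parallel) (auto simp: valid_def)
    then show "free_pcomp a' (free_pcomp a (Poly_Mapping.single r x) (Poly_Mapping.single s y)) (Poly_Mapping.single t z)
       = free_pcomp a (free_pcomp a' (Poly_Mapping.single r x) (Poly_Mapping.single t z)) (Poly_Mapping.single s y)"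
      by (simp add: mult_ac)
  qed (simp_all add: free_pcomp_add_left free_pcomp_add_right)
  moreover obtain f' g' h' where f': "f = ideal_coset R A f'" "f' \<in> free_comps A"
    "g = ideal_coset R B g'" "g' \<in> free_comps B" "h = ideal_coset R C h'" "h' \<in> free_comps C"
    using as by (auto simp: comps_presented)
  moreover have "free_pcomp a f' g' \<in> free_comps (A - {a} \<union> B)" "free_pcomp a' f' h' \<in> free_comps (A - {a'} \<union> C)"
    using f' as by (auto intro!: free_comps_pcomp)
  ultimately show "pcomp ?P (A - {a} \<union> B) a' C (pcomp ?P A a B f g) h = pcomp ?P (A - {a'} \<union> C) a B (pcomp ?P A a' C f h) g"
    using as(1-6) sets by (simp add: pcomp_presented)
next
  fix A B :: "'l set" and a and \<sigma> \<tau> :: "'l \<Rightarrow> 'l" and f g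
  let ?P = "presented_operad R"
  let ?\<rho> = "\<lambda>l. if l \<in> B then \<tau> l else \<sigma> l"
  assume as: "a \<in> A" "(A - {a}) \<inter> B = {}" "inj_on \<sigma> A" "inj_on \<tau> B" "\<sigma> ` (A - {a}) \<inter> \<tau> ` B = {}"
    "f \<in> comps ?P A" "g \<in> comps ?P B"
  have im: "?\<rho> ` (A - {a} \<union> B) = \<sigma> ` A - {\<sigma> a} \<union> \<tau> ` B"
    using as(1-3) by (auto simp: inj_on_eq_iff image_iff)
  have inj: "inj_on ?\<rho> (A - {a} \<union> B)"
  proof (rule inj_onI)
    fix x y assume xy: "x \<in> A - {a} \<union> B" "y \<in> A - {a} \<union> B" "?\<rho> x = ?\<rho> y"
    have "\<sigma> u \<noteq> \<tau> v" if "u \<in> A - {a}" "v \<in> B" for u v using as(5) that by blast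
    then have "x \<in> B \<longleftrightarrow> y \<in> B" using xy by (metis Un_iff)
    then show "x = y" using xy as(3,4) by (cases "x \<in> B") (auto dest: inj_onD)
  qed
  have disj: "(\<sigma> ` A - {\<sigma> a}) \<inter> \<tau> ` B = {}" using as(5) by auto
  have "free_relabel ?\<rho> (free_pcomp a f g) = free_pcomp (\<sigma> a) (free_relabel \<sigma> f) (free_relabel \<tau> g)"
    if f: "f \<in> free_comps A" and g: "g \<in> free_comps B" for f g :: "('g, 'l) monomial \<Rightarrow>\<^sub>0 'k"
    using f
  proof (induction rule: free_comps_induct)
    case (single s c)
    note s = this
    show ?case using g
    proof (induction rule: free_comps_induct)
      case (single t d)
      have "map_monomial id ?\<rho> (graft a s t) = graft (\<sigma> a) (map_monomial id \<sigma> s) (map_monomial id \<tau> t)"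
        by (rule map_graft) (use as single s in \<open>auto simp: valid_def\<close>)
      then show ?case by (simp only: free_pcomp_single free_relabel_single)
    qed (simp_all only: free_pcomp_add_right free_relabel_add free_pcomp_zero_right free_relabel_zero)
  qed (simp_all only: free_pcomp_add_left free_relabel_add free_pcomp_zero_left free_relabel_zero)
  moreover obtain f' g' where f': "f = ideal_coset R A f'" "f' \<in> free_comps A"
    "g = ideal_coset R B g'" "g' \<in> free_comps B"
    using as by (auto simp: comps_presented)
  ultimately show "relabel ?P ?\<rho> (A - {a} \<union> B) (pcomp ?P A a B f g)
    = pcomp ?P (\<sigma> ` A) (\<sigma> a) (\<tau> ` B) (relabel ?P \<sigma> A f) (relabel ?P \<tau> B g)"
    using as(1-4) disj inj im
    by (simp only: pcomp_presented relabel_presented free_comps_relabel imageI)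
next
  fix a :: 'l
  let ?P = "presented_operad R"
  show "ounit ?P a \<in> comps ?P {a}"
    by (auto simp: ounit_presented comps_presented valid_def)
next
  fix \<sigma> :: "'l \<Rightarrow> 'l" and a :: 'l
  let ?P = "presented_operad R"
  show "relabel ?P \<sigma> {a} (ounit ?P a) = ounit ?P (\<sigma> a)"
    by (simp add: ounit_presented relabel_presented)
next
  fix B :: "'l set" and a g
  let ?P = "presented_operad R"
  assume "g \<in> comps ?P B"
  moreover have "free_pcomp a (Poly_Mapping.single (Leaf a) 1) g = g"
    if "g \<in> free_comps B" for g :: "('g, 'l) monomial \<Rightarrow>\<^sub>0 'k"
    using that by (induction rule: free_comps_induct) (auto simp: free_pcomp_add_right)
  ultimately show "pcomp ?P {a} a B (ounit ?P a) g = g"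
    by (auto simp: ounit_presented comps_presented pcomp_presented valid_def)
next
  fix A :: "'l set" and a b f
  let ?P = "presented_operad R"
  assume as: "a \<in> A" "b \<notin> A - {a}" "f \<in> comps ?P A"
  have "free_pcomp a f (Poly_Mapping.single (Leaf b) 1) = free_relabel (id(a := b)) f"
    if "f \<in> free_comps A" for f :: "('g, 'l) monomial \<Rightarrow>\<^sub>0 'k"
    using that
    by (induction rule: free_comps_induct)
       (simp_all only: free_pcomp_add_left free_relabel_add free_pcomp_zero_left free_relabel_zero
          free_pcomp_single free_relabel_single graft_leaf mult_1_right)
  moreover have "inj_on (id(a := b)) A" "id(a := b) ` A = A - {a} \<union> {b}"
    using as(1,2) by (auto simp: inj_on_def)
  moreover obtain f' where "f = ideal_coset R A f'" "f' \<in> free_comps A"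
    using as by (auto simp: comps_presented)
  moreover have "Poly_Mapping.single (Leaf b) 1 \<in> (free_comps {b} :: (('g, 'l) monomial \<Rightarrow>\<^sub>0 'k) set)"
    by (auto simp: valid_def)
  moreover have "(A - {a}) \<inter> {b} = {}" using as(2) by auto
  ultimately show "pcomp ?P A a {b} f (ounit ?P b) = relabel ?P (id(a := b)) A f"
    using as(1) by (simp only: ounit_presented pcomp_presented relabel_presented)
qed

section \<open>Associativity classes of monomials\<close>

text \<open>The class of a monomial modulo associativity of all operations is recorded by the relation
  ``\<open>x\<close> stands to the left of \<open>y\<close> and \<open>g\<close> is the operation at the vertex where they meet''.\<close>

fun rel :: "('g, 'l) monomial \<Rightarrow> ('g \<times> 'l \<times> 'l) set" where
  "rel (Leaf l) = {}"
| "rel (Node g s t) = rel s \<union> rel t \<union> {g} \<times> set (leaves s) \<times> set (leaves t)"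

lemma rel_leaves: "(g, x, y) \<in> rel t \<Longrightarrow> x \<in> set (leaves t) \<and> y \<in> set (leaves t)"
  by (induction t) auto

lemma rel_asym: "distinct (leaves t) \<Longrightarrow> (g, x, y) \<in> rel t \<Longrightarrow> (h, y, x) \<notin> rel t"
  by (induction t) (auto dest: rel_leaves)

lemma rel_unique: "distinct (leaves t) \<Longrightarrow> (g, x, y) \<in> rel t \<Longrightarrow> (h, x, y) \<in> rel t \<Longrightarrow> g = h"
  by (induction t) (auto dest: rel_leaves)

lemma rel_map_monomial: "rel (map_monomial id \<sigma> t) = (\<lambda>(g, x, y). (g, \<sigma> x, \<sigma> y)) ` rel t"
  by (induction t) (auto simp: image_Un image_iff)

text \<open>Substitution of the structure \<open>\<rho>'\<close> for the point \<open>a\<close>: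
  every element of \<open>B\<close> inherits the relations of \<open>a\<close> to the remaining
  points.\<close>

definition comp_rel :: "'l \<Rightarrow> 'l set \<Rightarrow> ('g \<times> 'l \<times> 'l) set \<Rightarrow> ('g \<times> 'l \<times> 'l) set \<Rightarrow> ('g \<times> 'l \<times> 'l) set" where
  "comp_rel a B \<rho> \<rho>' = {(g, x, y). (g, x, y) \<in> \<rho> \<and> x \<noteq> a \<and> y \<noteq> a} \<union> \<rho>'
     \<union> {(g, x, y). (g, x, a) \<in> \<rho> \<and> y \<in> B} \<union> {(g, x, y). x \<in> B \<and> (g, a, y) \<in> \<rho>}"

text \<open>By distinctness \<open>a\<close> occurs in exactly one argument of a vertex; the other
  argument is left alone, and in the product of leaf sets at that vertex \<open>a\<close> is
  replaced by the leaves of \<open>t\<close>.\<close>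

lemma rel_graft:
  "distinct (leaves s) \<Longrightarrow> a \<in> set (leaves s) \<Longrightarrow> rel (graft a s t) = comp_rel a (set (leaves t)) (rel s) (rel t)"
proof (induction s)
  case (Node g s1 s2)
  show ?case
  proof (cases "a \<in> set (leaves s1)")
    case True
    then have a: "a \<notin> set (leaves s2)" using Node.prems by auto
    then have "rel (graft a s1 t) = comp_rel a (set (leaves t)) (rel s1) (rel t)" "graft a s2 t = s2"
      "set (leaves (graft a s1 t)) = set (leaves s1) - {a} \<union> set (leaves t)"
      using True Node set_leaves_graft[of s1 a t] by (auto simp: graft_notin)
    then show ?thesis using True a by (auto simp: comp_rel_def dest: rel_leaves)
  next
    case False
    then have "rel (graft a s2 t) = comp_rel a (set (leaves t)) (rel s2) (rel t)" "graft a s1 t = s1"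
      "set (leaves (graft a s2 t)) = set (leaves s2) - {a} \<union> set (leaves t)"
      using Node set_leaves_graft[of s2 a t] by (auto simp: graft_notin)
    then show ?thesis using False Node.prems by (auto simp: comp_rel_def dest: rel_leaves)
  qed
qed (auto simp: comp_rel_def)

definition realizable :: "'l set \<Rightarrow> ('g \<times> 'l \<times> 'l) set \<Rightarrow> bool" where
  "realizable A \<rho> \<longleftrightarrow> (\<exists>t. valid A t \<and> rel t = \<rho>)"

lemma realizable_subset: "realizable A \<rho> \<Longrightarrow> (g, x, y) \<in> \<rho> \<Longrightarrow> x \<in> A \<and> y \<in> A"
  by (auto simp: realizable_def valid_def dest: rel_leaves)

lemma realizable_asym: "realizable A \<rho> \<Longrightarrow> (g, x, y) \<in> \<rho> \<Longrightarrow> (h, y, x) \<notin> \<rho>"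
  using rel_asym by (fastforce simp: realizable_def valid_def)

lemma realizable_unique: "realizable A \<rho> \<Longrightarrow> (g, x, y) \<in> \<rho> \<Longrightarrow> (h, x, y) \<in> \<rho> \<Longrightarrow> g = h"
  using rel_unique by (fastforce simp: realizable_def valid_def)

lemma realizable_irrefl: "realizable A \<rho> \<Longrightarrow> (g, x, x) \<notin> \<rho>"
  using realizable_asym by metis

lemma realizable_comp:
  assumes "realizable A \<rho>" "realizable B \<rho>'" "a \<in> A" "(A - {a}) \<inter> B = {}"
  shows "realizable (A - {a} \<union> B) (comp_rel a B \<rho> \<rho>')"
proof -
  obtain s t where "valid A s" "rel s = \<rho>" "valid B t" "rel t = \<rho>'"
    using assms by (auto simp: realizable_def)
  then have "valid (A - {a} \<union> B) (graft a s t)" "rel (graft a s t) = comp_rel a B \<rho> \<rho>'"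
    using assms valid_graft[of A s B t a] rel_graft[of s a t] by (simp_all add: valid_def)
  then show ?thesis by (auto simp: realizable_def)
qed

lemma realizable_image:
  assumes "realizable A \<rho>" "inj_on \<sigma> A"
  shows "realizable (\<sigma> ` A) ((\<lambda>(g, x, y). (g, \<sigma> x, \<sigma> y)) ` \<rho>)"
proof -
  obtain t where "valid A t" "rel t = \<rho>" using assms by (auto simp: realizable_def)
  then show ?thesis
    unfolding realizable_def using valid_map_monomial[OF _ assms(2)] rel_map_monomial[of \<sigma> t] by blast
qed

text \<open>Discarding the leaves outside \<open>X\<close>, together with each vertex that thereby
  loses a whole argument, leaves a monomial in which the remaining pairs meet at the same operation
  as before.\<close>

lemma realizable_restrict:
  assumes "realizable A \<rho>" "X \<subseteq> A" "X \<noteq> {}"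
  shows "realizable X {(g, x, y). (g, x, y) \<in> \<rho> \<and> x \<in> X \<and> y \<in> X}"
proof -
  obtain t where t: "valid A t" "rel t = \<rho>" using assms(1) by (auto simp: realizable_def)
  have "\<exists>u. valid X u \<and> rel u = {(g, x, y). (g, x, y) \<in> rel t \<and> x \<in> X \<and> y \<in> X}"
    if "distinct (leaves t)" "X \<subseteq> set (leaves t)" "X \<noteq> {}" for t :: "('b, 'a) monomial" and X
    using that
  proof (induction t arbitrary: X)
    case (Leaf l)
    then show ?case by (intro exI[of _ "Leaf l"]) (auto simp: valid_def)
  next
    case (Node g s t)
    let ?S = "X \<inter> set (leaves s)" and ?T = "X \<inter> set (leaves t)"
    have X: "X = ?S \<union> ?T" using Node.prems by auto
    have disj: "set (leaves s) \<inter> set (leaves t) = {}" using Node.prems by simp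
    consider "?S = {}" | "?T = {}" | "?S \<noteq> {}" "?T \<noteq> {}" by blast
    then show ?case
    proof cases
      case 1
      then obtain u where "valid X u" "rel u = {(g, x, y). (g, x, y) \<in> rel t \<and> x \<in> X \<and> y \<in> X}"
        using Node.IH(2)[of X] Node.prems X by auto
      then show ?thesis using 1 by (intro exI[of _ u]) (auto dest: rel_leaves)
    next
      case 2
      then obtain u where "valid X u" "rel u = {(g, x, y). (g, x, y) \<in> rel s \<and> x \<in> X \<and> y \<in> X}"
        using Node.IH(1)[of X] Node.prems X by auto
      then show ?thesis using 2 by (intro exI[of _ u]) (auto dest: rel_leaves)
    next
      case 3
      obtain u where u: "valid ?S u" "rel u = {(g, x, y). (g, x, y) \<in> rel s \<and> x \<in> ?S \<and> y \<in> ?S}"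
        using Node.IH(1)[of ?S] Node.prems 3 by auto
      obtain v where v: "valid ?T v" "rel v = {(g, x, y). (g, x, y) \<in> rel t \<and> x \<in> ?T \<and> y \<in> ?T}"
        using Node.IH(2)[of ?T] Node.prems 3 by auto
      have "valid X (Node g u v)" using u v X disj by (auto simp: valid_def)
      moreover have "rel (Node g u v) = {(h, x, y). (h, x, y) \<in> rel (Node g s t) \<and> x \<in> X \<and> y \<in> X}"
        using u v by (auto simp: valid_def dest: rel_leaves)
      ultimately show ?thesis by blast
    qed
  qed
  from this[of t X] show ?thesis using t assms by (auto simp: realizable_def valid_def)
qed

lemma finite_realizable:
  assumes "finite A"
  shows "finite {\<rho> :: ('g::finite \<times> 'l \<times> 'l) set. realizable A \<rho>}"
proof (rule finite_subset)
  show "{\<rho> :: ('g \<times> 'l \<times> 'l) set. realizable A \<rho>} \<subseteq> Pow (UNIV \<times> A \<times> A)"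
    by (auto dest: realizable_subset)
qed (use assms in simp)

section \<open>The operad of several associative operations\<close>

text \<open>The argument treats any finite family of independent associative operations at once;
  \<open>two_ops\<close> enters only in the final theorem.\<close>

definition assoc_relators :: "(('g, 'l) monomial \<Rightarrow>\<^sub>0 'k::field) set" where
  "assoc_relators = {associator g x y z | g x y z. distinct [x, y, z]}"

abbreviation multi_as :: "('k::field, 'l, (('g, 'l) monomial \<Rightarrow>\<^sub>0 'k) set) operad_data" where
  "multi_as \<equiv> presented_operad assoc_relators"

section \<open>Linear independence modulo the ideal\<close>

definition rel_invariant :: "'l set \<Rightarrow> (('g, 'l) monomial \<Rightarrow> 'k) \<Rightarrow> bool" where
  "rel_invariant A F \<longleftrightarrow> (\<forall>s t. valid A s \<and> valid A t \<and> rel s = rel t \<longrightarrow> F s = F t)"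

text \<open>Both sides of an associator have the same \<open>rel\<close>. Precomposing
  \<open>F\<close> with a relabelling, or with grafting where one factor is fixed, gives an
  invariant function again; hence the induction over the ideal with \<open>F\<close>
  arbitrary.\<close>

lemma lin_assoc_ideal:
  fixes f :: "('g, 'l) monomial \<Rightarrow>\<^sub>0 'k::field"
  assumes "operadic_ideal assoc_relators A f" "rel_invariant A F"
  shows "lin F f = 0"
  using assms
proof (induction arbitrary: F rule: operadic_ideal.induct)
  case (generator r A)
  then obtain g x y z where r: "r = associator g x y z" by (auto simp: assoc_relators_def)
  let ?s = "Node g (Node g (Leaf x) (Leaf y)) (Leaf z)" and ?t = "Node g (Leaf x) (Node g (Leaf y) (Leaf z))"
  have "?s \<in> Poly_Mapping.keys r" "?t \<in> Poly_Mapping.keys r"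
    by (auto simp: r associator_def Poly_Mapping.in_keys_iff lookup_minus lookup_single)
  then have "valid A ?s" "valid A ?t" using generator.hyps(2) by (auto simp: free_comps_iff)
  moreover have "rel ?s = rel ?t" by auto
  ultimately have "F ?s = F ?t" using generator.prems by (auto simp: rel_invariant_def)
  then show ?case by (simp add: r associator_def lin_diff)
next
  case (relabel A f \<sigma>)
  have "rel_invariant A (\<lambda>t. F (map_monomial id \<sigma> t))"
    using relabel.prems relabel.hyps(2) valid_map_monomial
    unfolding rel_invariant_def rel_map_monomial by (metis rel_map_monomial)
  then show ?case
    using lin_relabel[OF operadic_ideal_free_comps[OF relabel.hyps(1)]] relabel.IH by metis
next
  case (pcomp_left A f g B a)
  have "rel_invariant A (\<lambda>s. lin (\<lambda>t. F (graft a s t)) g)"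
    unfolding rel_invariant_def
  proof (intro allI impI, elim conjE)
    fix s s' :: "('g, 'l) monomial" assume s: "valid A s" "valid A s'" "rel s = rel s'"
    show "lin (\<lambda>t. F (graft a s t)) g = lin (\<lambda>t. F (graft a s' t)) g"
    proof (rule lin_cong[OF pcomp_left.hyps(2)])
      fix t :: "('g, 'l) monomial" assume t: "valid B t"
      have "rel (graft a s t) = rel (graft a s' t)"
        using s t pcomp_left.hyps(3) by (simp add: rel_graft valid_def)
      then show "F (graft a s t) = F (graft a s' t)"
        using pcomp_left.prems valid_graft[OF _ t pcomp_left.hyps(3,4)] s unfolding rel_invariant_def by blast
    qed
  qed
  then show ?case
    using lin_pcomp[OF operadic_ideal_free_comps[OF pcomp_left.hyps(1)] pcomp_left.hyps(2)] pcomp_left.IH by metis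
next
  case (pcomp_right f A B g a)
  have "lin (\<lambda>s. lin (\<lambda>t. F (graft a s t)) g) f = lin (\<lambda>s. 0) f"
  proof (rule lin_cong[OF pcomp_right.hyps(1)])
    fix s :: "('g, 'l) monomial" assume s: "valid A s"
    have "rel_invariant B (\<lambda>t. F (graft a s t))"
      unfolding rel_invariant_def
    proof (intro allI impI, elim conjE)
      fix t t' :: "('g, 'l) monomial" assume t: "valid B t" "valid B t'" "rel t = rel t'"
      then have "rel (graft a s t) = rel (graft a s t')"
        using s t pcomp_right.hyps(3) by (simp add: rel_graft valid_def)
      then show "F (graft a s t) = F (graft a s t')"
        using pcomp_right.prems valid_graft[OF s _ pcomp_right.hyps(3,4)] t unfolding rel_invariant_def by blast
    qed
    then show "lin (\<lambda>t. F (graft a s t)) g = 0" by (rule pcomp_right.IH)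
  qed
  then show ?case
    using lin_pcomp[OF pcomp_right.hyps(1) operadic_ideal_free_comps[OF pcomp_right.hyps(2)]] by simp
qed (auto simp: lin_add lin_scale)

text \<open>Congruence of monomials modulo the ideal. The field does not occur in the type of
  monomials, so a type argument fixes the coefficients.\<close>

definition assoc_equiv :: "'k::field itself \<Rightarrow> 'l set \<Rightarrow> ('g, 'l) monomial \<Rightarrow> ('g, 'l) monomial \<Rightarrow> bool" where
  "assoc_equiv (K :: 'k itself) A s t \<longleftrightarrow>
     operadic_ideal assoc_relators A (Poly_Mapping.single s (1::'k) - Poly_Mapping.single t 1)"

lemma assoc_equiv_refl: "assoc_equiv K A s s"
  by (simp add: assoc_equiv_def operadic_ideal.zero)

lemma assoc_equiv_sym: "assoc_equiv K A s t \<Longrightarrow> assoc_equiv K A t s"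
  unfolding assoc_equiv_def using operadic_ideal_uminus by fastforce

lemma assoc_equiv_trans [trans]: "assoc_equiv K A s t \<Longrightarrow> assoc_equiv K A t u \<Longrightarrow> assoc_equiv K A s u"
  unfolding assoc_equiv_def using operadic_ideal.add by fastforce

lemma assoc_equiv_graft:
  assumes "assoc_equiv K A s s'" "valid B t" "a \<in> A" "(A - {a}) \<inter> B = {}"
  shows "assoc_equiv K (A - {a} \<union> B) (graft a s t) (graft a s' t)"
  using operadic_ideal.pcomp_left[OF assms(1)[unfolded assoc_equiv_def], of "Poly_Mapping.single t 1" B a] assms(2-)
  by (simp add: assoc_equiv_def free_pcomp_diff_left)

lemma assoc_equiv_graft_right:
  assumes "assoc_equiv K B t t'" "valid A s" "a \<in> A" "(A - {a}) \<inter> B = {}"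
  shows "assoc_equiv K (A - {a} \<union> B) (graft a s t) (graft a s t')"
  using operadic_ideal.pcomp_right[OF _ assms(1)[unfolded assoc_equiv_def], of "Poly_Mapping.single s 1" A a] assms(2-)
  by (simp add: assoc_equiv_def free_pcomp_diff_right)

text \<open>Obtained by grafting \<open>s\<close> and \<open>s'\<close> into
  \<open>Node g (Leaf a) t\<close>. The placeholder \<open>a\<close> is taken from \<open>A\<close>
  itself, as the label type need not contain a label outside \<open>A \<union> B\<close>; grafting
  removes it before \<open>A\<close> is inserted.\<close>

lemma assoc_equiv_Node_left:
  assumes "assoc_equiv K A s s'" "valid A s" "valid A s'" "valid B t" "A \<inter> B = {}"
  shows "assoc_equiv K (A \<union> B) (Node g s t) (Node g s' t)"
proof -
  have "A \<noteq> {}" using assms(2) by (auto simp: valid_def)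
  then obtain a where a: "a \<in> A" by blast
  then have nb: "a \<notin> set (leaves t)" using assms(4,5) by (auto simp: valid_def)
  have "valid (insert a B) (Node g (Leaf a) t)" using assms(4) nb by (auto simp: valid_def)
  from assoc_equiv_graft_right[OF assms(1) this, of a] nb assms(4,5)
  have "assoc_equiv K (insert a B - {a} \<union> A) (Node g s t) (Node g s' t)"
    by (auto simp: graft_notin valid_def)
  moreover have "insert a B - {a} \<union> A = A \<union> B" using nb assms(4) a by (auto simp: valid_def)
  ultimately show ?thesis by simp
qed

lemma assoc_equiv_Node_right:
  assumes "assoc_equiv K A s s'" "valid A s" "valid A s'" "valid B t" "A \<inter> B = {}"
  shows "assoc_equiv K (A \<union> B) (Node g t s) (Node g t s')"
proof -
  have "A \<noteq> {}" using assms(2) by (auto simp: valid_def)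
  then obtain a where a: "a \<in> A" by blast
  then have nb: "a \<notin> set (leaves t)" using assms(4,5) by (auto simp: valid_def)
  have "valid (insert a B) (Node g t (Leaf a))" using assms(4) nb by (auto simp: valid_def)
  from assoc_equiv_graft_right[OF assms(1) this, of a] nb assms(4,5)
  have "assoc_equiv K (insert a B - {a} \<union> A) (Node g t s) (Node g t s')"
    by (auto simp: graft_notin valid_def)
  moreover have "insert a B - {a} \<union> A = A \<union> B" using nb assms(4) a by (auto simp: valid_def)
  ultimately show ?thesis by simp
qed

text \<open>Start from the associator on one leaf of each of \<open>A\<close>, \<open>B\<close>,
  \<open>C\<close> and graft \<open>s\<close>, \<open>t\<close>, \<open>u\<close> in turn. The
  placeholders are again members of the sets that replace them, which keeps all disjointness
  conditions.\<close>

lemma assoc_equiv_assoc: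
  assumes "valid A s" "valid B t" "valid C u" "A \<inter> B = {}" "A \<inter> C = {}" "B \<inter> C = {}"
  shows "assoc_equiv K (A \<union> B \<union> C) (Node g (Node g s t) u) (Node g s (Node g t u))"
proof -
  have "A \<noteq> {}" "B \<noteq> {}" "C \<noteq> {}" using assms(1-3) by (auto simp: valid_def)
  then obtain x y z where xyz: "x \<in> A" "y \<in> B" "z \<in> C" by blast
  have ne: "x \<noteq> y" "x \<noteq> z" "y \<noteq> z" using xyz assms by auto
  have L: "set (leaves s) = A" "set (leaves t) = B" "set (leaves u) = C" using assms by (auto simp: valid_def)
  have nin: "y \<notin> A" "z \<notin> A" "z \<notin> B" using xyz assms(4-6) by auto
  have "assoc_equiv K {x, y, z} (Node g (Node g (Leaf x) (Leaf y)) (Leaf z)) (Node g (Leaf x) (Node g (Leaf y) (Leaf z)))"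
    unfolding assoc_equiv_def associator_def[symmetric]
  proof (rule operadic_ideal.generator)
    show "associator g x y z \<in> assoc_relators" using ne by (auto simp: assoc_relators_def)
    show "associator g x y z \<in> free_comps {x, y, z}"
      unfolding associator_def by (intro free_comps_diff free_comps_single) (use ne in \<open>auto simp: valid_def\<close>)
  qed
  from assoc_equiv_graft[OF this assms(1), of x]
  have "assoc_equiv K ({x, y, z} - {x} \<union> A) (Node g (Node g s (Leaf y)) (Leaf z)) (Node g s (Node g (Leaf y) (Leaf z)))"
    using ne nin by simp
  from assoc_equiv_graft[OF this assms(2), of y]
  have "assoc_equiv K ({x, y, z} - {x} \<union> A - {y} \<union> B) (Node g (Node g s t) (Leaf z)) (Node g s (Node g t (Leaf z)))"
    using ne nin L assms(4) by (auto simp: graft_notin)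
  from assoc_equiv_graft[OF this assms(3), of z]
  have "assoc_equiv K ({x, y, z} - {x} \<union> A - {y} \<union> B - {z} \<union> C) (Node g (Node g s t) u) (Node g s (Node g t u))"
    using ne nin L assms(4-6) by (auto simp: graft_notin)
  moreover have "{x, y, z} - {x} \<union> A - {y} \<union> B - {z} \<union> C = A \<union> B \<union> C" using xyz ne nin by auto
  ultimately show ?thesis by simp
qed

lemma valid_Node_iff:
  "valid A (Node g s t) \<longleftrightarrow> valid (set (leaves s)) s \<and> valid (set (leaves t)) t \<and>
     set (leaves s) \<inter> set (leaves t) = {} \<and> A = set (leaves s) \<union> set (leaves t)"
  by (auto simp: valid_def)

lemma rel_Node_left:
  "distinct (leaves (Node g s t)) \<Longrightarrow>
     rel s = {(h, x, y). (h, x, y) \<in> rel (Node g s t) \<and> x \<in> set (leaves s) \<and> y \<in> set (leaves s)}"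
  by (auto dest: rel_leaves)

lemma rel_Node_right:
  "distinct (leaves (Node g s t)) \<Longrightarrow>
     rel t = {(h, x, y). (h, x, y) \<in> rel (Node g s t) \<and> x \<in> set (leaves t) \<and> y \<in> set (leaves t)}"
  by (auto dest: rel_leaves)

text \<open>The top cuts of two equivalent monomials are nested; restricting the second monomial to the
  difference of the two cuts yields a common refinement.\<close>

lemma assoc_equiv_if_nested:
  fixes s1 s2 t1 t2 :: "('g, 'l) monomial"
  assumes IH: "\<And>B (s :: ('g, 'l) monomial) t. card B < card A \<Longrightarrow> finite B \<Longrightarrow> valid B s \<Longrightarrow> valid B t \<Longrightarrow> rel s = rel t \<Longrightarrow> assoc_equiv K B s t"
    and s: "valid A (Node g s1 s2)" and t: "valid A (Node h t1 t2)"
    and rel: "rel (Node g s1 s2) = rel (Node h t1 t2)"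
    and sub: "set (leaves s1) \<subseteq> set (leaves t1)"
  shows "assoc_equiv K A (Node g s1 s2) (Node h t1 t2)"
proof -
  let ?X = "set (leaves s1)" and ?Y = "set (leaves t1)" and ?X' = "set (leaves s2)" and ?Y' = "set (leaves t2)"
  note S = s[unfolded valid_Node_iff] and T = t[unfolded valid_Node_iff]
  \<comment> \<open>A leaf to the left of the first cut and a leaf to the right of the second are
    separated by both roots, so the two root operations agree.\<close>
  obtain x y where "x \<in> ?X" "y \<in> ?Y'"
    using set_leaves_nonempty[of s1] set_leaves_nonempty[of t2] by (meson ex_in_conv set_empty)
  then have "x \<in> ?Y" "y \<in> ?X'" using sub S T by auto
  then have "(g, x, y) \<in> rel (Node g s1 s2)" "(h, x, y) \<in> rel (Node h t1 t2)"
    using \<open>x \<in> ?X\<close> \<open>y \<in> ?Y'\<close> by simp_all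
  then have gh: "g = h" using rel_unique[of "Node g s1 s2" g x y h] s by (simp only: rel valid_def)
  have finA: "finite A" using S by simp
  have small: "card B < card A" if "B \<subset> A" for B using finA that by (rule psubset_card_mono)
  have "distinct (leaves (Node g s1 s2))" "distinct (leaves (Node h t1 t2))"
    using s t by (simp_all only: valid_def)
  note r = rel_Node_left[OF this(1)] rel_Node_right[OF this(1)]
    rel_Node_left[OF this(2), folded rel] rel_Node_right[OF this(2), folded rel]
  have ne: "?X \<noteq> {}" "?X' \<noteq> {}" "?Y \<noteq> {}" "?Y' \<noteq> {}" by simp_all
  note VS = S[THEN conjunct1] S[THEN conjunct2, THEN conjunct1] and VT = T[THEN conjunct1] T[THEN conjunct2, THEN conjunct1]
  note SA = S[THEN conjunct2, THEN conjunct2, THEN conjunct2] S[THEN conjunct2, THEN conjunct2, THEN conjunct1]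
  note TA = T[THEN conjunct2, THEN conjunct2, THEN conjunct2] T[THEN conjunct2, THEN conjunct2, THEN conjunct1]
  have "P \<subset> A" "Q \<subset> A" if "A = P \<union> Q" "P \<inter> Q = {}" "P \<noteq> {}" "Q \<noteq> {}" for P Q
    using that by auto
  note psub = this[OF SA ne(1,2)] this[OF TA ne(3,4)]
  have fin: "finite ?X" "finite ?X'" "finite ?Y" "finite ?Y'" by simp_all
  show ?thesis
  proof (cases "?X = ?Y")
    case True
    then have XY': "?X' = ?Y'" using SA TA by blast
    have "assoc_equiv K ?X s1 t1"
      by (rule IH[OF small[OF psub(1)] fin(1) VS(1) VT(1)[folded True]]) (simp only: r True)
    then have "assoc_equiv K (?X \<union> ?X') (Node g s1 s2) (Node g t1 s2)"
      by (rule assoc_equiv_Node_left[OF _ VS(1) VT(1)[folded True] VS(2) SA(2)])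
    moreover have "assoc_equiv K ?X' s2 t2"
      by (rule IH[OF small[OF psub(2)] fin(2) VS(2) VT(2)[folded XY']]) (simp only: r XY')
    then have "assoc_equiv K (?X' \<union> ?X) (Node g t1 s2) (Node g t1 t2)"
      by (rule assoc_equiv_Node_right[OF _ VS(2) VT(2)[folded XY'] VT(1)[folded True]]) (use SA(2) in blast)
    ultimately show ?thesis using gh assoc_equiv_trans by (metis SA(1) Un_commute)
  next
    case False
    let ?Z = "?Y - ?X"
    have Z: "?Z \<noteq> {}" "?Z \<subseteq> A" "?Y = ?X \<union> ?Z" "?X \<inter> ?Z = {}" using False sub psub by blast+
    have X': "?X' = ?Z \<union> ?Y'" "?Z \<inter> ?Y' = {}" "?X \<inter> ?Y' = {}" using SA TA sub by blast+
    have "realizable A (rel (Node g s1 s2))" using s unfolding realizable_def by blast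
    \<comment> \<open>\<open>u\<close> is the middle block of the common refinement: both monomials
      are congruent to \<open>s1\<close>, \<open>u\<close>, \<open>t2\<close> joined by
      \<open>g\<close>, one for each of the two bracketings.\<close>
    from realizable_restrict[OF this Z(2,1)]
    obtain u where u: "valid ?Z u" "rel u = {(k, x, y). (k, x, y) \<in> rel (Node g s1 s2) \<and> x \<in> ?Z \<and> y \<in> ?Z}"
      unfolding realizable_def by blast
    have Lu: "set (leaves u) = ?Z" using u(1) unfolding valid_def by blast
    have c2: "(g, x, y) \<in> rel (Node g s1 s2)" if "x \<in> ?Z" "y \<in> ?Y'" for x y
    proof -
      have "(h, x, y) \<in> rel (Node g s1 s2)" unfolding rel using that by simp
      then show ?thesis by (simp only: gh)
    qed
    have c1: "(g, x, y) \<in> rel (Node g s1 s2)" if "x \<in> ?X" "y \<in> ?Z" for x y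
      using that X'(1) by simp
    have d: "distinct (leaves (Node g s1 s2))" using s unfolding valid_def by blast
    have n: "(k, y, x) \<notin> rel (Node g s1 s2)" "(k, x, y) \<in> rel (Node g s1 s2) \<longleftrightarrow> k = g"
      if "(g, x, y) \<in> rel (Node g s1 s2)" for x y k
      using that rel_asym[OF d] rel_unique[OF d] by metis+
    have rt1: "rel (Node g s1 u) = rel t1"
    proof (rule set_eqI, clarify)
      fix k x y
      have "(k, x, y) \<in> rel (Node g s1 u) \<longleftrightarrow> (k, x, y) \<in> rel s1 \<or> (k, x, y) \<in> rel u \<or> k = g \<and> x \<in> ?X \<and> y \<in> ?Z"
        by (simp add: Lu)
      also have "\<dots> \<longleftrightarrow> (k, x, y) \<in> rel (Node g s1 s2) \<and> x \<in> ?X \<union> ?Z \<and> y \<in> ?X \<union> ?Z"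
        unfolding r(1) u(2) using n[OF c1] by blast
      finally show "(k, x, y) \<in> rel (Node g s1 u) \<longleftrightarrow> (k, x, y) \<in> rel t1"
        unfolding r(3) Z(3)[symmetric] by blast
    qed
    have rs2: "rel s2 = rel (Node g u t2)"
    proof (rule set_eqI, clarify)
      fix k x y
      have "(k, x, y) \<in> rel (Node g u t2) \<longleftrightarrow> (k, x, y) \<in> rel u \<or> (k, x, y) \<in> rel t2 \<or> k = g \<and> x \<in> ?Z \<and> y \<in> ?Y'"
        by (auto simp: Lu)
      also have "\<dots> \<longleftrightarrow> (k, x, y) \<in> rel (Node g s1 s2) \<and> x \<in> ?Z \<union> ?Y' \<and> y \<in> ?Z \<union> ?Y'"
        unfolding r(4) u(2) using n[OF c2] by blast
      finally show "(k, x, y) \<in> rel s2 \<longleftrightarrow> (k, x, y) \<in> rel (Node g u t2)"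
        unfolding r(2) X'(1)[symmetric] by blast
    qed
    have vt1: "valid ?Y (Node g s1 u)" unfolding valid_Node_iff Lu
      using VS(1) u(1) Z(3,4) by blast
    have vs2: "valid ?X' (Node g u t2)" unfolding valid_Node_iff Lu
      using VT(2) u(1) X'(1,2) by blast
    have "assoc_equiv K ?X' s2 (Node g u t2)"
      by (rule IH[OF small[OF psub(2)] fin(2) VS(2) vs2 rs2])
    then have "assoc_equiv K (?X' \<union> ?X) (Node g s1 s2) (Node g s1 (Node g u t2))"
      by (rule assoc_equiv_Node_right[OF _ VS(2) vs2 VS(1)]) (use SA(2) in blast)
    moreover have "assoc_equiv K (?X \<union> ?Z \<union> ?Y') (Node g (Node g s1 u) t2) (Node g s1 (Node g u t2))"
      by (rule assoc_equiv_assoc[OF VS(1) u(1) VT(2) Z(4) X'(3,2)])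
    moreover have "assoc_equiv K ?Y (Node g s1 u) t1"
      by (rule IH[OF small[OF psub(3)] fin(3) vt1 VT(1) rt1])
    then have "assoc_equiv K (?Y \<union> ?Y') (Node g (Node g s1 u) t2) (Node g t1 t2)"
      by (rule assoc_equiv_Node_left[OF _ vt1 VT(1,2) TA(2)])
    moreover have "?X' \<union> ?X = A" using SA(1) by blast
    moreover have "?X \<union> ?Z \<union> ?Y' = A" "?Y \<union> ?Y' = A" using TA(1) Z(3) by blast+
    ultimately show ?thesis unfolding gh[symmetric] using assoc_equiv_sym assoc_equiv_trans by metis
  qed
qed

text \<open>Strong induction on the number of leaves. The root cuts are nested, so
  \<open>assoc_equiv_if_nested\<close> applies in one of the two directions, with the induction
  hypothesis for the smaller leaf sets.\<close>

lemma assoc_equiv_if_rel_eq: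
  assumes "valid A s" "valid A t" "rel s = rel t"
  shows "assoc_equiv K A s t"
proof -
  have "finite A" using assms(1) by (auto simp: valid_def)
  then show ?thesis using assms
  proof (induction "card A" arbitrary: A s t rule: less_induct)
    case less
    have IH: "assoc_equiv K B s t" if "card B < card A" "finite B" "valid B s" "valid B t" "rel s = rel t"
      for B and s t :: "('b, 'a) monomial" using less.hyps that by blast
    show ?case
    proof (cases s)
      case (Leaf l)
      then have "A = {l}" using less.prems by (simp add: valid_def)
      moreover have False if "t = Node h t1 t2" for h t1 t2
        using less.prems(4) that Leaf set_leaves_nonempty[of t1] set_leaves_nonempty[of t2]
        by (auto simp flip: set_empty)
      ultimately have "t = Leaf l" using less.prems by (cases t) (auto simp: valid_def)
      then show ?thesis using Leaf assoc_equiv_refl by simp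
    next
      case s: (Node g s1 s2)
      show ?thesis
      proof (cases t)
        case (Leaf l)
        then show ?thesis using less.prems(4) s set_leaves_nonempty[of s1] set_leaves_nonempty[of s2]
          by (auto simp flip: set_empty)
      next
        case t: (Node h t1 t2)
        note S = less.prems(2)[unfolded s] and T = less.prems(3)[unfolded t] and R = less.prems(4)[unfolded s t]
        \<comment> \<open>If neither cut contained the other, some \<open>x\<close> would precede
          some \<open>y\<close> in one monomial and follow it in the other.\<close>
        have "set (leaves s1) \<subseteq> set (leaves t1) \<or> set (leaves t1) \<subseteq> set (leaves s1)"
        proof (rule ccontr)
          assume "\<not> ?thesis"
          then obtain x y where xy: "x \<in> set (leaves s1)" "x \<notin> set (leaves t1)" "y \<in> set (leaves t1)" "y \<notin> set (leaves s1)"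
            by blast
          then have "x \<in> set (leaves t2)" "y \<in> set (leaves s2)" using S T unfolding valid_Node_iff by blast+
          then have "(g, x, y) \<in> rel (Node g s1 s2)" "(h, y, x) \<in> rel (Node h t1 t2)"
            using xy by simp_all
          then show False using rel_asym[of "Node g s1 s2" g x y h] S by (simp only: R valid_def)
        qed
        then show ?thesis
        proof
          assume "set (leaves s1) \<subseteq> set (leaves t1)"
          from assoc_equiv_if_nested[OF _ S T R this] IH show ?thesis unfolding s t by blast
        next
          assume "set (leaves t1) \<subseteq> set (leaves s1)"
          from assoc_equiv_if_nested[OF _ T S R[symmetric] this] IH show ?thesis
            unfolding s t by (blast intro: assoc_equiv_sym)
        qed
      qed
    qed
  qed
qed

section \<open>Basis vectors of the operad and their coordinates\<close>

definition basis :: "'l set \<Rightarrow> ('g \<times> 'l \<times> 'l) set \<Rightarrow> (('g, 'l) monomial \<Rightarrow>\<^sub>0 'k::field) set" where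
  "basis A \<rho> = ideal_coset assoc_relators A (Poly_Mapping.single (SOME t. valid A t \<and> rel t = \<rho>) 1)"

text \<open>The \<open>SOME\<close> here and in \<open>basis\<close> are harmless: monomials with
  the same \<open>rel\<close> are congruent (\<open>basis_eq\<close>), and the coefficient
  functional vanishes on the ideal (\<open>coord_coset\<close>).\<close>

definition coord :: "('g \<times> 'l \<times> 'l) set \<Rightarrow> (('g, 'l) monomial \<Rightarrow>\<^sub>0 'k::field) set \<Rightarrow> 'k" where
  "coord \<rho> X = lin (\<lambda>t. of_bool (rel t = \<rho>)) (SOME f. f \<in> X)"

lemma basis_eq:
  assumes "valid A t" "rel t = \<rho>"
  shows "basis A \<rho> = ideal_coset assoc_relators A (Poly_Mapping.single t (1::'k::field))"
proof -
  define u where "u = (SOME t. valid A t \<and> rel t = \<rho>)"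
  have "valid A u \<and> rel u = \<rho>" unfolding u_def by (rule someI[of _ t]) (use assms in simp)
  then have "assoc_equiv TYPE('k) A u t" using assoc_equiv_if_rel_eq assms by metis
  then show ?thesis unfolding basis_def u_def[symmetric] ideal_coset_eq_iff assoc_equiv_def .
qed

lemma coord_coset: "coord \<rho> (ideal_coset assoc_relators A f) = lin (\<lambda>t. of_bool (rel t = \<rho>)) f"
proof -
  define f' where "f' = (SOME f'. f' \<in> ideal_coset assoc_relators A f)"
  have "f' \<in> ideal_coset assoc_relators A f"
    unfolding f'_def by (rule someI[of _ f]) (simp add: ideal_coset_iff operadic_ideal.zero)
  then have "operadic_ideal assoc_relators A (f' - f)" by (simp add: ideal_coset_iff)
  then have "lin (\<lambda>t. of_bool (rel t = \<rho>)) (f' - f) = 0"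
    by (rule lin_assoc_ideal) (simp add: rel_invariant_def)
  then show ?thesis by (simp add: coord_def f'_def lin_diff)
qed

lemma basis_in_comps: "realizable A \<rho> \<Longrightarrow> basis A \<rho> \<in> comps multi_as A"
  by (auto simp: realizable_def comps_presented basis_eq)

lemma coord_basis:
  assumes "realizable A \<rho>'"
  shows "coord \<rho> (basis A \<rho>') = of_bool (\<rho> = \<rho>')"
proof -
  obtain t where "valid A t" "rel t = \<rho>'" using assms by (auto simp: realizable_def)
  then show ?thesis by (auto simp: basis_eq[of A t] coord_coset)
qed

lemma coord_vadd:
  assumes "X \<in> comps multi_as A" "Y \<in> comps multi_as A"
  shows "coord \<rho> (vadd multi_as A X Y) = coord \<rho> X + coord \<rho> Y"
  using assms by (auto simp: comps_presented vadd_presented coord_coset lin_add)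

lemma coord_vscale:
  assumes "X \<in> comps multi_as A"
  shows "coord \<rho> (vscale multi_as A c X) = c * coord \<rho> X"
  using assms by (auto simp: comps_presented vscale_presented coord_coset lin_scale)

lemma pcomp_basis:
  assumes "realizable A \<rho>" "realizable B \<rho>'" "a \<in> A" "(A - {a}) \<inter> B = {}"
  shows "pcomp multi_as A a B (basis A \<rho>) (basis B \<rho>') = basis (A - {a} \<union> B) (comp_rel a B \<rho> \<rho>')"
proof -
  obtain s t where st: "valid A s" "rel s = \<rho>" "valid B t" "rel t = \<rho>'"
    using assms by (auto simp: realizable_def)
  then have "valid (A - {a} \<union> B) (graft a s t)" "rel (graft a s t) = comp_rel a B \<rho> \<rho>'"
    using assms valid_graft[of A s B t a] rel_graft[of s a t] by (simp_all add: valid_def)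
  then show ?thesis
    using assms(3,4) st by (simp add: basis_eq[OF st(1)] basis_eq[OF st(3)] basis_eq pcomp_presented)
qed

lemma comps_multi_as_induct [consumes 1, case_names zero basis add]:
  assumes "X \<in> comps multi_as A" and "Q (vzero multi_as A)"
    and "\<And>\<rho> c. realizable A \<rho> \<Longrightarrow> Q (vscale multi_as A c (basis A \<rho>))"
    and "\<And>X Y. X \<in> comps multi_as A \<Longrightarrow> Y \<in> comps multi_as A \<Longrightarrow> Q X \<Longrightarrow> Q Y \<Longrightarrow> Q (vadd multi_as A X Y)"
  shows "Q X"
proof -
  obtain f where f: "f \<in> free_comps A" "X = ideal_coset assoc_relators A f"
    using assms(1) by (auto simp: comps_presented)
  have "Q (ideal_coset assoc_relators A f)" using f(1)
  proof (induction rule: free_comps_induct)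
    case zero
    then show ?case using assms(2) by (simp add: vzero_presented)
  next
    case (single t c)
    then have "realizable A (rel t)" by (auto simp: realizable_def)
    then show ?case using assms(3)[of "rel t" c] single by (simp add: basis_eq vscale_presented)
  next
    case (add f g)
    then have "Q (vadd multi_as A (ideal_coset assoc_relators A f) (ideal_coset assoc_relators A g))"
      by (intro assms(4)) (auto simp: comps_presented)
    then show ?case by (simp add: vadd_presented)
  qed
  then show ?thesis using f by simp
qed

section \<open>Alternating cochains of flag complexes\<close>

definition compat :: "'x set \<Rightarrow> 'x set \<Rightarrow> bool" where
  "compat u v \<longleftrightarrow> u \<subseteq> v \<or> v \<subseteq> u \<or> u \<inter> v = {}"

lemma compat_sym: "compat u v \<Longrightarrow> compat v u"
  by (auto simp: compat_def)

lemma compat_refl [simp]: "compat u u"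
  by (simp add: compat_def)

definition flag :: "'x set set \<Rightarrow> nat \<Rightarrow> 'x set list \<Rightarrow> bool" where
  "flag V k es \<longleftrightarrow> length es = k \<and> distinct es \<and> set es \<subseteq> V \<and> (\<forall>u\<in>set es. \<forall>v\<in>set es. compat u v)"

text \<open>The link of \<open>v\<close>. In a flag complex it is again a flag complex, determined
  by its vertex set alone.\<close>

definition star_link :: "'x set set \<Rightarrow> 'x set \<Rightarrow> 'x set set" where
  "star_link V v = {u \<in> V - {v}. compat u v}"

lemma flag_Cons: "v \<in> V \<Longrightarrow> flag V (Suc k) (v # es) \<longleftrightarrow> flag (star_link V v) k es"
  by (auto simp: flag_def star_link_def compat_sym)

lemma flag_cong_set: "length es = length es' \<Longrightarrow> set es = set es' \<Longrightarrow> flag V k es \<longleftrightarrow> flag V k es'"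
  unfolding flag_def by (metis card_distinct distinct_card)

lemma flag_mono: "flag V k es \<Longrightarrow> set es \<subseteq> W \<Longrightarrow> flag W k es"
  by (auto simp: flag_def)

lemma flag_drop_mid: "flag V (Suc k) (xs @ v # ys) \<Longrightarrow> flag V k (xs @ ys)"
  by (auto simp: flag_def)

section \<open>Alternating cochains and their coboundary\<close>

definition alternating :: "'x set set \<Rightarrow> nat \<Rightarrow> ('x set list \<Rightarrow> 'k::ab_group_add) \<Rightarrow> bool" where
  "alternating V k \<phi> \<longleftrightarrow> (\<forall>es1 e e' es2. flag V k (es1 @ e # e' # es2) \<longrightarrow>
     \<phi> (es1 @ e' # e # es2) = - \<phi> (es1 @ e # e' # es2))"

lemma alternatingD:
  "alternating V k \<phi> \<Longrightarrow> flag V k (es1 @ e # e' # es2) \<Longrightarrow>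
     \<phi> (es1 @ e' # e # es2) = - \<phi> (es1 @ e # e' # es2)"
  by (auto simp: alternating_def)

lemma alternating_Cons:
  assumes "alternating V (Suc k) \<phi>" "v \<in> V"
  shows "alternating (star_link V v) k (\<lambda>es. \<phi> (v # es))"
  unfolding alternating_def
  using alternatingD[OF assms(1), of "v # _"] flag_Cons[OF assms(2)] by simp

lemma alternating_mono: "alternating V k \<phi> \<Longrightarrow> W \<subseteq> V \<Longrightarrow> alternating W k \<phi>"
proof -
  assume "alternating V k \<phi>" "W \<subseteq> V"
  moreover have "flag V k es" if "flag W k es" for es
    using flag_mono[OF that] that \<open>W \<subseteq> V\<close> by (auto simp: flag_def)
  ultimately show ?thesis by (simp add: alternating_def)
qed

lemma alternating_move_front:
  fixes \<phi> :: "'x set list \<Rightarrow> 'k::ring_1"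
  assumes "alternating V k \<phi>" "flag V k (xs @ v # ys)"
  shows "\<phi> (xs @ v # ys) = (- 1) ^ length xs * \<phi> (v # xs @ ys)"
  using assms(2)
proof (induction xs arbitrary: ys rule: rev_induct)
  case (snoc x xs)
  have *: "flag V k (xs @ v # x # ys)"
    using snoc.prems by (subst flag_cong_set[of _ "(xs @ [x]) @ v # ys"]) auto
  have "\<phi> (xs @ x # v # ys) = - \<phi> (xs @ v # x # ys)"
    by (rule alternatingD[OF assms(1) *])
  also have "\<phi> (xs @ v # x # ys) = (- 1) ^ length xs * \<phi> (v # xs @ x # ys)"
    by (rule snoc.IH[OF *])
  finally show ?case by simp
qed simp

definition cob :: "('x list \<Rightarrow> 'k::comm_ring_1) \<Rightarrow> 'x list \<Rightarrow> 'k" where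
  "cob \<phi> es = (\<Sum>i<length es. (- 1) ^ i * \<phi> (take i es @ drop (Suc i) es))"

lemma cob_Nil [simp]: "cob \<phi> [] = 0"
  by (simp add: cob_def)

text \<open>Either the head is omitted, with sign +1, or a later entry, whose position and hence
  sign shift by one. Computations on lists with a distinguished first entry use this
  recursion.\<close>

lemma cob_Cons [simp]: "cob \<phi> (x # xs) = \<phi> xs - cob (\<lambda>es. \<phi> (x # es)) xs"
  by (simp add: cob_def sum.lessThan_Suc_shift sum_negf del: sum.lessThan_Suc)

lemma cob_cong:
  assumes "\<And>xs x ys. es = xs @ x # ys \<Longrightarrow> \<phi> (xs @ ys) = \<psi> (xs @ ys)"
  shows "cob \<phi> es = cob \<psi> es"
  unfolding cob_def
proof (rule sum.cong[OF refl])
  fix i assume "i \<in> {..<length es}"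
  then have "es = take i es @ es ! i # drop (Suc i) es" by (simp add: id_take_nth_drop)
  from assms[OF this] show "(- 1) ^ i * \<phi> (take i es @ drop (Suc i) es) = (- 1) ^ i * \<psi> (take i es @ drop (Suc i) es)"
    by simp
qed

lemma cob_zero [simp]: "cob (\<lambda>es. 0) xs = 0"
  by (simp add: cob_def)

lemma cob_minus: "cob (\<lambda>es. - \<phi> es) xs = - cob \<phi> xs"
  by (simp add: cob_def sum_negf)

lemma cob_diff: "cob (\<lambda>es. \<phi> es - \<psi> es) xs = cob \<phi> xs - cob \<psi> xs"
  by (simp add: cob_def sum_subtractf algebra_simps)

text \<open>Exchanging \<open>e\<close> and \<open>e'\<close> exchanges the two summands that omit
  one of them, which carry opposite signs; every other summand changes sign because
  \<open>\<phi>\<close> alternates. Entries before \<open>e\<close> are stripped off by passing to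
  the link of the first one.\<close>

lemma alternating_cob:
  assumes "alternating V k \<phi>"
  shows "alternating V (Suc k) (cob \<phi>)"
  unfolding alternating_def
proof (intro allI impI)
  fix es1 e e' es2
  assume "flag V (Suc k) (es1 @ e # e' # es2)"
  then show "cob \<phi> (es1 @ e' # e # es2) = - cob \<phi> (es1 @ e # e' # es2)"
    using assms
  proof (induction es1 arbitrary: V k \<phi>)
    case Nil
    have "cob (\<lambda>es. \<phi> (e' # e # es)) es2 = cob (\<lambda>es. - \<phi> (e # e' # es)) es2"
    proof (rule cob_cong)
      fix xs x ys assume "es2 = xs @ x # ys"
      then have "flag V k ([] @ e # e' # xs @ ys)"
        using flag_drop_mid[of V k "e # e' # xs" x ys] Nil by simp
      then show "\<phi> (e' # e # xs @ ys) = - \<phi> (e # e' # xs @ ys)"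
        using alternatingD[OF Nil(2)] by (metis append_Nil)
    qed
    then show ?case by (simp add: cob_minus)
  next
    case (Cons x es1)
    have x: "x \<in> V" using Cons.prems by (auto simp: flag_def)
    have fl: "flag (star_link V x) k (es1 @ e # e' # es2)"
      using Cons.prems flag_Cons[OF x] by simp
    show ?case
    proof (cases k)
      case 0
      then show ?thesis using fl by (simp add: flag_def)
    next
      case (Suc j)
      have "flag V k (es1 @ e # e' # es2)"
        using Cons.prems(1) by (auto simp: flag_def)
      then have "\<phi> (es1 @ e' # e # es2) = - \<phi> (es1 @ e # e' # es2)"
        by (rule alternatingD[OF Cons.prems(2)])
      moreover have "cob (\<lambda>es. \<phi> (x # es)) (es1 @ e' # e # es2) = - cob (\<lambda>es. \<phi> (x # es)) (es1 @ e # e' # es2)"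
        by (rule Cons.IH[of "star_link V x" j]) (use fl Suc Cons.prems x alternating_Cons in auto)
      ultimately show ?thesis by simp
    qed
  qed
qed

text \<open>Moving \<open>v\<close> to the front costs a sign that depends only on its position, so
  both cochains are determined by lists starting with \<open>v\<close>.\<close>

lemma alternating_eqI:
  fixes \<phi> \<psi> :: "'x set list \<Rightarrow> 'k::ring_1"
  assumes "alternating V k \<phi>" "alternating V k \<psi>"
    and "\<And>es. flag V k (v # es) \<Longrightarrow> \<phi> (v # es) = \<psi> (v # es)"
    and "flag V k es" "v \<in> set es"
  shows "\<phi> es = \<psi> es"
proof -
  obtain xs ys where es: "es = xs @ v # ys" using assms(5) by (meson split_list)
  have "flag V k (v # xs @ ys)" using assms(4) es by (subst flag_cong_set[of _ es]) auto
  then show ?thesis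
    using alternating_move_front[OF assms(1)] alternating_move_front[OF assms(2)] assms(3,4) es by metis
qed

text \<open>A list of \<open>k\<close> compatible vertices spans a simplex of dimension \<open>k - 1\<close>; degree 0 belongs to
  the empty simplex, so exactness means vanishing of the reduced cohomology.\<close>

definition flag_exact :: "'k::comm_ring_1 itself \<Rightarrow> 'x set set \<Rightarrow> nat \<Rightarrow> bool" where
  "flag_exact (K :: 'k itself) V k \<longleftrightarrow> (\<forall>\<phi> :: 'x set list \<Rightarrow> 'k.
     alternating V k \<phi> \<and> (\<forall>es. flag V (Suc k) es \<longrightarrow> cob \<phi> es = 0) \<longrightarrow>
       (case k of 0 \<Rightarrow> \<phi> [] = 0
        | Suc j \<Rightarrow> \<exists>\<psi>. alternating V j \<psi> \<and> (\<forall>es. flag V k es \<longrightarrow> \<phi> es = cob \<psi> es)))"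

lemma flag_exact_empty: "k \<noteq> 0 \<Longrightarrow> flag_exact K {} k"
  by (cases k) (auto simp: flag_exact_def flag_def alternating_def intro!: exI[of _ "\<lambda>_. 0"])

text \<open>Prefixing the apex is a contracting homotopy: for a cocycle \<open>\<phi>\<close> the
  cochain \<open>\<phi> (e # es)\<close> is a primitive. In degree 0 the flag \<open>[e]\<close>
  alone forces \<open>\<phi> []\<close> to vanish.\<close>

lemma flag_exact_cone:
  assumes e: "e \<in> V" "\<And>u. u \<in> V \<Longrightarrow> compat u e"
  shows "flag_exact (K :: 'k::comm_ring_1 itself) V k"
  unfolding flag_exact_def
proof (intro allI impI, elim conjE)
  fix \<phi> :: "'a set list \<Rightarrow> 'k"
  assume alt: "alternating V k \<phi>" and closed: "\<forall>es. flag V (Suc k) es \<longrightarrow> cob \<phi> es = 0"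
  have cons: "flag V (Suc j) (e # es) \<longleftrightarrow> flag V j es" if "e \<notin> set es" for j es
    using that e by (auto simp: flag_def compat_sym)
  show "case k of 0 \<Rightarrow> \<phi> [] = 0
        | Suc j \<Rightarrow> \<exists>\<psi>. alternating V j \<psi> \<and> (\<forall>es. flag V k es \<longrightarrow> \<phi> es = cob \<psi> es)"
  proof (cases k)
    case 0
    have "flag V 1 [e]" using e by (simp add: flag_def)
    then show ?thesis using closed 0 by force
  next
    case (Suc j)
    \<comment> \<open>The default 0 is for lists that already contain \<open>e\<close>, where
      \<open>e # es\<close> is no flag; with it \<open>cob \<psi> (e # es)\<close> reduces to
      \<open>\<psi> es\<close>.\<close>
    define \<psi> where "\<psi> es = (if e \<in> set es then 0 else \<phi> (e # es))" for es
    have alt\<psi>: "alternating V j \<psi>"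
      unfolding alternating_def
    proof (intro allI impI)
      fix es1 a b es2 assume *: "flag V j (es1 @ a # b # es2)"
      show "\<psi> (es1 @ b # a # es2) = - \<psi> (es1 @ a # b # es2)"
        using alternatingD[OF alt, of "e # es1" a b es2] cons[of "es1 @ a # b # es2" j] * Suc
        by (auto simp: \<psi>_def)
    qed
    moreover have "\<phi> es = cob \<psi> es" if es: "flag V k es" for es
    proof (cases "e \<in> set es")
      case True
      show ?thesis
      proof (rule alternating_eqI[OF alt _ _ es True])
        show "alternating V k (cob \<psi>)" using alternating_cob[OF alt\<psi>] Suc by simp
        fix es assume "flag V k (e # es)"
        moreover have "cob (\<lambda>es. \<psi> (e # es)) es = cob (\<lambda>es. 0) es" by (rule cob_cong) (simp add: \<psi>_def)
        ultimately show "\<phi> (e # es) = cob \<psi> (e # es)" by (auto simp: \<psi>_def flag_def cob_zero)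
      qed
    next
      case False
      have "cob \<phi> (e # es) = 0" using closed cons[OF False] es by blast
      moreover have "cob (\<lambda>es. \<phi> (e # es)) es = cob \<psi> es"
        by (rule cob_cong) (use False in \<open>auto simp: \<psi>_def\<close>)
      ultimately show ?thesis by simp
    qed
    ultimately show ?thesis using Suc by auto
  qed
qed

text \<open>The passage from deletion and link to the whole complex, usually read off a long exact
  sequence. A primitive on the deletion is corrected, on the lists containing \<open>v\<close>, by a
  primitive on the link, which lives one degree lower.\<close>

lemma flag_exact_delete:
  assumes v: "v \<in> V" and del: "flag_exact (K :: 'k::comm_ring_1 itself) (V - {v}) k"
    and link: "\<And>j. k = Suc j \<Longrightarrow> flag_exact K (star_link V v) j"
  shows "flag_exact K V k"
  unfolding flag_exact_def
proof (intro allI impI, elim conjE)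
  fix \<phi> :: "'a set list \<Rightarrow> 'k"
  assume alt: "alternating V k \<phi>" and closed: "\<forall>es. flag V (Suc k) es \<longrightarrow> cob \<phi> es = 0"
  have alt': "alternating (V - {v}) k \<phi>" by (rule alternating_mono[OF alt]) auto
  have closed': "\<forall>es. flag (V - {v}) (Suc k) es \<longrightarrow> cob \<phi> es = 0"
    using closed flag_mono by (auto simp: flag_def)
  show "case k of 0 \<Rightarrow> \<phi> [] = 0
        | Suc j \<Rightarrow> \<exists>\<psi>. alternating V j \<psi> \<and> (\<forall>es. flag V k es \<longrightarrow> \<phi> es = cob \<psi> es)"
  proof (cases k)
    case 0
    then show ?thesis using del alt' closed' by (auto simp: flag_exact_def)
  next
    case (Suc j)
    obtain \<psi>0 where \<psi>0: "alternating (V - {v}) j \<psi>0" "\<And>es. flag (V - {v}) k es \<Longrightarrow> \<phi> es = cob \<psi>0 es"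
      using del alt' closed' Suc unfolding flag_exact_def by fastforce
    let ?L = "star_link V v"
    have L: "?L \<subseteq> V - {v}" by (auto simp: star_link_def)
    \<comment> \<open>The discrepancy, on lists starting with \<open>v\<close>, between
      \<open>\<phi>\<close> and the coboundary of \<open>\<psi>0\<close> extended by zero; it is a
      cocycle of the link.\<close>
    define \<chi> where "\<chi> es = \<phi> (v # es) - \<psi>0 es" for es
    have alt\<chi>: "alternating ?L j \<chi>"
      using alternating_Cons[OF alt[unfolded Suc] v] alternating_mono[OF \<psi>0(1) L]
      by (simp add: alternating_def \<chi>_def)
    have closed\<chi>: "cob \<chi> es = 0" if es: "flag ?L (Suc j) es" for es
    proof -
      have "flag V (Suc k) (v # es)" using es flag_Cons[OF v] Suc by simp
      then have "cob \<phi> (v # es) = 0" using closed by blast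
      then have "\<phi> es = cob (\<lambda>es. \<phi> (v # es)) es" by simp
      moreover have "\<phi> es = cob \<psi>0 es" using \<psi>0(2) es L Suc by (auto simp: flag_def)
      moreover have "cob \<chi> es = cob (\<lambda>es. \<phi> (v # es)) es - cob \<psi>0 es"
        unfolding cob_diff[symmetric] \<chi>_def ..
      ultimately show ?thesis by simp
    qed
    obtain \<xi> where alt\<xi>: "\<And>i. j = Suc i \<Longrightarrow> alternating ?L i \<xi>"
      and \<xi>: "\<And>es. flag ?L j es \<Longrightarrow> \<chi> es = cob \<xi> es"
    proof (cases j)
      case 0
      \<comment> \<open>In link degree 0 there is no lower cochain: exactness says that
        \<open>\<chi>\<close> vanishes, and \<open>cob\<close> of anything is 0 on the empty list,
        so any \<open>\<xi>\<close> will do.\<close>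
      then have "\<chi> [] = 0" using link[OF Suc] alt\<chi> closed\<chi> by (auto simp: flag_exact_def)
      then show ?thesis using that[of "\<lambda>_. 0"] 0 by (auto simp: flag_def)
    next
      case (Suc i)
      then show ?thesis using link[OF \<open>k = Suc j\<close>] alt\<chi> closed\<chi> that
        unfolding flag_exact_def by fastforce
    qed
    \<comment> \<open>The power of -1 accounts for moving \<open>v\<close> to the front. The leading
      minus cancels the one in \<open>cob_Cons\<close>, so that on flags
      \<open>cob \<psi> (v # es)\<close> is \<open>\<psi>0 es + cob \<xi> es\<close>.\<close>
    define \<psi> where "\<psi> es = (if v \<in> set es
      then - ((- 1) ^ length (takeWhile (\<lambda>x. x \<noteq> v) es) * \<xi> (remove1 v es)) else \<psi>0 es)" for es
    have \<psi>_split: "\<psi> (xs @ v # ys) = - ((- 1) ^ length xs * \<xi> (xs @ ys))" if "v \<notin> set xs" for xs ys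
    proof -
      have "takeWhile (\<lambda>x. x \<noteq> v) (xs @ v # ys) = xs" using that by (induction xs) auto
      then show ?thesis using that by (simp add: \<psi>_def remove1_append)
    qed
    have alt\<psi>: "alternating V j \<psi>"
      unfolding alternating_def
    proof (intro allI impI)
      fix es1 a b es2 assume *: "flag V j (es1 @ a # b # es2)"
      show "\<psi> (es1 @ b # a # es2) = - \<psi> (es1 @ a # b # es2)"
      proof (cases "v \<in> set (es1 @ a # b # es2)")
        case False
        then show ?thesis using alternatingD[OF \<psi>0(1), of es1 a b es2] * by (auto simp: \<psi>_def flag_def)
      next
        case True
        obtain i where i: "j = Suc i" using * by (cases j) (auto simp: flag_def)
        consider "v = a" "v \<notin> set es1" | "v = b" "v \<notin> set es1" "v \<noteq> a"
          | xs ys where "es1 = xs @ v # ys" "v \<notin> set xs"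
          | xs ys where "es2 = xs @ v # ys" "v \<notin> set xs" "v \<notin> set es1" "v \<noteq> a" "v \<noteq> b"
          using True by (metis Un_iff set_ConsD set_append split_list_first)
        then show ?thesis
        proof cases
          case 1
          then show ?thesis using \<psi>_split[of es1 "b # es2"] \<psi>_split[of "es1 @ [b]" es2] *
            by (auto simp: flag_def)
        next
          case 2
          then show ?thesis using \<psi>_split[of es1 "a # es2"] \<psi>_split[of "es1 @ [a]" es2] by simp
        next
          case 3
          have "flag V (Suc i) (v # xs @ ys @ a # b # es2)"
            using * 3 i by (subst flag_cong_set[of _ "es1 @ a # b # es2"]) auto
          then have "flag ?L i ((xs @ ys) @ a # b # es2)" using flag_Cons[OF v] by simp
          from alternatingD[OF alt\<xi>[OF i] this] show ?thesis
            using 3 \<psi>_split[of xs] by simp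
        next
          case 4
          have "flag V (Suc i) (v # es1 @ a # b # xs @ ys)"
            using * 4 i by (subst flag_cong_set[of _ "es1 @ a # b # es2"]) auto
          then have "flag ?L i (es1 @ a # b # xs @ ys)" using flag_Cons[OF v] by simp
          from alternatingD[OF alt\<xi>[OF i] this] show ?thesis
            using 4 \<psi>_split[of "es1 @ a # b # xs" ys] \<psi>_split[of "es1 @ b # a # xs" ys] by simp
        qed
      qed
    qed
    moreover have "\<phi> es = cob \<psi> es" if es: "flag V k es" for es
    proof (cases "v \<in> set es")
      case True
      show ?thesis
      proof (rule alternating_eqI[OF alt _ _ es True])
        show "alternating V k (cob \<psi>)" using alternating_cob[OF alt\<psi>] Suc by simp
        fix es assume *: "flag V k (v # es)"
        then have "v \<notin> set es" by (simp add: flag_def)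
        then have "\<psi> es = \<psi>0 es" by (simp add: \<psi>_def)
        moreover have "cob (\<lambda>es. \<psi> (v # es)) es = cob (\<lambda>es. - \<xi> es) es"
          by (rule cob_cong) (use \<psi>_split[of "[]"] in simp)
        moreover have "\<chi> es = cob \<xi> es" using \<xi> flag_Cons[OF v] * Suc by blast
        ultimately show "\<phi> (v # es) = cob \<psi> (v # es)" by (simp add: \<chi>_def cob_minus algebra_simps)
      qed
    next
      case False
      then have "flag (V - {v}) k es" using es by (auto simp: flag_def)
      then have "\<phi> es = cob \<psi>0 es" by (rule \<psi>0(2))
      also have "\<dots> = cob \<psi> es" by (rule cob_cong) (use False in \<open>auto simp: \<psi>_def\<close>)
      finally show ?thesis .
    qed
    ultimately show ?thesis using Suc by auto
  qed
qed

section \<open>Intervals\<close>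

lemma inj_on_image_subset_iff:
  assumes "inj_on f C" "A \<subseteq> C" "B \<subseteq> C"
  shows "f ` A \<subseteq> f ` B \<longleftrightarrow> A \<subseteq> B"
proof
  assume "f ` A \<subseteq> f ` B"
  show "A \<subseteq> B"
  proof
    fix x assume "x \<in> A"
    then have "f x \<in> f ` B" "x \<in> C" using \<open>f ` A \<subseteq> f ` B\<close> assms(2) by auto
    then show "x \<in> B" by (simp add: inj_on_image_mem_iff[OF assms(1) _ assms(3)])
  qed
qed (rule image_mono)

lemma compat_image:
  fixes i j i' j' n :: nat
  assumes "inj_on f {..<n}" "i < j" "j \<le> n" "i' < j'" "j' \<le> n"
  shows "compat (f ` {i..<j}) (f ` {i'..<j'}) \<longleftrightarrow> j \<le> i' \<or> j' \<le> i \<or> (i' \<le> i \<and> j \<le> j') \<or> (i \<le> i' \<and> j' \<le> j)"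
proof -
  have sub: "{i..<j} \<subseteq> {..<n}" "{i'..<j'} \<subseteq> {..<n}" using assms by auto
  have "f ` {i..<j} \<subseteq> f ` {i'..<j'} \<longleftrightarrow> {i..<j} \<subseteq> {i'..<j'}"
    by (rule inj_on_image_subset_iff[OF assms(1) sub])
  moreover have "f ` {i'..<j'} \<subseteq> f ` {i..<j} \<longleftrightarrow> {i'..<j'} \<subseteq> {i..<j}"
    by (rule inj_on_image_subset_iff[OF assms(1) sub(2,1)])
  moreover have "f ` {i..<j} \<inter> f ` {i'..<j'} = f ` ({i..<j} \<inter> {i'..<j'})"
    by (rule inj_on_image_Int[OF assms(1) sub, symmetric])
  moreover have "{i..<j} \<inter> {i'..<j'} = {} \<longleftrightarrow> j \<le> i' \<or> j' \<le> i"
    using assms(2,4) by auto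
  ultimately show ?thesis using assms(2,4) by (auto simp: compat_def)
qed

lemma image_interval_eq_iff:
  fixes i j i' j' n :: nat
  assumes "inj_on f {..<n}" "i < j" "j \<le> n" "i' < j'" "j' \<le> n"
  shows "f ` {i..<j} = f ` {i'..<j'} \<longleftrightarrow> i = i' \<and> j = j'"
proof -
  have "f ` {i..<j} = f ` {i'..<j'} \<longleftrightarrow> {i..<j} = {i'..<j'}"
    by (rule inj_on_image_eq_iff[OF assms(1)]) (use assms in auto)
  then show ?thesis using assms by (simp add: atLeastLessThan_eq_iff)
qed

text \<open>\<open>p\<close> records the progress of the deletion: for \<open>p = 1\<close> all
  proper intervals of \<open>{m..<n}\<close> of length at least 2 are present, and raising
  \<open>p\<close> by one removes \<open>{m + p..<n}\<close>. The map \<open>f\<close> lists the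
  leaves, so that the members are sets of leaves.\<close>

definition intervals :: "(nat \<Rightarrow> 'x) \<Rightarrow> nat \<Rightarrow> nat \<Rightarrow> nat \<Rightarrow> 'x set set" where
  "intervals f n m p = {f ` {i..<j} | i j. m \<le> i \<and> i + 2 \<le> j \<and> j \<le> n \<and> (i, j) \<noteq> (m, n) \<and> (j = n \<longrightarrow> m + p \<le> i)}"

lemma intervalsI:
  assumes "m \<le> i" "i + 2 \<le> j" "j \<le> n" "(i, j) \<noteq> (m, n)" "j = n \<longrightarrow> m + p \<le> i"
  shows "f ` {i..<j} \<in> intervals f n m p"
  unfolding intervals_def by (intro CollectI exI[of _ i] exI[of _ j] conjI refl assms)

lemma intervalsE:
  assumes "u \<in> intervals f n m p"
  obtains i j where "u = f ` {i..<j}" "m \<le> i" "i + 2 \<le> j" "j \<le> n" "(i, j) \<noteq> (m, n)" "j = n \<longrightarrow> m + p \<le> i"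
  using assms unfolding intervals_def by (elim CollectE exE conjE)

lemma intervals_delete:
  assumes inj: "inj_on f {..<n}" and "1 \<le> p" "m + p + 2 \<le> n"
  shows "f ` {m + p..<n} \<in> intervals f n m p"
    and "intervals f n m p - {f ` {m + p..<n}} = intervals f n m (Suc p)"
proof -
  show "f ` {m + p..<n} \<in> intervals f n m p"
    by (rule intervalsI) (use assms(2,3) in auto)
  show "intervals f n m p - {f ` {m + p..<n}} = intervals f n m (Suc p)" (is "?L = ?R")
  proof (intro set_eqI iffI)
    fix u assume "u \<in> ?L"
    then have *: "u \<in> intervals f n m p" and ne: "u \<noteq> f ` {m + p..<n}" by simp_all
    from * obtain i j where u: "u = f ` {i..<j}" "m \<le> i" "i + 2 \<le> j" "j \<le> n" "(i, j) \<noteq> (m, n)" "j = n \<longrightarrow> m + p \<le> i"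
      by (rule intervalsE)
    have "j = n \<longrightarrow> i \<noteq> m + p" using u ne by auto
    then show "u \<in> ?R" using u by (auto intro!: intervalsI)
  next
    fix u assume "u \<in> ?R"
    then obtain i j where u: "u = f ` {i..<j}" "m \<le> i" "i + 2 \<le> j" "j \<le> n" "(i, j) \<noteq> (m, n)" "j = n \<longrightarrow> m + Suc p \<le> i"
      by (rule intervalsE)
    then have "u \<noteq> f ` {m + p..<n}"
      using image_interval_eq_iff[OF inj, of i j "m + p" n] assms(3) by auto
    then show "u \<in> ?L" using u by (auto intro!: intervalsI)
  qed
qed

text \<open>From \<open>p = 2\<close> on, \<open>{m..<m + p}\<close> has two elements and can serve
  as apex. The intervals still present that reach the end start at \<open>m + p\<close> or later, so
  in the link of \<open>{m + p..<n}\<close> every interval lies inside that one or ends by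
  \<open>m + p\<close>; either way it is compatible with the apex.\<close>

lemma flag_exact_intervals_cone:
  assumes inj: "inj_on f {..<n}" and "2 \<le> p" "m + p < n"
  shows "flag_exact K (intervals f n m p) k"
  using assms(2,3)
proof (induction "n - (m + p)" arbitrary: p k)
  case 0
  then show ?case by simp
next
  case (Suc d p k)
  have apex: "f ` {m..<m + p} \<in> intervals f n m p"
    by (rule intervalsI) (use Suc.prems in auto)
  show ?case
  proof (cases "m + p + 2 \<le> n")
    case False
    \<comment> \<open>Here \<open>m + p = n - 1\<close>: no interval of length 2 reaches the end any
      more, and all of them lie in the apex.\<close>
    have "compat u (f ` {m..<m + p})" if u: "u \<in> intervals f n m p" for u
    proof -
      from u obtain i j where "u = f ` {i..<j}" "m \<le> i" "i + 2 \<le> j" "j \<le> n" "(i, j) \<noteq> (m, n)" "j = n \<longrightarrow> m + p \<le> i"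
        by (rule intervalsE)
      then show ?thesis using False Suc.prems compat_image[OF inj, of i j m "m + p"] by auto
    qed
    then show ?thesis by (rule flag_exact_cone[OF apex])
  next
    case True
    let ?v = "f ` {m + p..<n}"
    show ?thesis
    proof (rule flag_exact_delete[of ?v])
      show "?v \<in> intervals f n m p" using intervals_delete[OF inj] True Suc.prems by simp
      show "flag_exact K (intervals f n m p - {?v}) k"
        using Suc.hyps(1)[of "Suc p"] Suc.hyps(2) Suc.prems True intervals_delete[OF inj, of p m] by simp
    next
      fix l assume "k = Suc l"
      show "flag_exact K (star_link (intervals f n m p) ?v) l"
      proof (rule flag_exact_cone[of "f ` {m..<m + p}"])
        show "f ` {m..<m + p} \<in> star_link (intervals f n m p) ?v"
          using apex compat_image[OF inj, of m "m + p" "m + p" n]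
            image_interval_eq_iff[OF inj, of m "m + p" "m + p" n] Suc.prems by (auto simp: star_link_def)
      next
        fix u assume "u \<in> star_link (intervals f n m p) ?v"
        then have *: "u \<in> intervals f n m p" and c: "compat u ?v" by (simp_all add: star_link_def)
        from * obtain i j where u: "u = f ` {i..<j}" "m \<le> i" "i + 2 \<le> j" "j \<le> n" "(i, j) \<noteq> (m, n)" "j = n \<longrightarrow> m + p \<le> i"
          by (rule intervalsE)
        with c show "compat u (f ` {m..<m + p})"
          using compat_image[OF inj, of i j "m + p" n] compat_image[OF inj, of i j m "m + p"] True Suc.prems
          by auto
      qed
    qed
  qed
qed

text \<open>The proper intervals of length at least 2 of \<open>{m..<n}\<close> form the dual of the boundary of an
  associahedron, a sphere whose top simplices have \<open>n - m - 2\<close> vertices.\<close>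

lemma flag_exact_intervals:
  assumes inj: "inj_on f {..<n}" and "m + 2 \<le> n" "k \<noteq> n - m - 2"
  shows "flag_exact K (intervals f n m 1) k"
  using assms(2,3)
proof (induction "n - m - 2" arbitrary: m k)
  case 0
  \<comment> \<open>Two points have no proper interval of length 2; the empty complex has reduced
    cohomology only in degree 0, which is the excluded one.\<close>
  then have "intervals f n m 1 = {}" by (auto elim!: intervalsE)
  then show ?case using 0 by (simp add: flag_exact_empty)
next
  case (Suc d m k)
  let ?v = "f ` {m + 1..<n}"
  have n: "m + 1 + 2 \<le> n" using Suc.hyps(2) by simp
  show ?case
  \<comment> \<open>Without \<open>?v\<close> the complex has \<open>p = 2\<close> and is exact in
    all degrees. The only obstruction comes from the link, the same complex on
    \<open>{m + 1..<n}\<close>, with \<open>k\<close> and the excluded degree both lowered by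
    one.\<close>
  proof (rule flag_exact_delete[of ?v])
    show "?v \<in> intervals f n m 1" using intervals_delete(1)[OF inj, of 1 m] n by simp
    show "flag_exact K (intervals f n m 1 - {?v}) k"
      using flag_exact_intervals_cone[OF inj, of 2 m] intervals_delete[OF inj, of 1 m] n by (simp add: numeral_2_eq_2)
  next
    fix l assume l: "k = Suc l"
    have "star_link (intervals f n m 1) ?v = intervals f n (m + 1) 1" (is "?L = ?R")
    proof (intro set_eqI iffI)
      fix u assume "u \<in> ?L"
      then have *: "u \<in> intervals f n m 1" and c: "compat u ?v" "u \<noteq> ?v" by (simp_all add: star_link_def)
      from * obtain i j where u: "u = f ` {i..<j}" "m \<le> i" "i + 2 \<le> j" "j \<le> n" "(i, j) \<noteq> (m, n)" "j = n \<longrightarrow> m + 1 \<le> i"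
        by (rule intervalsE)
      \<comment> \<open>An interval starting at \<open>m\<close> has a second element inside
        \<open>?v\<close>, but would have to be everything in order to contain \<open>?v\<close>; so
        it is not compatible with \<open>?v\<close>.\<close>
      have "m + 1 \<le> i" using c u compat_image[OF inj, of i j "m + 1" n] n by auto
      moreover have "(i, j) \<noteq> (m + 1, n)" using c u by auto
      ultimately show "u \<in> ?R" using u by (auto intro!: intervalsI)
    next
      fix u assume "u \<in> ?R"
      then obtain i j where u: "u = f ` {i..<j}" "m + 1 \<le> i" "i + 2 \<le> j" "j \<le> n" "(i, j) \<noteq> (m + 1, n)"
        by (rule intervalsE) simp
      have "u \<noteq> ?v" using u image_interval_eq_iff[OF inj, of i j "m + 1" n] n by auto
      moreover have "compat u ?v" using u compat_image[OF inj, of i j "m + 1" n] n by auto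
      ultimately show "u \<in> ?L" using u by (auto simp: star_link_def intro!: intervalsI)
    qed
    then show "flag_exact K (star_link (intervals f n m 1) ?v) l"
      using Suc.hyps(1)[of "m + 1" l] Suc.hyps(2) Suc.prems l n by simp
  qed
qed

section \<open>Trees\<close>

lemma is_tree_finite: "finite A \<Longrightarrow> is_tree A T \<Longrightarrow> finite T"
  by (rule finite_subset[of _ "Pow A"]) (auto simp: is_tree_def)

lemma is_tree_vertex: "is_tree A T \<Longrightarrow> v \<in> T \<Longrightarrow> v \<subseteq> A \<and> 2 \<le> card v"
  by (auto simp: is_tree_def)

lemma is_tree_laminar: "is_tree A T \<Longrightarrow> u \<in> T \<Longrightarrow> v \<in> T \<Longrightarrow> u \<subseteq> v \<or> v \<subseteq> u \<or> u \<inter> v = {}"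
  unfolding is_tree_def by blast

lemma is_tree_delete: "is_tree A T \<Longrightarrow> e \<noteq> A \<Longrightarrow> is_tree A (T - {e})"
  unfolding is_tree_def by blast

text \<open>Ensures that the two kinds of input labels, vertices and singletons of leaves, never
  coincide.\<close>

lemma is_tree_not_singleton: "is_tree A T \<Longrightarrow> {a} \<notin> T"
  by (auto simp: is_tree_def)

lemma is_tree_nonempty: "is_tree A T \<Longrightarrow> v \<in> T \<Longrightarrow> v \<noteq> {}"
  by (auto simp: is_tree_def)

lemma inputs_psubset: "u \<in> inputs T v \<Longrightarrow> u \<subset> v"
  by (simp add: inputs_def)

lemma inputs_cases: "u \<in> inputs T v \<Longrightarrow> u \<in> T \<or> (\<exists>a\<in>v. u = {a})"
  by (auto simp: inputs_def)

lemma inputs_maximal: "u \<in> inputs T v \<Longrightarrow> w \<in> T \<Longrightarrow> u \<subset> w \<Longrightarrow> w \<subset> v \<Longrightarrow> False"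
  by (auto simp: inputs_def)

lemma inputs_nonempty: "is_tree A T \<Longrightarrow> u \<in> inputs T v \<Longrightarrow> u \<noteq> {}"
  using inputs_cases is_tree_nonempty by fastforce

lemma inputs_disjoint:
  assumes T: "is_tree A T" and u: "u \<in> inputs T v" and w: "w \<in> inputs T v" and "u \<noteq> w"
  shows "u \<inter> w = {}"
proof -
  have "u \<subseteq> w \<or> w \<subseteq> u \<or> u \<inter> w = {}"
    using inputs_cases[OF u] inputs_cases[OF w] is_tree_laminar[OF T, of u w] by blast
  moreover have "\<not> u \<subset> w"
    using inputs_cases[OF w] inputs_maximal[OF u, of w] inputs_psubset[OF w] inputs_nonempty[OF T u] by blast
  moreover have "\<not> w \<subset> u"
    using inputs_cases[OF u] inputs_maximal[OF w, of u] inputs_psubset[OF u] inputs_nonempty[OF T w] by blast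
  ultimately show ?thesis using \<open>u \<noteq> w\<close> by blast
qed

text \<open>A largest set strictly below \<open>v\<close> that contains \<open>a\<close>, among the
  vertices and \<open>{a}\<close>, is an input. Together with \<open>inputs_disjoint\<close> this
  makes the inputs a partition of \<open>v\<close>.\<close>

lemma inputs_cover:
  assumes A: "finite A" and T: "is_tree A T" and v: "v \<in> T" "a \<in> v"
  obtains u where "u \<in> inputs T v" "a \<in> u"
proof -
  let ?S = "{u \<in> insert {a} T. a \<in> u \<and> u \<subset> v}"
  have "{a} \<in> ?S" using v is_tree_not_singleton[OF T, of a] by auto
  then have ne: "?S \<noteq> {}" by blast
  have fin: "finite ?S" using is_tree_finite[OF A T] by simp
  obtain u where ext: "u \<in> ?S" "\<forall>w\<in>?S. u \<subseteq> w \<longrightarrow> u = w"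
    using finite_has_maximal[OF fin ne] by (rule bexE)
  note u = ext(1) ext(2)[rule_format]
  have "\<not> (u \<subset> w \<and> w \<subset> v)" if "w \<in> T" for w
    using u(2)[of w] u(1) that by blast
  then have "u \<in> inputs T v" using u(1) v(2) unfolding inputs_def by blast
  then show ?thesis using that u by blast
qed

lemma parent_unique:
  assumes T: "is_tree A T" and "v \<in> T" "e \<in> inputs T v" "w \<in> T" "e \<in> inputs T w"
  shows "v = w"
  using is_tree_laminar[OF T \<open>v \<in> T\<close> \<open>w \<in> T\<close>] inputs_psubset[OF assms(3)] inputs_psubset[OF assms(5)]
    inputs_maximal[OF assms(3) \<open>w \<in> T\<close>] inputs_maximal[OF assms(5) \<open>v \<in> T\<close>] inputs_nonempty[OF T assms(3)]
  by blast

lemma parent_eq: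
  assumes "is_tree A T" "v \<in> T" "e \<in> inputs T v"
  shows "parent T e = v"
  unfolding parent_def
proof (rule the_equality)
  show "v \<in> T \<and> e \<in> inputs T v" using assms by simp
  show "w = v" if "w \<in> T \<and> e \<in> inputs T w" for w
    using parent_unique[OF assms(1) _ _ assms(2,3), of w] that by simp
qed

lemma parent_exists:
  assumes A: "finite A" and T: "is_tree A T" and e: "e \<in> T" "e \<noteq> A"
  shows "parent T e \<in> T" "e \<in> inputs T (parent T e)"
proof -
  let ?S = "{v \<in> T. e \<subset> v}"
  have "A \<in> ?S" using T e by (auto simp: is_tree_def)
  then have ne: "?S \<noteq> {}" by blast
  have fin: "finite ?S" using is_tree_finite[OF A T] by simp
  obtain v where ext: "v \<in> ?S" "\<forall>w\<in>?S. w \<subseteq> v \<longrightarrow> v = w"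
    using finite_has_minimal[OF fin ne] by (rule bexE)
  note v = ext(1) ext(2)[rule_format]
  have "\<not> (e \<subset> w \<and> w \<subset> v)" if "w \<in> T" for w
    using v(2)[of w] that by blast
  then have ev: "e \<in> inputs T v" using v(1) e(1) unfolding inputs_def by blast
  then have "parent T e = v" using parent_eq[OF T _ ev] v(1) by blast
  then show "parent T e \<in> T" "e \<in> inputs T (parent T e)" using v(1) ev by simp_all
qed

lemma inputsI:
  "u \<in> T \<or> (\<exists>a\<in>v. u = {a}) \<Longrightarrow> u \<subset> v \<Longrightarrow> (\<And>w. w \<in> T \<Longrightarrow> u \<subset> w \<Longrightarrow> w \<subset> v \<Longrightarrow> False) \<Longrightarrow> u \<in> inputs T v"
  unfolding inputs_def by blast

lemma inputs_delete_other:
  assumes T: "is_tree A T" and "e \<in> T" "w \<in> T" "e \<notin> inputs T w"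
  shows "inputs (T - {e}) w = inputs T w"
proof (intro set_eqI iffI)
  fix u assume u: "u \<in> inputs (T - {e}) w"
  show "u \<in> inputs T w"
  proof (cases "u \<subset> e \<and> e \<subset> w")
    case True
    have "e \<in> inputs T w"
    proof (rule inputsI)
      fix x assume "x \<in> T" "e \<subset> x" "x \<subset> w"
      then show False using inputs_maximal[OF u, of x] True by auto
    qed (use True \<open>e \<in> T\<close> in auto)
    then show ?thesis using assms by simp
  next
    case False
    show ?thesis
    proof (rule inputsI)
      show "u \<in> T \<or> (\<exists>a\<in>w. u = {a})" using inputs_cases[OF u] by auto
      show "u \<subset> w" by (rule inputs_psubset[OF u])
      fix x assume "x \<in> T" "u \<subset> x" "x \<subset> w"
      then show False using inputs_maximal[OF u, of x] False by auto
    qed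
  qed
next
  fix u assume u: "u \<in> inputs T w"
  show "u \<in> inputs (T - {e}) w"
  proof (rule inputsI)
    show "u \<in> T - {e} \<or> (\<exists>a\<in>w. u = {a})" using inputs_cases[OF u] u assms by auto
    show "u \<subset> w" by (rule inputs_psubset[OF u])
    fix x assume "x \<in> T - {e}" "u \<subset> x" "x \<subset> w"
    then show False using inputs_maximal[OF u, of x] by auto
  qed
qed

text \<open>This set is exactly the arity of the partial composition along \<open>e\<close>, so
  contracted decorations have the right arity at the parent.\<close>

lemma inputs_delete_parent:
  assumes T: "is_tree A T" and "e \<in> T" "p \<in> T" and e: "e \<in> inputs T p"
  shows "inputs (T - {e}) p = inputs T p - {e} \<union> inputs T e"
proof (intro set_eqI iffI)
  have ep: "e \<subset> p" by (rule inputs_psubset[OF e])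
  fix u assume u: "u \<in> inputs (T - {e}) p"
  have up: "u \<subset> p" by (rule inputs_psubset[OF u])
  show "u \<in> inputs T p - {e} \<union> inputs T e"
  proof (cases "u \<subset> e")
    case True
    have "u \<in> inputs T e"
    proof (rule inputsI)
      show "u \<in> T \<or> (\<exists>a\<in>e. u = {a})" using inputs_cases[OF u] True by auto
      fix x assume x: "x \<in> T" "u \<subset> x" "x \<subset> e"
      then have "x \<in> T - {e}" "x \<subset> p" using ep by auto
      then show False using inputs_maximal[OF u, of x] x by simp
    qed (rule True)
    then show ?thesis by simp
  next
    case False
    have "u \<noteq> e" using inputs_cases[OF u] is_tree_not_singleton[OF T] \<open>e \<in> T\<close> by auto
    have "u \<in> inputs T p"
    proof (rule inputsI)
      show "u \<in> T \<or> (\<exists>a\<in>p. u = {a})" using inputs_cases[OF u] by auto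
      fix x assume x: "x \<in> T" "u \<subset> x" "x \<subset> p"
      then have "x \<in> T - {e}" using False by auto
      then show False using inputs_maximal[OF u, of x] x by simp
    qed (rule up)
    then show ?thesis using \<open>u \<noteq> e\<close> by simp
  qed
next
  have ep: "e \<subset> p" by (rule inputs_psubset[OF e])
  fix u assume "u \<in> inputs T p - {e} \<union> inputs T e"
  then show "u \<in> inputs (T - {e}) p"
  proof
    assume u: "u \<in> inputs T p - {e}"
    then have u': "u \<in> inputs T p" by simp
    show ?thesis
    proof (rule inputsI)
      show "u \<in> T - {e} \<or> (\<exists>a\<in>p. u = {a})" using inputs_cases[OF u'] u by auto
      show "u \<subset> p" by (rule inputs_psubset[OF u'])
      fix x assume "x \<in> T - {e}" "u \<subset> x" "x \<subset> p"
      then show False using inputs_maximal[OF u', of x] by simp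
    qed
  next
    assume u: "u \<in> inputs T e"
    have ue: "u \<subset> e" by (rule inputs_psubset[OF u])
    show ?thesis
    proof (rule inputsI)
      show "u \<in> T - {e} \<or> (\<exists>a\<in>p. u = {a})" using inputs_cases[OF u] ue ep by auto
      show "u \<subset> p" using ue ep by (rule psubset_trans)
      fix x assume x: "x \<in> T - {e}" "u \<subset> x" "x \<subset> p"
      have "x \<inter> e \<noteq> {}" using inputs_nonempty[OF T u] ue x(2) by auto
      then consider "x \<subset> e" | "e \<subset> x" using is_tree_laminar[OF T, of x e] x(1) \<open>e \<in> T\<close> by auto
      then show False using inputs_maximal[OF u, of x] inputs_maximal[OF e, of x] x by cases auto
    qed
  qed
qed

lemma inputs_parent_disjoint:
  assumes T: "is_tree A T" and e: "e \<in> inputs T p"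
  shows "(inputs T p - {e}) \<inter> inputs T e = {}"
proof -
  have False if "u \<in> inputs T p" "u \<noteq> e" "u \<in> inputs T e" for u
    using inputs_disjoint[OF T that(1) e that(2)] inputs_psubset[OF that(3)] inputs_nonempty[OF T that(3)] by blast
  then show ?thesis by blast
qed

section \<open>Modules\<close>

definition is_module :: "'x set \<Rightarrow> ('g \<times> 'x \<times> 'x) set \<Rightarrow> 'x set \<Rightarrow> bool" where
  "is_module A \<rho> v \<longleftrightarrow> v \<subseteq> A \<and> (\<forall>g. \<forall>x\<in>A - v. \<forall>a\<in>v. \<forall>b\<in>v.
     ((g, a, x) \<in> \<rho> \<longleftrightarrow> (g, b, x) \<in> \<rho>) \<and> ((g, x, a) \<in> \<rho> \<longleftrightarrow> (g, x, b) \<in> \<rho>))"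

lemma is_module_singleton [simp]: "a \<in> A \<Longrightarrow> is_module A \<rho> {a}"
  by (auto simp: is_module_def)

lemma is_module_self [simp]: "is_module A \<rho> A"
  by (auto simp: is_module_def)

text \<open>The quotient structure on the blocks in \<open>I\<close>. For disjoint modules it does
  not matter which elements \<open>a\<close> and \<open>b\<close> are taken
  (\<open>module_pair_iff\<close>).\<close>

definition quot_rel :: "('g \<times> 'x \<times> 'x) set \<Rightarrow> 'x set set \<Rightarrow> ('g \<times> 'x set \<times> 'x set) set" where
  "quot_rel \<rho> I = {(g, u, w). u \<in> I \<and> w \<in> I \<and> u \<noteq> w \<and> (\<exists>a\<in>u. \<exists>b\<in>w. (g, a, b) \<in> \<rho>)}"

lemma module_pair_iff:
  assumes "is_module A \<rho> u" "is_module A \<rho> w" "u \<inter> w = {}" "a \<in> u" "a' \<in> u" "b \<in> w" "b' \<in> w"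
  shows "(g, a, b) \<in> \<rho> \<longleftrightarrow> (g, a', b') \<in> \<rho>"
proof -
  have "(g, a, b) \<in> \<rho> \<longleftrightarrow> (g, a', b) \<in> \<rho>" using assms unfolding is_module_def by blast
  also have "\<dots> \<longleftrightarrow> (g, a', b') \<in> \<rho>" using assms unfolding is_module_def by blast
  finally show ?thesis .
qed

lemma quot_rel_iff:
  assumes "is_module A \<rho> u" "is_module A \<rho> w" "u \<inter> w = {}" "u \<in> I" "w \<in> I" "a \<in> u" "b \<in> w"
  shows "(g, u, w) \<in> quot_rel \<rho> I \<longleftrightarrow> (g, a, b) \<in> \<rho>"
proof -
  have "u \<noteq> w" using assms by blast
  then show ?thesis using assms module_pair_iff[OF assms(1-3)] unfolding quot_rel_def by blast
qed

text \<open>A choice of one point per block identifies the quotient with the restriction of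
  \<open>\<rho>\<close> to these points, and restrictions are realizable.\<close>

lemma realizable_quot_rel:
  assumes \<rho>: "realizable A \<rho>" and I: "I \<noteq> {}" "\<And>u. u \<in> I \<Longrightarrow> u \<noteq> {} \<and> is_module A \<rho> u"
    "\<And>u w. u \<in> I \<Longrightarrow> w \<in> I \<Longrightarrow> u \<noteq> w \<Longrightarrow> u \<inter> w = {}"
  shows "realizable I (quot_rel \<rho> I)"
proof -
  define c where "c u = (SOME a. a \<in> u)" for u :: "'a set"
  have c: "c u \<in> u" if "u \<in> I" for u unfolding c_def by (rule some_in_eq[THEN iffD2]) (use I(2) that in blast)
  have inj: "inj_on c I"
  proof (rule inj_onI)
    fix u w assume "u \<in> I" "w \<in> I" "c u = c w"
    then show "u = w" using c[of u] c[of w] I(3)[of u w] by force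
  qed
  define d where "d = inv_into I c"
  have d: "d (c u) = u" if "u \<in> I" for u using inj that by (simp add: d_def)
  let ?X = "c ` I"
  have "?X \<subseteq> A" using c I(2) unfolding is_module_def by blast
  then have "realizable ?X {(g, x, y). (g, x, y) \<in> \<rho> \<and> x \<in> ?X \<and> y \<in> ?X}"
    using realizable_restrict[OF \<rho>] I(1) by blast
  moreover have "inj_on d ?X" by (rule inj_onI) (use d in auto)
  ultimately have "realizable (d ` ?X) ((\<lambda>(g, x, y). (g, d x, d y)) ` {(g, x, y). (g, x, y) \<in> \<rho> \<and> x \<in> ?X \<and> y \<in> ?X})"
    by (rule realizable_image)
  moreover have "d ` ?X = I" using d by force
  moreover have "(\<lambda>(g, x, y). (g, d x, d y)) ` {(g, x, y). (g, x, y) \<in> \<rho> \<and> x \<in> ?X \<and> y \<in> ?X} = quot_rel \<rho> I" (is "?L = _")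
  proof (rule set_eqI, clarify)
    fix g u w
    have "(g, u, w) \<in> ?L \<longleftrightarrow> u \<in> I \<and> w \<in> I \<and> (g, c u, c w) \<in> \<rho>"
      using d by (force simp: image_iff)
    also have "\<dots> \<longleftrightarrow> (g, u, w) \<in> quot_rel \<rho> I"
    proof (cases "u \<in> I \<and> w \<in> I \<and> u \<noteq> w")
      case True
      then have "(g, u, w) \<in> quot_rel \<rho> I \<longleftrightarrow> (g, c u, c w) \<in> \<rho>"
        using I c by (intro quot_rel_iff) auto
      with True show ?thesis by simp
    next
      case False
      then show ?thesis using realizable_irrefl[OF \<rho>] by (auto simp: quot_rel_def)
    qed
    finally show "(g, u, w) \<in> ?L \<longleftrightarrow> (g, u, w) \<in> quot_rel \<rho> I" .
  qed
  ultimately show ?thesis by simp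
qed

text \<open>The trees adapted to \<open>\<rho>\<close> correspond to the decompositions of \<open>\<rho>\<close> under iterated composition;
  the factor at a vertex is the quotient relation on its inputs.\<close>

definition adapted :: "'x set \<Rightarrow> ('g \<times> 'x \<times> 'x) set \<Rightarrow> 'x set set \<Rightarrow> bool" where
  "adapted A \<rho> T \<longleftrightarrow> is_tree A T \<and> (\<forall>v\<in>T. is_module A \<rho> v)"

lemma adapted_inputs_module:
  assumes "adapted A \<rho> T" "v \<in> T" "u \<in> inputs T v"
  shows "is_module A \<rho> u"
  using inputs_cases[OF assms(3)] assms(1,2) is_tree_vertex[of A T v] by (auto simp: adapted_def)

lemma adapted_quot_iff:
  assumes "adapted A \<rho> T" "v \<in> T" "u \<in> inputs T v" "w \<in> inputs T v" "u \<noteq> w" "a \<in> u" "b \<in> w"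
  shows "(g, u, w) \<in> quot_rel \<rho> (inputs T v) \<longleftrightarrow> (g, a, b) \<in> \<rho>"
  using assms inputs_disjoint[of A T u v w] adapted_inputs_module[OF assms(1,2)]
  by (intro quot_rel_iff) (auto simp: adapted_def)

lemma realizable_quot_inputs:
  assumes "finite A" "realizable A \<rho>" and T: "adapted A \<rho> T" and v: "v \<in> T"
  shows "realizable (inputs T v) (quot_rel \<rho> (inputs T v))"
proof (rule realizable_quot_rel[OF assms(2)])
  have t: "is_tree A T" using T by (simp add: adapted_def)
  obtain a where "a \<in> v" using is_tree_nonempty[OF t v] by blast
  then show "inputs T v \<noteq> {}" using inputs_cover[OF assms(1) t v] by blast
  show "u \<noteq> {} \<and> is_module A \<rho> u" if "u \<in> inputs T v" for u
    using inputs_nonempty[OF t that] adapted_inputs_module[OF T v that] by blast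
  show "u \<inter> w = {}" if "u \<in> inputs T v" "w \<in> inputs T v" "u \<noteq> w" for u w
    using inputs_disjoint[OF t] that by blast
qed

text \<open>Since \<open>e\<close> is a module, an input of \<open>e\<close> is related to the other
  inputs of \<open>p\<close> exactly as \<open>e\<close> is; this is the inheritance expressed by
  \<open>comp_rel\<close>.\<close>

lemma comp_quot_rel:
  assumes T: "adapted A \<rho> T" and e: "e \<in> T" and p: "p \<in> T" "e \<in> inputs T p"
  shows "comp_rel e (inputs T e) (quot_rel \<rho> (inputs T p)) (quot_rel \<rho> (inputs T e))
    = quot_rel \<rho> (inputs (T - {e}) p)"
proof -
  have t: "is_tree A T" using T by (simp add: adapted_def)
  let ?I = "inputs T p" and ?J = "inputs T e"
  have I': "inputs (T - {e}) p = ?I - {e} \<union> ?J" by (rule inputs_delete_parent[OF t e p])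
  have disj: "(?I - {e}) \<inter> ?J = {}" by (rule inputs_parent_disjoint[OF t p(2)])
  have "e \<notin> ?J" using inputs_psubset by blast
  have neJ: "\<exists>a. a \<in> u \<and> a \<in> e" if "u \<in> ?J" for u
    using inputs_nonempty[OF t that] inputs_psubset[OF that] by blast
  have ex: "(g, u, w) \<in> quot_rel \<rho> I \<longleftrightarrow> u \<in> I \<and> w \<in> I \<and> u \<noteq> w \<and> (\<exists>a\<in>u. \<exists>b\<in>w. (g, a, b) \<in> \<rho>)" for g u w I
    by (simp add: quot_rel_def)
  have me: "is_module A \<rho> e" using T e by (simp add: adapted_def)
  have mods: "(\<exists>a\<in>u. \<exists>b\<in>w. (g, a, b) \<in> \<rho>) \<longleftrightarrow> (\<exists>a\<in>u. \<exists>b\<in>e. (g, a, b) \<in> \<rho>)"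
    "(\<exists>a\<in>w. \<exists>b\<in>u. (g, a, b) \<in> \<rho>) \<longleftrightarrow> (\<exists>a\<in>e. \<exists>b\<in>u. (g, a, b) \<in> \<rho>)"
    if "u \<in> ?I - {e}" "w \<in> ?J" for g u w
  proof -
    have *: "is_module A \<rho> u" "u \<inter> e = {}" "w \<subset> e" "w \<noteq> {}"
      using adapted_inputs_module[OF T p(1), of u] inputs_disjoint[OF t _ p(2), of u] that
        inputs_psubset[OF that(2)] inputs_nonempty[OF t that(2)] by auto
    show "(\<exists>a\<in>u. \<exists>b\<in>w. (g, a, b) \<in> \<rho>) \<longleftrightarrow> (\<exists>a\<in>u. \<exists>b\<in>e. (g, a, b) \<in> \<rho>)"
      using module_pair_iff[OF *(1) me *(2)] *(3,4) by blast
    show "(\<exists>a\<in>w. \<exists>b\<in>u. (g, a, b) \<in> \<rho>) \<longleftrightarrow> (\<exists>a\<in>e. \<exists>b\<in>u. (g, a, b) \<in> \<rho>)"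
      using module_pair_iff[OF me *(1)] *(2-4) by blast
  qed
  show ?thesis
  proof (rule set_eqI, clarify)
    fix g u w
    have "(g, u, w) \<in> quot_rel \<rho> (?I - {e} \<union> ?J) \<longleftrightarrow>
      ((g, u, w) \<in> quot_rel \<rho> ?I \<and> u \<noteq> e \<and> w \<noteq> e) \<or> (g, u, w) \<in> quot_rel \<rho> ?J
      \<or> ((g, u, e) \<in> quot_rel \<rho> ?I \<and> w \<in> ?J) \<or> (u \<in> ?J \<and> (g, e, w) \<in> quot_rel \<rho> ?I)" (is "?L \<longleftrightarrow> ?R")
    proof (cases "u \<in> ?J"; cases "w \<in> ?J")
      assume "u \<in> ?J" "w \<in> ?J"
      then show ?thesis using disj \<open>e \<notin> ?J\<close> p(2) unfolding ex by blast
    next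
      assume "u \<in> ?J" "w \<notin> ?J"
      then show ?thesis using disj \<open>e \<notin> ?J\<close> p(2) mods(2)[of w u g] unfolding ex by blast
    next
      assume "u \<notin> ?J" "w \<in> ?J"
      then show ?thesis using disj \<open>e \<notin> ?J\<close> p(2) mods(1)[of u w g] unfolding ex by blast
    next
      assume "u \<notin> ?J" "w \<notin> ?J"
      then show ?thesis using disj \<open>e \<notin> ?J\<close> p(2) unfolding ex by blast
    qed
    then show "(g, u, w) \<in> comp_rel e ?J (quot_rel \<rho> ?I) (quot_rel \<rho> ?J)
       \<longleftrightarrow> (g, u, w) \<in> quot_rel \<rho> (inputs (T - {e}) p)"
      unfolding I' comp_rel_def by simp
  qed
qed

lemma inputs_corolla:
  assumes "2 \<le> card A"
  shows "inputs {A} A = {{a} | a. a \<in> A}"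
proof -
  have "{a} \<subset> A" if "a \<in> A" for a using assms that by auto
  then show ?thesis by (auto simp: inputs_def)
qed

text \<open>The labels of a tree can be composed: contract an edge \<open>e\<close>, compose the two
  labels at its ends, and take the \<open>\<rho>\<close> of the smaller tree. It remains to see that
  \<open>e\<close> is a module of this \<open>\<rho>\<close> and that the two labels come back as
  quotients.\<close>

lemma quot_rel_surj:
  assumes A: "finite A" "2 \<le> card A" and T: "is_tree A T"
    and b: "\<And>v. v \<in> T \<Longrightarrow> realizable (inputs T v) (b v)"
  shows "\<exists>\<rho>. realizable A \<rho> \<and> adapted A \<rho> T \<and> (\<forall>v\<in>T. b v = quot_rel \<rho> (inputs T v))"
  using T b
proof (induction "card T" arbitrary: T b rule: less_induct)
  case less
  note T = less.prems(1) and b = less.prems(2)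
  have finT: "finite T" by (rule is_tree_finite[OF A(1) T])
  have AT: "A \<in> T" using T by (simp add: is_tree_def)
  show ?case
  proof (cases "T = {A}")
    case True
    \<comment> \<open>The inputs of the only vertex are the singletons, so its label is already the
      composite, up to renaming \<open>{a}\<close> to \<open>a\<close>.\<close>
    let ?\<sigma> = "the_elem :: 'a set \<Rightarrow> 'a"
    let ?\<rho> = "(\<lambda>(g, x, y). (g, ?\<sigma> x, ?\<sigma> y)) ` b A"
    have I: "inputs T A = {{a} | a. a \<in> A}" using inputs_corolla[OF A(2)] True by simp
    have rI: "realizable (inputs T A) (b A)" by (rule b[OF AT])
    then have "realizable (?\<sigma> ` inputs T A) ?\<rho>"
      by (rule realizable_image) (auto simp: I inj_on_def)
    moreover have "?\<sigma> ` inputs T A = A" by (force simp: I image_iff)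
    moreover have "adapted A ?\<rho> T" using T True by (simp add: adapted_def)
    moreover have "b A = quot_rel ?\<rho> (inputs T A)"
    proof (rule set_eqI, clarify)
      fix g u w
      have sing: "u = {?\<sigma> u} \<and> w = {?\<sigma> w} \<and> u \<in> inputs T A \<and> w \<in> inputs T A" if "(g, u, w) \<in> b A" for g u w
        using realizable_subset[OF rI that] by (auto simp: I)
      have "(g, a, b') \<in> ?\<rho> \<longleftrightarrow> (g, {a}, {b'}) \<in> b A" for a b'
      proof
        assume "(g, a, b') \<in> ?\<rho>"
        then obtain u w where "(g, u, w) \<in> b A" "a = ?\<sigma> u" "b' = ?\<sigma> w" by auto
        then show "(g, {a}, {b'}) \<in> b A" using sing by metis
      qed (force simp: image_iff)
      then show "(g, u, w) \<in> b A \<longleftrightarrow> (g, u, w) \<in> quot_rel ?\<rho> (inputs T A)"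
        using sing[of g u w] realizable_irrefl[OF rI] unfolding quot_rel_def I by (auto 0 4)
    qed
    ultimately show ?thesis using True by (metis singletonD)
  next
    case False
    then obtain e where e: "e \<in> T" "e \<noteq> A" using AT by blast
    define p where "p = parent T e"
    have p: "p \<in> T" "e \<in> inputs T p" using parent_exists[OF A(1) T e] by (simp_all add: p_def)
    let ?T = "T - {e}" and ?I = "inputs T p" and ?J = "inputs T e"
    define b' where "b' = b(p := comp_rel e ?J (b p) (b e))"
    have pe: "p \<noteq> e" using inputs_psubset[OF p(2)] by blast
    have T': "is_tree A ?T" by (rule is_tree_delete[OF T e(2)])
    have I': "inputs ?T p = ?I - {e} \<union> ?J" by (rule inputs_delete_parent[OF T e(1) p])
    have other: "inputs ?T v = inputs T v" if "v \<in> T" "v \<noteq> p" for v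
      using inputs_delete_other[OF T e(1) that(1)] parent_unique[OF T that(1) _ p] that(2) by blast
    have disj: "(?I - {e}) \<inter> ?J = {}" by (rule inputs_parent_disjoint[OF T p(2)])
    have "realizable (inputs ?T v) (b' v)" if "v \<in> ?T" for v
    proof (cases "v = p")
      case True
      then show ?thesis
        using realizable_comp[OF b[OF p(1)] b[OF e(1)] p(2) disj] by (simp add: I' b'_def)
    next
      case False
      then show ?thesis using b[of v] other[of v] that by (simp add: b'_def)
    qed
    moreover have "card ?T < card T" by (rule psubset_card_mono[OF finT]) (use e(1) in auto)
    ultimately obtain \<rho> where \<rho>: "realizable A \<rho>" "adapted A \<rho> ?T" "\<And>v. v \<in> ?T \<Longrightarrow> b' v = quot_rel \<rho> (inputs ?T v)"
      using less.hyps[of ?T b'] T' by metis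
    have bp: "comp_rel e ?J (b p) (b e) = quot_rel \<rho> (?I - {e} \<union> ?J)"
      using \<rho>(3)[of p] p pe by (simp add: b'_def I')
    have eJ: "e \<notin> ?J" using inputs_psubset by blast
    have pT: "p \<in> ?T" using p pe by simp
    have bpI: "u \<in> ?I \<and> w \<in> ?I \<and> u \<noteq> w" if "(g, u, w) \<in> b p" for g u w
      using realizable_subset[OF b[OF p(1)] that] realizable_irrefl[OF b[OF p(1)]] that by blast
    have beJ: "u \<in> ?J \<and> w \<in> ?J \<and> u \<noteq> w" if "(g, u, w) \<in> b e" for g u w
      using realizable_subset[OF b[OF e(1)] that] realizable_irrefl[OF b[OF e(1)]] that by blast
    have JI: "u \<notin> ?I" if "u \<in> ?J" for u using that disj eJ by auto
    have comp_iff: "(g, u, w) \<in> comp_rel e ?J (b p) (b e) \<longleftrightarrow> ((g, u, w) \<in> b p \<and> u \<noteq> e \<and> w \<noteq> e)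
        \<or> (g, u, w) \<in> b e \<or> ((g, u, e) \<in> b p \<and> w \<in> ?J) \<or> (u \<in> ?J \<and> (g, e, w) \<in> b p)" for g u w
      by (simp add: comp_rel_def)
    have q: "(g, x, y) \<in> \<rho> \<longleftrightarrow> (g, u, w) \<in> comp_rel e ?J (b p) (b e)"
      if "u \<in> ?I - {e} \<union> ?J" "w \<in> ?I - {e} \<union> ?J" "u \<noteq> w" "x \<in> u" "y \<in> w" for g x y u w
      using adapted_quot_iff[OF \<rho>(2) pT, of u w x y g] that unfolding I' bp by blast
    have q1: "(g, x, y) \<in> \<rho> \<longleftrightarrow> (g, u, w) \<in> b p"
      if "u \<in> ?I - {e}" "w \<in> ?I - {e}" "u \<noteq> w" "x \<in> u" "y \<in> w" for g x y u w
    proof -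
      have "u \<notin> ?J" "w \<notin> ?J" "u \<noteq> e" "w \<noteq> e" using that JI by auto
      then show ?thesis using q[of u w x y g] that beJ[of g u w] by (auto simp: comp_iff)
    qed
    have q2: "(g, x, y) \<in> \<rho> \<longleftrightarrow> (g, u, w) \<in> b e"
      if "u \<in> ?J" "w \<in> ?J" "u \<noteq> w" "x \<in> u" "y \<in> w" for g x y u w
    proof -
      have "u \<notin> ?I" "w \<notin> ?I" using that JI by auto
      then show ?thesis using q[of u w x y g] that bpI[of g u w] bpI[of g u e] bpI[of g e w]
        by (auto simp: comp_iff)
    qed
    have cover: "\<exists>w\<in>?J. y \<in> w" if "y \<in> e" for y using inputs_cover[OF A(1) T e(1) that] by blast
    \<comment> \<open>The right-hand sides do not depend on \<open>y\<close>; this is what makes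
      \<open>e\<close> a module as seen from inside \<open>p\<close>.\<close>
    have q3: "(g, x, y) \<in> \<rho> \<longleftrightarrow> (g, u, e) \<in> b p" "(g, y, x) \<in> \<rho> \<longleftrightarrow> (g, e, u) \<in> b p"
      if u: "u \<in> ?I - {e}" "x \<in> u" "y \<in> e" for g x y u
    proof -
      obtain w where w: "w \<in> ?J" "y \<in> w" using cover[OF u(3)] by blast
      have nw: "w \<notin> ?I" "u \<notin> ?J" "u \<noteq> e" "w \<noteq> u" using w u JI by auto
      have "(g, x, y) \<in> \<rho> \<longleftrightarrow> (g, u, w) \<in> comp_rel e ?J (b p) (b e)"
        by (rule q) (use u w nw in simp_all)
      moreover have "(g, y, x) \<in> \<rho> \<longleftrightarrow> (g, w, u) \<in> comp_rel e ?J (b p) (b e)"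
        by (rule q) (use u w nw in simp_all)
      moreover have "(g, u, w) \<notin> b p" "(g, w, u) \<notin> b p" "(g, u, w) \<notin> b e" "(g, w, u) \<notin> b e"
        using bpI[of g u w] bpI[of g w u] beJ[of g u w] beJ[of g w u] nw by blast+
      ultimately show "(g, x, y) \<in> \<rho> \<longleftrightarrow> (g, u, e) \<in> b p" "(g, y, x) \<in> \<rho> \<longleftrightarrow> (g, e, u) \<in> b p"
        using w(1) nw(2) unfolding comp_iff by simp_all
    qed
    have "e \<subseteq> A" "e \<subseteq> p" using is_tree_vertex[OF T e(1)] inputs_psubset[OF p(2)] by blast+
    have modp: "is_module A \<rho> p" using \<rho>(2) pT by (simp add: adapted_def)
    have "is_module A \<rho> e"
      unfolding is_module_def
    proof (intro conjI allI ballI)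
      fix g x y y' assume x: "x \<in> A - e" and y: "y \<in> e" "y' \<in> e"
      show "(g, y, x) \<in> \<rho> \<longleftrightarrow> (g, y', x) \<in> \<rho>" "(g, x, y) \<in> \<rho> \<longleftrightarrow> (g, x, y') \<in> \<rho>"
      proof -
        have "((g, y, x) \<in> \<rho> \<longleftrightarrow> (g, y', x) \<in> \<rho>) \<and> ((g, x, y) \<in> \<rho> \<longleftrightarrow> (g, x, y') \<in> \<rho>)"
        proof (cases "x \<in> p")
          case True
          obtain u where u: "u \<in> ?I" "x \<in> u" using inputs_cover[OF A(1) T p(1) True] by blast
          then have "u \<in> ?I - {e}" using x by blast
          then show ?thesis using q3[of u x y g] q3[of u x y' g] u y by simp
        next
          case False
          \<comment> \<open>From outside \<open>p\<close> the elements of \<open>e\<close> look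
            alike because \<open>p\<close> is a module containing \<open>e\<close>.\<close>
          then show ?thesis using modp x y \<open>e \<subseteq> p\<close> unfolding is_module_def by blast
        qed
        then show "(g, y, x) \<in> \<rho> \<longleftrightarrow> (g, y', x) \<in> \<rho>" "(g, x, y) \<in> \<rho> \<longleftrightarrow> (g, x, y') \<in> \<rho>" by simp_all
      qed
    qed (rule \<open>e \<subseteq> A\<close>)
    then have ad: "adapted A \<rho> T" using \<rho>(2) T unfolding adapted_def by blast
    have ne: "\<exists>x. x \<in> u" if "u \<in> inputs T v" for u v using inputs_nonempty[OF T that] by blast
    have "b v = quot_rel \<rho> (inputs T v)" if v: "v \<in> T" for v
    proof -
      have sub: "u \<in> inputs T v \<and> w \<in> inputs T v \<and> u \<noteq> w" if "(g, u, w) \<in> b v" for g u w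
        using realizable_subset[OF b[OF v] that] realizable_irrefl[OF b[OF v]] that by blast
      have main: "(g, u, w) \<in> b v \<longleftrightarrow> (g, u, w) \<in> quot_rel \<rho> (inputs T v)"
        if uw: "u \<in> inputs T v" "w \<in> inputs T v" "u \<noteq> w" for g u w
      proof -
        obtain x y where xy: "x \<in> u" "y \<in> w" using ne uw by blast
        have *: "(g, u, w) \<in> quot_rel \<rho> (inputs T v) \<longleftrightarrow> (g, x, y) \<in> \<rho>"
          by (rule adapted_quot_iff[OF ad v uw xy])
        consider "v = p" | "v = e" | "v \<noteq> p" "v \<noteq> e" by blast
        then show ?thesis
        proof cases
          case 1
          then show ?thesis unfolding * using q1[of u w x y g] q3(1)[of u x y g] q3(2)[of w y x g] uw xy by blast
        next
          case 2
          then show ?thesis unfolding * using q2[of u w x y g] uw xy by blast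
        next
          case 3
          then have "b v = quot_rel \<rho> (inputs T v)" using \<rho>(3)[of v] v other[of v] by (simp add: b'_def)
          then show ?thesis by simp
        qed
      qed
      have sub': "u \<in> inputs T v \<and> w \<in> inputs T v \<and> u \<noteq> w" if "(g, u, w) \<in> quot_rel \<rho> (inputs T v)" for g u w
        using that by (simp add: quot_rel_def)
      show ?thesis
      proof (rule set_eqI, clarify)
        fix g u w
        show "(g, u, w) \<in> b v \<longleftrightarrow> (g, u, w) \<in> quot_rel \<rho> (inputs T v)"
          using main[of u w g] sub[of g u w] sub'[of g u w] by argo
      qed
    qed
    then show ?thesis using \<rho>(1) ad by blast
  qed
qed

text \<open>Two leaves \<open>a\<close> and \<open>b\<close> lie in different inputs of the smallest
  vertex containing both, so their relation can be read off from the label there.\<close>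

lemma quot_rel_inj:
  assumes A: "finite A" and \<rho>: "realizable A \<rho>" "adapted A \<rho> T" and \<rho>': "realizable A \<rho>'" "adapted A \<rho>' T"
    and eq: "\<And>v. v \<in> T \<Longrightarrow> quot_rel \<rho> (inputs T v) = quot_rel \<rho>' (inputs T v)"
  shows "\<rho> = \<rho>'"
proof -
  have T: "is_tree A T" using \<rho> by (simp add: adapted_def)
  have "(g, a, b) \<in> \<rho> \<longleftrightarrow> (g, a, b) \<in> \<rho>'" if ab: "a \<in> A" "b \<in> A" "a \<noteq> b" for g a b
  proof -
    let ?S = "{v \<in> T. a \<in> v \<and> b \<in> v}"
    have "A \<in> ?S" using T ab by (auto simp: is_tree_def)
    then have ne: "?S \<noteq> {}" by blast
  have fin: "finite ?S" using is_tree_finite[OF A T] by simp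
  obtain v where ext: "v \<in> ?S" "\<forall>w\<in>?S. w \<subseteq> v \<longrightarrow> v = w"
    using finite_has_minimal[OF fin ne] by (rule bexE)
  note v = ext(1) ext(2)[rule_format]
    obtain u where u: "u \<in> inputs T v" "a \<in> u" using inputs_cover[OF A T, of v a] v(1) by blast
    obtain w where w: "w \<in> inputs T v" "b \<in> w" using inputs_cover[OF A T, of v b] v(1) by blast
    have "u \<noteq> w"
    proof
      assume "u = w"
      then have "u \<in> ?S" using inputs_cases[OF u(1)] u w ab by auto
      then show False using v(2)[of u] inputs_psubset[OF u(1)] by blast
    qed
    then show ?thesis
      using adapted_quot_iff[OF \<rho>(2) _ u(1) w(1) _ u(2) w(2), of g] adapted_quot_iff[OF \<rho>'(2) _ u(1) w(1) _ u(2) w(2), of g]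
        eq[of v] v(1) by simp
  qed
  moreover have "a \<in> A \<and> b \<in> A \<and> a \<noteq> b" if "(g, a, b) \<in> \<rho>" for g a b
    using realizable_subset[OF \<rho>(1) that] realizable_irrefl[OF \<rho>(1)] that by blast
  moreover have "a \<in> A \<and> b \<in> A \<and> a \<noteq> b" if "(g, a, b) \<in> \<rho>'" for g a b
    using realizable_subset[OF \<rho>'(1) that] realizable_irrefl[OF \<rho>'(1)] that by blast
  ultimately show ?thesis by (intro set_eqI) (metis prod_cases3)
qed

section \<open>The complex of modules\<close>

definition proper_modules :: "'x set \<Rightarrow> ('g \<times> 'x \<times> 'x) set \<Rightarrow> 'x set set" where
  "proper_modules A \<rho> = {v. v \<subset> A \<and> 2 \<le> card v \<and> is_module A \<rho> v}"

section \<open>Uniform monomials and strong modules\<close>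

fun uniform :: "'g \<Rightarrow> ('g, 'l) monomial \<Rightarrow> bool" where
  "uniform g (Leaf l) \<longleftrightarrow> True"
| "uniform g (Node h s t) \<longleftrightarrow> g = h \<and> uniform g s \<and> uniform g t"

fun pairs :: "'l list \<Rightarrow> ('l \<times> 'l) set" where
  "pairs [] = {}"
| "pairs (x # xs) = {x} \<times> set xs \<union> pairs xs"

lemma pairs_append: "pairs (xs @ ys) = pairs xs \<union> pairs ys \<union> set xs \<times> set ys"
  by (induction xs) auto

lemma pairs_subset: "(x, y) \<in> pairs xs \<Longrightarrow> x \<in> set xs \<and> y \<in> set xs"
  by (induction xs) auto

lemma pairs_nth:
  "distinct xs \<Longrightarrow> i < length xs \<Longrightarrow> j < length xs \<Longrightarrow> (xs ! i, xs ! j) \<in> pairs xs \<longleftrightarrow> i < j"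
proof (induction xs arbitrary: i j)
  case (Cons x xs)
  have "x \<noteq> xs ! k" if "k < length xs" for k using Cons.prems(1) that by auto
  moreover have "(x, y) \<notin> pairs xs" "(y, x) \<notin> pairs xs" for y using Cons.prems(1) pairs_subset by fastforce+
  ultimately show ?case using Cons by (cases i; cases j) (auto; metis)+
qed simp

lemma rel_uniform: "uniform g t \<Longrightarrow> rel t = {g} \<times> pairs (leaves t)"
  by (induction t) (auto simp: pairs_append)

text \<open>A set \<open>M\<close> as below is the leaf set of a vertex labelled \<open>h\<close> whose parent is labelled \<open>g\<close> in the
  tree that alternates between the operations; it is compatible with every module.\<close>

definition strong_module :: "'g \<Rightarrow> 'x set \<Rightarrow> ('g \<times> 'x \<times> 'x) set \<Rightarrow> 'x set \<Rightarrow> bool" where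
  "strong_module g A \<rho> M \<longleftrightarrow> is_module A \<rho> M \<and> (\<forall>m\<in>M. \<forall>x\<in>A - M. (g, m, x) \<in> \<rho> \<or> (g, x, m) \<in> \<rho>) \<and>
     (\<exists>h M1 M2. h \<noteq> g \<and> M = M1 \<union> M2 \<and> M1 \<inter> M2 = {} \<and> M1 \<noteq> {} \<and> M2 \<noteq> {} \<and> {h} \<times> M1 \<times> M2 \<subseteq> \<rho>)"

text \<open>The new elements in \<open>T\<close> are related to all of \<open>S\<close> in the same
  way and by \<open>g\<close>, so \<open>M\<close> stays a module and stays joined to its outside by
  \<open>g\<close>. The flag \<open>left\<close> tells on which side \<open>S\<close> stands, so
  that one statement serves both arguments of a vertex.\<close>

lemma strong_module_extend:
  assumes M: "strong_module g S \<sigma> M" and disj: "S \<inter> T = {}" and sub: "\<sigma> \<subseteq> \<rho>"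
    and in_S: "\<And>k x y. x \<in> S \<Longrightarrow> y \<in> S \<Longrightarrow> (k, x, y) \<in> \<rho> \<longleftrightarrow> (k, x, y) \<in> \<sigma>"
    and across: "\<And>k x y. x \<in> S \<Longrightarrow> y \<in> T \<Longrightarrow> ((k, x, y) \<in> \<rho> \<longleftrightarrow> k = g \<and> left) \<and> ((k, y, x) \<in> \<rho> \<longleftrightarrow> k = g \<and> \<not> left)"
  shows "strong_module g (S \<union> T) \<rho> M"
proof -
  have M': "is_module S \<sigma> M" using M unfolding strong_module_def by blast
  then have MS: "M \<subseteq> S" unfolding is_module_def by blast
  have mod: "((k, a, x) \<in> \<sigma> \<longleftrightarrow> (k, b, x) \<in> \<sigma>) \<and> ((k, x, a) \<in> \<sigma> \<longleftrightarrow> (k, x, b) \<in> \<sigma>)"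
    if "x \<in> S - M" "a \<in> M" "b \<in> M" for k x a b
    using M' that unfolding is_module_def by blast
  have col: "(g, m, x) \<in> \<sigma> \<or> (g, x, m) \<in> \<sigma>" if "m \<in> M" "x \<in> S - M" for m x
    using M that unfolding strong_module_def by blast
  have "is_module (S \<union> T) \<rho> M"
    unfolding is_module_def
  proof (rule conjI, use MS in blast, intro allI ballI)
    fix k x a b assume x: "x \<in> S \<union> T - M" and ab: "a \<in> M" "b \<in> M"
    have S: "a \<in> S" "b \<in> S" using MS ab by auto
    show "((k, a, x) \<in> \<rho> \<longleftrightarrow> (k, b, x) \<in> \<rho>) \<and> ((k, x, a) \<in> \<rho> \<longleftrightarrow> (k, x, b) \<in> \<rho>)"
    proof (cases "x \<in> S")
      case True
      then show ?thesis using mod[of x a b k] in_S S x ab by simp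
    next
      case False
      then have "x \<in> T" using x by simp
      then show ?thesis using across[OF S(1), of x k] across[OF S(2), of x k] by simp
    qed
  qed
  moreover have "(g, m, x) \<in> \<rho> \<or> (g, x, m) \<in> \<rho>" if "m \<in> M" "x \<in> S \<union> T - M" for m x
  proof (cases "x \<in> S")
    case True
    then show ?thesis using col[of m x] that sub by blast
  next
    case False
    then have "x \<in> T" "m \<in> S" using that MS by auto
    then show ?thesis using across[of m x g] by simp
  qed
  moreover obtain h M1 M2 where "h \<noteq> g" "M = M1 \<union> M2" "M1 \<inter> M2 = {}" "M1 \<noteq> {}" "M2 \<noteq> {}" "{h} \<times> M1 \<times> M2 \<subseteq> \<sigma>"
    using M unfolding strong_module_def by blast
  moreover have "{h} \<times> M1 \<times> M2 \<subseteq> \<rho>" by (rule order_trans[OF calculation(8) sub])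
  ultimately show ?thesis unfolding strong_module_def by blast
qed

lemma strong_module_Node:
  assumes d: "distinct (leaves (Node g s t))"
  shows "strong_module g (set (leaves s)) (rel s) M \<Longrightarrow> strong_module g (set (leaves (Node g s t))) (rel (Node g s t)) M"
    and "strong_module g (set (leaves t)) (rel t) M \<Longrightarrow> strong_module g (set (leaves (Node g s t))) (rel (Node g s t)) M"
proof -
  let ?S = "set (leaves s)" and ?T = "set (leaves t)"
  have disj: "?S \<inter> ?T = {}" using d by simp
  have mem: "(k, x, y) \<in> rel (Node g s t) \<longleftrightarrow> (k, x, y) \<in> rel s \<or> (k, x, y) \<in> rel t \<or> k = g \<and> x \<in> ?S \<and> y \<in> ?T" for k x y
    by auto
  have ST: "((k, x, y) \<in> rel (Node g s t) \<longleftrightarrow> k = g) \<and> (k, y, x) \<notin> rel (Node g s t)" if "x \<in> ?S" "y \<in> ?T" for k x y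
    unfolding mem using that disj rel_leaves[of k x y s] rel_leaves[of k x y t] rel_leaves[of k y x s] rel_leaves[of k y x t]
    by blast
  show "strong_module g (set (leaves (Node g s t))) (rel (Node g s t)) M" if "strong_module g ?S (rel s) M"
  proof -
    have "strong_module g (?S \<union> ?T) (rel (Node g s t)) M"
    proof (rule strong_module_extend[OF that disj, where left = True])
      show "(k, x, y) \<in> rel (Node g s t) \<longleftrightarrow> (k, x, y) \<in> rel s" if "x \<in> ?S" "y \<in> ?S" for k x y
        unfolding mem using that disj rel_leaves[of k x y t] by blast
    qed (use ST in auto)
    then show ?thesis by simp
  qed
  show "strong_module g (set (leaves (Node g s t))) (rel (Node g s t)) M" if "strong_module g ?T (rel t) M"
  proof -
    have "strong_module g (?T \<union> ?S) (rel (Node g s t)) M"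
    proof (rule strong_module_extend[OF that, where left = False])
      show "(k, x, y) \<in> rel (Node g s t) \<longleftrightarrow> (k, x, y) \<in> rel t" if "x \<in> ?T" "y \<in> ?T" for k x y
        unfolding mem using that disj rel_leaves[of k x y s] by blast
      show "?T \<inter> ?S = {}" using disj by blast
    qed (use ST in auto)
    then show ?thesis by (simp add: Un_commute)
  qed
qed

text \<open>Follow vertices labelled \<open>g\<close> down from the root; the leaf set of the first
  vertex with another label is \<open>M\<close>. At that vertex \<open>M\<close> is everything and
  the condition on outside elements is void; \<open>strong_module_Node\<close> then carries
  \<open>M\<close> back up to the root.\<close>

lemma uniform_or_strong_module:
  "distinct (leaves t) \<Longrightarrow> uniform g t \<or> (\<exists>M. strong_module g (set (leaves t)) (rel t) M)"
proof (induction t)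
  case (Node h s t)
  show ?case
  proof (cases "h = g")
    case True
    then show ?thesis using Node strong_module_Node[of g s t] by auto
  next
    case False
    have "strong_module g (set (leaves (Node h s t))) (rel (Node h s t)) (set (leaves (Node h s t)))"
      unfolding strong_module_def
    proof (intro conjI exI)
      show "h \<noteq> g" by (rule False)
      show "set (leaves (Node h s t)) = set (leaves s) \<union> set (leaves t)" by simp
      show "set (leaves s) \<inter> set (leaves t) = {}" using Node.prems by simp
      show "{h} \<times> set (leaves s) \<times> set (leaves t) \<subseteq> rel (Node h s t)" by auto
    qed auto
    then show ?thesis by blast
  qed
qed simp

text \<open>Suppose \<open>u\<close> overlaps \<open>M\<close> and has an element \<open>x\<close>
  outside \<open>M\<close>. Elements of \<open>M - u\<close> are joined to \<open>x\<close> by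
  \<open>g\<close>, hence to all of \<open>u\<close>. Pairs from \<open>M1\<close> and
  \<open>M2\<close> are joined by \<open>h\<close> instead, so both members lie in \<open>u\<close>
  or neither does; then \<open>M\<close> lies in \<open>u\<close> or misses it.\<close>

lemma strong_module_compat:
  assumes A: "realizable A \<rho>" and M: "strong_module g A \<rho> M" and u: "is_module A \<rho> u"
  shows "compat u M"
proof (rule ccontr)
  assume "\<not> compat u M"
  then obtain x a b where x: "x \<in> u" "x \<notin> M" and a: "a \<in> u" "a \<in> M" and b: "b \<in> M" "b \<notin> u"
    unfolding compat_def by blast
  obtain h M1 M2 where h: "h \<noteq> g" "M = M1 \<union> M2" "M1 \<inter> M2 = {}" "M1 \<noteq> {}" "M2 \<noteq> {}" "{h} \<times> M1 \<times> M2 \<subseteq> \<rho>"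
    using M unfolding strong_module_def by blast
  have "M \<subseteq> A" "u \<subseteq> A" using M u unfolding strong_module_def is_module_def by blast+
  have col: "(g, c, d) \<in> \<rho> \<or> (g, d, c) \<in> \<rho>" if c: "c \<in> u" and d: "d \<in> M" "d \<notin> u" for c d
  proof -
    have "(g, d, x) \<in> \<rho> \<or> (g, x, d) \<in> \<rho>" using M x d(1) \<open>u \<subseteq> A\<close> unfolding strong_module_def by blast
    moreover have "d \<in> A - u" using d \<open>M \<subseteq> A\<close> by blast
    then have "((g, c, d) \<in> \<rho> \<longleftrightarrow> (g, x, d) \<in> \<rho>) \<and> ((g, d, c) \<in> \<rho> \<longleftrightarrow> (g, d, x) \<in> \<rho>)"
      using u c x(1) unfolding is_module_def by blast
    ultimately show ?thesis by blast
  qed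
  have hcol: "(h, c, d) \<in> \<rho>" if "c \<in> M1" "d \<in> M2" for c d using h(6) that by blast
  have no: "\<not> (g, c, d) \<in> \<rho>" "\<not> (g, d, c) \<in> \<rho>" if "c \<in> M1" "d \<in> M2" for c d
    using hcol[OF that] realizable_unique[OF A, of h c d g] realizable_asym[OF A, of h c d g] h(1) by blast+
  have step: "d \<in> u \<longleftrightarrow> c \<in> u" if "c \<in> M1" "d \<in> M2" for c d
    using col[of c d] col[of d c] no[OF that] that h(2) by blast
  obtain c0 d0 where "c0 \<in> M1" "d0 \<in> M2" using h(4,5) by blast
  then have "c \<in> u \<longleftrightarrow> c0 \<in> u" if "c \<in> M" for c using step that h(2) by (metis UnE)
  then show False using a b by blast
qed

text \<open>The modules of a linear order are its intervals: a point between the smallest and the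
  largest element of a module but outside the module would tell these two apart.\<close>

lemma proper_modules_uniform:
  assumes t: "valid A t" "uniform g t" and A: "card A = n"
  shows "proper_modules A (rel t) = intervals ((!) (leaves t)) n 0 1"
    and "inj_on ((!) (leaves t)) {..<n}"
proof -
  let ?f = "(!) (leaves t)"
  have d: "distinct (leaves t)" and LA: "set (leaves t) = A" using t(1) by (auto simp: valid_def)
  have n: "length (leaves t) = n" using d LA A distinct_card by fastforce
  show inj: "inj_on ?f {..<n}" using d n by (auto simp: inj_on_def nth_eq_iff_index_eq)
  have imA: "?f ` {0..<n} = A" using LA n by (auto simp: set_conv_nth)
  have r: "(h, ?f i, ?f j) \<in> rel t \<longleftrightarrow> h = g \<and> i < j" if "i < n" "j < n" for h i j
    using rel_uniform[OF t(2)] pairs_nth[OF d, of i j] that n by auto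
  show "proper_modules A (rel t) = intervals ?f n 0 1"
  proof (intro set_eqI iffI)
    fix v assume "v \<in> proper_modules A (rel t)"
    then have v: "v \<subset> A" "2 \<le> card v" "is_module A (rel t) v" by (auto simp: proper_modules_def)
    define J where "J = {i. i < n \<and> ?f i \<in> v}"
    have finJ: "finite J" by (simp add: J_def)
    have vJ: "v = ?f ` J"
    proof
      show "v \<subseteq> ?f ` J"
      proof
        fix x assume "x \<in> v"
        then have "x \<in> ?f ` {0..<n}" using v(1) imA by blast
        then show "x \<in> ?f ` J" using \<open>x \<in> v\<close> by (auto simp: J_def)
      qed
    qed (auto simp: J_def)
    have cJ: "card J = card v" unfolding vJ
      by (rule card_image[symmetric]) (use inj in \<open>auto simp: inj_on_def J_def\<close>)
    then have ne: "J \<noteq> {}" using v(2) by auto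
    define a where "a = Min J"
    define b where "b = Suc (Max J)"
    have ab: "a \<in> J" "Max J \<in> J" "\<And>i. i \<in> J \<Longrightarrow> a \<le> i \<and> i < b"
      using finJ ne by (auto simp: a_def b_def less_Suc_eq_le)
    have Jn: "i < n \<and> ?f i \<in> v" if "i \<in> J" for i using that by (simp add: J_def)
    have bn: "b \<le> n" using Jn[OF ab(2)] by (simp add: b_def)
    have "{a..<b} \<subseteq> J"
    proof
      fix l assume l: "l \<in> {a..<b}"
      show "l \<in> J"
      proof (rule ccontr)
        assume nl: "l \<notin> J"
        have ln: "l < n" using l bn by simp
        then have "?f l \<notin> v" using nl by (simp add: J_def)
        moreover have "?f l \<in> A" unfolding imA[symmetric] using ln by simp
        ultimately have "(g, ?f a, ?f l) \<in> rel t \<longleftrightarrow> (g, ?f (Max J), ?f l) \<in> rel t"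
          using v(3) Jn[OF ab(1)] Jn[OF ab(2)] unfolding is_module_def by blast
        moreover have "a < l" using l nl ab(1) by (cases "a = l") auto
        moreover have "a < n" "Max J < n" using Jn ab(1,2) by blast+
        ultimately have "Max J < l" using r ln by simp
        then show False using l by (simp add: b_def)
      qed
    qed
    then have J: "J = {a..<b}" using ab(3) by auto
    have "a + 2 \<le> b" using cJ v(2) unfolding J by simp
    moreover have "(a, b) \<noteq> (0, n)" using vJ J imA v(1) by auto
    ultimately show "v \<in> intervals ?f n 0 1" unfolding vJ J using bn by (intro intervalsI) auto
  next
    fix v assume "v \<in> intervals ?f n 0 1"
    then obtain i j where ij: "v = ?f ` {i..<j}" "0 \<le> i" "i + 2 \<le> j" "j \<le> n" "(i, j) \<noteq> (0, n)" "j = n \<longrightarrow> 0 + 1 \<le> i"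
      by (rule intervalsE)
    have sub: "v \<subseteq> A" unfolding ij(1) using imA ij(4) by fastforce
    have "card v = card {i..<j}" unfolding ij(1)
      by (rule card_image) (use inj ij(4) in \<open>auto simp: inj_on_def\<close>)
    then have cv: "card v = j - i" by simp
    have "v \<noteq> A"
    proof
      assume "v = A"
      then have "j - i = n" using cv A by simp
      then show False using ij by auto
    qed
    moreover have "is_module A (rel t) v"
      unfolding is_module_def
    proof (rule conjI[OF sub], intro allI ballI)
      fix h x y z assume x: "x \<in> A - v" and yz: "y \<in> v" "z \<in> v"
      obtain l where l: "x = ?f l" "l < n" using x imA by (metis Diff_iff atLeastLessThan_iff imageE)
      have nl: "l < i \<or> j \<le> l"
      proof (rule ccontr)
        assume "\<not> ?thesis"
        then have "?f l \<in> v" unfolding ij(1) by (intro imageI) auto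
        then show False using x l by simp
      qed
      obtain c c' where c: "y = ?f c" "i \<le> c" "c < j" "z = ?f c'" "i \<le> c'" "c' < j" using yz ij(1) by auto
      show "((h, y, x) \<in> rel t \<longleftrightarrow> (h, z, x) \<in> rel t) \<and> ((h, x, y) \<in> rel t \<longleftrightarrow> (h, x, z) \<in> rel t)"
        unfolding l(1) c(1,4) using r c(2,3,5,6) l(2) nl ij(4) by auto
    qed
    ultimately show "v \<in> proper_modules A (rel t)" using sub cv ij(3) by (auto simp: proper_modules_def)
  qed
qed

theorem flag_exact_proper_modules:
  assumes \<rho>: "realizable A \<rho>" and A: "2 \<le> card A" and k: "k \<noteq> card A - 2"
  shows "flag_exact K (proper_modules A \<rho>) k"
proof -
  obtain t where t: "valid A t" "rel t = \<rho>" using \<rho> by (auto simp: realizable_def)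
  obtain g t1 t2 where node: "t = Node g t1 t2"
    using t A by (cases t) (auto simp: valid_def)
  have finA: "finite A" and d: "distinct (leaves t)" and L: "set (leaves t) = A"
    using t(1) by (auto simp: valid_def)
  show ?thesis
  proof (cases "uniform g t")
    case True
    show ?thesis
      using flag_exact_intervals[OF proper_modules_uniform(2)[OF t(1) True refl], of 0 k K] A k
        proper_modules_uniform(1)[OF t(1) True refl] t(2) by simp
  next
    case False
    have d12: "distinct (leaves t1)" "distinct (leaves t2)" "set (leaves t1) \<inter> set (leaves t2) = {}"
      using d node by auto
    have "\<not> uniform g t1 \<or> \<not> uniform g t2" using False node by simp
    \<comment> \<open>\<open>g\<close> is the root operation, so another operation occurs inside one
      of the arguments; a strong module found there misses the other argument and is therefore
      proper.\<close>
    then obtain M where M: "strong_module g A \<rho> M" "M \<subseteq> set (leaves t1) \<or> M \<subseteq> set (leaves t2)"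
    proof
      assume "\<not> uniform g t1"
      then obtain M where M: "strong_module g (set (leaves t1)) (rel t1) M"
        using uniform_or_strong_module[OF d12(1)] by blast
      then have "M \<subseteq> set (leaves t1)" by (simp add: strong_module_def is_module_def)
      then show ?thesis using that strong_module_Node(1)[OF d[unfolded node] M] L t(2) node by metis
    next
      assume "\<not> uniform g t2"
      then obtain M where M: "strong_module g (set (leaves t2)) (rel t2) M"
        using uniform_or_strong_module[OF d12(2)] by blast
      then have "M \<subseteq> set (leaves t2)" by (simp add: strong_module_def is_module_def)
      then show ?thesis using that strong_module_Node(2)[OF d[unfolded node] M] L t(2) node by metis
    qed
    have "P \<subset> P \<union> Q" "Q \<subset> P \<union> Q" if "P \<inter> Q = {}" "P \<noteq> {}" "Q \<noteq> {}" for P Q :: "'a set"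
      using that by auto
    from this[OF d12(3)] have "set (leaves t1) \<subset> A" "set (leaves t2) \<subset> A"
      using L unfolding node by simp_all
    then have "M \<subset> A" using M(2) by blast
    moreover have "2 \<le> card M"
    proof -
      obtain h M1 M2 where h: "M = M1 \<union> M2" "M1 \<inter> M2 = {}" "M1 \<noteq> {}" "M2 \<noteq> {}"
        using M(1) unfolding strong_module_def by blast
      have "finite M" using \<open>M \<subset> A\<close> finA finite_subset by blast
      then have "card M = card M1 + card M2" "card M1 \<noteq> 0" "card M2 \<noteq> 0"
        using h card_Un_disjoint[of M1 M2] by auto
      then show ?thesis by simp
    qed
    moreover have "is_module A \<rho> M" using M(1) by (simp add: strong_module_def)
    ultimately have "M \<in> proper_modules A \<rho>" by (simp add: proper_modules_def)
    then show ?thesis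
    proof (rule flag_exact_cone)
      fix u assume "u \<in> proper_modules A \<rho>"
      then show "compat u M" using strong_module_compat[OF \<rho> M(1)] by (simp add: proper_modules_def)
    qed
  qed
qed

section \<open>Multilinear forms on decorations\<close>

lemma decorations_update:
  "x \<in> decorations P T \<Longrightarrow> v \<in> T \<Longrightarrow> y \<in> comps P (inputs T v) \<Longrightarrow> x(v := y) \<in> decorations P T"
  by (auto simp: decorations_def PiE_iff extensional_def)

lemma decorations_mem: "x \<in> decorations P T \<Longrightarrow> v \<in> T \<Longrightarrow> x v \<in> comps P (inputs T v)"
  by (auto simp: decorations_def PiE_iff)

lemma multilinear_form_vadd:
  "multilinear_form P T \<phi> \<Longrightarrow> x \<in> decorations P T \<Longrightarrow> v \<in> T \<Longrightarrow> y \<in> comps P (inputs T v) \<Longrightarrow>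
     z \<in> comps P (inputs T v) \<Longrightarrow> \<phi> (x(v := vadd P (inputs T v) y z)) = \<phi> (x(v := y)) + \<phi> (x(v := z))"
  unfolding multilinear_form_def by blast

lemma multilinear_form_vscale:
  "multilinear_form P T \<phi> \<Longrightarrow> x \<in> decorations P T \<Longrightarrow> v \<in> T \<Longrightarrow> y \<in> comps P (inputs T v) \<Longrightarrow>
     \<phi> (x(v := vscale P (inputs T v) c y)) = c * \<phi> (x(v := y))"
  unfolding multilinear_form_def by blast

lemma multilinear_form_zero: "multilinear_form P T (\<lambda>_. 0)"
  by (simp add: multilinear_form_def)

lemma multilinear_form_scale:
  assumes "multilinear_form P T \<phi>"
  shows "multilinear_form P T (\<lambda>x. c * \<phi> x)"
  unfolding multilinear_form_def
  using multilinear_form_vadd[OF assms] multilinear_form_vscale[OF assms] by (simp add: algebra_simps)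

lemma multilinear_form_sum:
  assumes "\<And>i. i \<in> I \<Longrightarrow> multilinear_form P T (\<phi> i)"
  shows "multilinear_form P T (\<lambda>x. \<Sum>i\<in>I. \<phi> i x)"
  unfolding multilinear_form_def
  using multilinear_form_vadd[OF assms] multilinear_form_vscale[OF assms]
  by (simp add: sum.distrib sum_distrib_left)

lemma inputs_finite: "finite T \<Longrightarrow> finite v \<Longrightarrow> finite (inputs T v)"
  by (rule finite_subset[of _ "T \<union> (\<lambda>a. {a}) ` v"]) (auto simp: inputs_def)

lemma tree_inputs_finite: "finite A \<Longrightarrow> is_tree A T \<Longrightarrow> v \<in> T \<Longrightarrow> finite (inputs T v)"
  using inputs_finite is_tree_finite is_tree_vertex finite_subset by metis

lemma pcomp_closed:
  assumes "operad P" "finite A" "finite B" "a \<in> A" "(A - {a}) \<inter> B = {}" "f \<in> comps P A" "g \<in> comps P B"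
  shows "pcomp P A a B f g \<in> comps P (A - {a} \<union> B)"
  using operad.pcomp_linear_left[OF assms(1-5,7)] assms(6) unfolding linear_comps_def by blast

lemma contract_decorations:
  assumes P: "operad P" and A: "finite A" and T: "is_tree A T" and e: "e \<in> T" "e \<noteq> A"
    and x: "x \<in> decorations P T"
  shows "contract P T e x \<in> decorations P (T - {e})"
proof -
  define p where "p = parent T e"
  have p: "p \<in> T" "e \<in> inputs T p" using parent_exists[OF A T e] by (simp_all add: p_def)
  have "contract P T e x v \<in> comps P (inputs (T - {e}) v)" if v: "v \<in> T - {e}" for v
  proof (cases "v = p")
    case True
    have "pcomp P (inputs T p) e (inputs T e) (x p) (x e) \<in> comps P (inputs T p - {e} \<union> inputs T e)"
      using pcomp_closed[OF P] tree_inputs_finite[OF A T] p e inputs_parent_disjoint[OF T p(2)] decorations_mem[OF x]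
      by simp
    then show ?thesis
      using True v inputs_delete_parent[OF T e(1) p] by (simp add: contract_def Let_def p_def[symmetric])
  next
    case False
    then have "inputs (T - {e}) v = inputs T v"
      using inputs_delete_other[OF T e(1), of v] parent_unique[OF T _ _ p, of v] v by blast
    then show ?thesis using False v decorations_mem[OF x, of v] by (simp add: contract_def Let_def p_def[symmetric])
  qed
  then show ?thesis by (auto simp: decorations_def PiE_iff contract_def Let_def)
qed

text \<open>Changing the label at one vertex changes the contracted decoration at one vertex only,
  and linearly: at the parent of \<open>e\<close>, through partial composition, if \<open>v\<close>
  is \<open>e\<close> or its parent, and at \<open>v\<close> itself otherwise.\<close>

lemma contract_update:
  assumes P: "operad P" and A: "finite A" and T: "is_tree A T" and e: "e \<in> T" "e \<noteq> A"
    and x: "x \<in> decorations P T" and v: "v \<in> T"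
  obtains w h where "w \<in> T - {e}" "linear_comps P (inputs T v) (inputs (T - {e}) w) h"
    "\<And>y. contract P T e (x(v := y)) = (contract P T e x)(w := h y)"
proof -
  define p where "p = parent T e"
  have p: "p \<in> T" "e \<in> inputs T p" using parent_exists[OF A T e] by (simp_all add: p_def)
  have pe: "p \<noteq> e" using inputs_psubset[OF p(2)] by blast
  note disj = inputs_parent_disjoint[OF T p(2)] and I' = inputs_delete_parent[OF T e(1) p]
  have ctr: "contract P T e x = restrict (x(p := pcomp P (inputs T p) e (inputs T e) (x p) (x e))) (T - {e})" for x
    by (simp add: contract_def Let_def p_def)
  consider "v = e" | "v = p" | "v \<noteq> e" "v \<noteq> p" by blast
  then show ?thesis
  proof cases
    case 1
    show ?thesis
    proof (rule that[of p "pcomp P (inputs T p) e (inputs T e) (x p)"])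
      show "linear_comps P (inputs T v) (inputs (T - {e}) p) (pcomp P (inputs T p) e (inputs T e) (x p))"
        unfolding 1 I'
        by (rule operad.pcomp_linear_right[OF P _ _ p(2) disj])
           (use tree_inputs_finite[OF A T] p e decorations_mem[OF x] in auto)
    qed (use 1 p pe in \<open>auto simp: ctr fun_eq_iff\<close>)
  next
    case 2
    show ?thesis
    proof (rule that[of p "\<lambda>y. pcomp P (inputs T p) e (inputs T e) y (x e)"])
      show "linear_comps P (inputs T v) (inputs (T - {e}) p) (\<lambda>y. pcomp P (inputs T p) e (inputs T e) y (x e))"
        unfolding 2 I'
        by (rule operad.pcomp_linear_left[OF P _ _ p(2) disj])
           (use tree_inputs_finite[OF A T] p e decorations_mem[OF x] in auto)
    qed (use 2 p pe in \<open>auto simp: ctr fun_eq_iff\<close>)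
  next
    case 3
    have "inputs (T - {e}) v = inputs T v"
      using inputs_delete_other[OF T e(1) v] parent_unique[OF T v _ p] 3 by blast
    then show ?thesis
      by (intro that[of v "\<lambda>y. y"]) (use 3 v in \<open>auto simp: ctr fun_eq_iff linear_comps_def\<close>)
  qed
qed

lemma multilinear_form_contract:
  assumes P: "operad P" and A: "finite A" and T: "is_tree A T" and e: "e \<in> T" "e \<noteq> A"
    and \<chi>: "multilinear_form P (T - {e}) \<chi>"
  shows "multilinear_form P T (\<lambda>x. \<chi> (contract P T e x))"
  unfolding multilinear_form_def
proof (intro ballI conjI allI)
  fix x v y assume x: "x \<in> decorations P T" and v: "v \<in> T" and y: "y \<in> comps P (inputs T v)"
  obtain w h where w: "w \<in> T - {e}" and h: "linear_comps P (inputs T v) (inputs (T - {e}) w) h"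
    and upd: "\<And>y. contract P T e (x(v := y)) = (contract P T e x)(w := h y)"
    using contract_update[OF P A T e x v] by metis
  note c = contract_decorations[OF P A T e x]
  have hc: "h z \<in> comps P (inputs (T - {e}) w)" if "z \<in> comps P (inputs T v)" for z
    using h that unfolding linear_comps_def by blast
  show "\<chi> (contract P T e (x(v := vadd P (inputs T v) y z)))
      = \<chi> (contract P T e (x(v := y))) + \<chi> (contract P T e (x(v := z)))" if z: "z \<in> comps P (inputs T v)" for z
  proof -
    have "h (vadd P (inputs T v) y z) = vadd P (inputs (T - {e}) w) (h y) (h z)"
      using h y z unfolding linear_comps_def by blast
    then show ?thesis unfolding upd using multilinear_form_vadd[OF \<chi> c w hc[OF y] hc[OF z]] by simp
  qed
  show "\<chi> (contract P T e (x(v := vscale P (inputs T v) k y))) = k * \<chi> (contract P T e (x(v := y)))" for k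
  proof -
    have "h (vscale P (inputs T v) k y) = vscale P (inputs (T - {e}) w) k (h y)"
      using h y unfolding linear_comps_def by blast
    then show ?thesis unfolding upd using multilinear_form_vscale[OF \<chi> c w hc[OF y]] by simp
  qed
qed

section \<open>Decorations by basis elements\<close>

text \<open>The class \<open>\<rho>\<close> is the total composite of this decoration.\<close>

definition basis_decoration :: "('g \<times> 'x \<times> 'x) set \<Rightarrow> 'x set set \<Rightarrow> 'x set \<Rightarrow> (('g, 'x set) monomial \<Rightarrow>\<^sub>0 'k::field) set" where
  "basis_decoration \<rho> T = restrict (\<lambda>v. basis (inputs T v) (quot_rel \<rho> (inputs T v))) T"

lemma basis_decoration_in_decorations:
  assumes "finite A" "realizable A \<rho>" "adapted A \<rho> T"
  shows "basis_decoration \<rho> T \<in> decorations multi_as T"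
  using basis_in_comps[OF realizable_quot_inputs[OF assms]]
  by (auto simp: decorations_def basis_decoration_def)

text \<open>Deleting \<open>e\<close> composes the labels at \<open>e\<close> and at its parent and
  keeps the total composite; hence the differential never mixes different
  \<open>\<rho>\<close>.\<close>

lemma contract_basis_decoration:
  fixes \<rho> :: "('g \<times> 'x \<times> 'x) set"
  assumes A: "finite A" and \<rho>: "realizable A \<rho>" and T: "adapted A \<rho> T" and e: "e \<in> T" "e \<noteq> A"
  shows "contract multi_as T e (basis_decoration \<rho> T)
    = (basis_decoration \<rho> (T - {e}) :: 'x set \<Rightarrow> (('g, 'x set) monomial \<Rightarrow>\<^sub>0 'k::field) set)"
proof (rule ext)
  fix v
  have t: "is_tree A T" using T by (simp add: adapted_def)
  define p where "p = parent T e"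
  have p: "p \<in> T" "e \<in> inputs T p" using parent_exists[OF A t e] by (simp_all add: p_def)
  show "contract multi_as T e (basis_decoration \<rho> T) v
    = (basis_decoration \<rho> (T - {e}) v :: (('g, 'x set) monomial \<Rightarrow>\<^sub>0 'k) set)"
  proof (cases "v = p")
    case True
    have "pcomp multi_as (inputs T p) e (inputs T e) (basis (inputs T p) (quot_rel \<rho> (inputs T p))) (basis (inputs T e) (quot_rel \<rho> (inputs T e)))
      = (basis (inputs (T - {e}) p) (quot_rel \<rho> (inputs (T - {e}) p)) :: (('g, 'x set) monomial \<Rightarrow>\<^sub>0 'k) set)"
      using pcomp_basis[OF realizable_quot_inputs[OF A \<rho> T p(1)] realizable_quot_inputs[OF A \<rho> T e(1)] p(2) inputs_parent_disjoint[OF t p(2)]]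
      unfolding comp_quot_rel[OF T e(1) p] inputs_delete_parent[OF t e(1) p] by simp
    then show ?thesis using True p e inputs_psubset[OF p(2)]
      by (auto simp add: contract_def Let_def p_def[symmetric] basis_decoration_def)
  next
    case False
    show ?thesis
    proof (cases "v \<in> T - {e}")
      case True
      then have "inputs (T - {e}) v = inputs T v"
        using inputs_delete_other[OF t e(1), of v] parent_unique[OF t _ _ p, of v] False by blast
      then show ?thesis using False True
        by (simp add: contract_def Let_def p_def[symmetric] basis_decoration_def)
    next
      case False
      then show ?thesis by (auto simp: contract_def Let_def basis_decoration_def)
    qed
  qed
qed

text \<open>Expand the labels in the basis, vertex by vertex; once all labels are basis vectors,
  \<open>quot_rel_surj\<close> shows that the decoration is a
  \<open>basis_decoration\<close>.\<close>

lemma multilinear_form_eqI: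
  fixes \<phi> \<chi> :: "('x set \<Rightarrow> (('g, 'x set) monomial \<Rightarrow>\<^sub>0 'k::field) set) \<Rightarrow> 'k"
  assumes A: "finite A" "2 \<le> card A" and T: "is_tree A T"
    and \<phi>: "multilinear_form multi_as T \<phi>" and \<chi>: "multilinear_form multi_as T \<chi>"
    and eq: "\<And>\<rho>. realizable A \<rho> \<Longrightarrow> adapted A \<rho> T \<Longrightarrow> \<phi> (basis_decoration \<rho> T) = \<chi> (basis_decoration \<rho> T)"
    and x: "x \<in> decorations multi_as T"
  shows "\<phi> x = \<chi> x"
proof -
  have finT: "finite T" by (rule is_tree_finite[OF A(1) T])
  \<comment> \<open>\<open>S\<close> is the set of vertices whose labels are still arbitrary;
    elsewhere the labels are already basis vectors.\<close>
  have "\<phi> x = \<chi> x" if "finite S" "S \<subseteq> T" "x \<in> decorations multi_as T"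
    "\<forall>v\<in>T - S. \<exists>\<rho>. realizable (inputs T v) \<rho> \<and> x v = basis (inputs T v) \<rho>" for S x
    using that
  proof (induction S arbitrary: x rule: finite_induct)
    case empty
    then obtain b where b: "\<And>v. v \<in> T \<Longrightarrow> realizable (inputs T v) (b v) \<and> x v = basis (inputs T v) (b v)"
      by (metis Diff_empty)
    then obtain \<rho> where \<rho>: "realizable A \<rho>" "adapted A \<rho> T" "\<forall>v\<in>T. b v = quot_rel \<rho> (inputs T v)"
      using quot_rel_surj[OF A T, of b] by blast
    have "x = basis_decoration \<rho> T"
    proof (rule ext)
      fix v
      show "x v = basis_decoration \<rho> T v"
        using b[of v] \<rho>(3) empty.prems(2) by (cases "v \<in> T") (auto simp: basis_decoration_def decorations_def PiE_iff extensional_def)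
    qed
    then show ?case using eq[OF \<rho>(1,2)] by simp
  next
    case (insert v S)
    then have v: "v \<in> T" by simp
    have "\<phi> (x(v := X)) = \<chi> (x(v := X))" if "X \<in> comps multi_as (inputs T v)" for X
      using that
    proof (induction rule: comps_multi_as_induct)
      case zero
      let ?z = "vzero multi_as (inputs T v) :: (('g, 'x set) monomial \<Rightarrow>\<^sub>0 'k) set"
      have z: "vscale multi_as (inputs T v) 0 ?z = ?z" "?z \<in> comps multi_as (inputs T v)"
        by (simp_all add: vzero_presented vscale_presented comps_presented)
      have zero: "\<psi> (x(v := ?z)) = 0" if "multilinear_form multi_as T \<psi>"
        for \<psi> :: "('x set \<Rightarrow> (('g, 'x set) monomial \<Rightarrow>\<^sub>0 'k) set) \<Rightarrow> 'k"
        using multilinear_form_vscale[OF that insert.prems(2) v z(2), of 0] unfolding z(1) by simp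
      show ?case by (simp only: zero[OF \<phi>] zero[OF \<chi>])
    next
      case (basis \<rho> c)
      have b: "basis (inputs T v) \<rho> \<in> comps multi_as (inputs T v)" by (rule basis_in_comps[OF basis])
      have "\<phi> (x(v := basis (inputs T v) \<rho>)) = \<chi> (x(v := basis (inputs T v) \<rho>))"
      proof (rule insert.IH)
        show "x(v := basis (inputs T v) \<rho>) \<in> decorations multi_as T"
          by (rule decorations_update[OF insert.prems(2) v b])
        show "\<forall>w\<in>T - S. \<exists>\<rho>'. realizable (inputs T w) \<rho>' \<and> (x(v := basis (inputs T v) \<rho>)) w = basis (inputs T w) \<rho>'"
        proof
          fix w assume "w \<in> T - S"
          then show "\<exists>\<rho>'. realizable (inputs T w) \<rho>' \<and> (x(v := basis (inputs T v) \<rho>)) w = basis (inputs T w) \<rho>'"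
            using insert.prems(3) basis by (cases "w = v") auto
        qed
      qed (use insert.prems in auto)
      then show ?case
        by (simp only: multilinear_form_vscale[OF \<phi> insert.prems(2) v b] multilinear_form_vscale[OF \<chi> insert.prems(2) v b])
    next
      case (add X Y)
      show ?case
        by (simp only: multilinear_form_vadd[OF \<phi> insert.prems(2) v add.hyps]
            multilinear_form_vadd[OF \<chi> insert.prems(2) v add.hyps] add.IH)
    qed
    from this[OF decorations_mem[OF insert.prems(2) v]] show ?case by (simp only: fun_upd_triv)
  qed
  from this[of T x] finT x show ?thesis by simp
qed

text \<open>With \<open>c v\<close> the quotient relations of an adapted \<open>\<rho>'\<close>,
  these products are dual to the basis decorations (\<open>prod_coord_basis_decoration\<close>).
  They serve to build a cochain with prescribed values.\<close>

lemma multilinear_form_prod_coord: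
  assumes "finite T"
  shows "multilinear_form multi_as T (\<lambda>x. \<Prod>v\<in>T. coord (c v) (x v) :: 'k::field)"
proof -
  have split: "(\<Prod>w\<in>T. coord (c w) ((x(v := y)) w) :: 'k) = coord (c v) y * (\<Prod>w\<in>T - {v}. coord (c w) (x w))"
    if "v \<in> T" for v y and x :: "'a set \<Rightarrow> (('b, 'a set) monomial \<Rightarrow>\<^sub>0 'k) set"
    using assms that by (subst prod.remove[of T v]) auto
  show ?thesis
    unfolding multilinear_form_def
    by (intro ballI conjI allI) (simp_all only: split coord_vadd coord_vscale distrib_right mult.assoc)
qed

lemma prod_coord_basis_decoration:
  assumes A: "finite A" and \<rho>: "realizable A \<rho>" "adapted A \<rho> T" and \<rho>': "realizable A \<rho>'" "adapted A \<rho>' T"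
  shows "(\<Prod>v\<in>T. coord (quot_rel \<rho>' (inputs T v)) (basis_decoration \<rho> T v)) = (of_bool (\<rho> = \<rho>') :: 'k::field)"
proof -
  have finT: "finite T" using is_tree_finite[OF A] \<rho>(2) by (simp add: adapted_def)
  have "(\<Prod>v\<in>T. coord (quot_rel \<rho>' (inputs T v)) (basis_decoration \<rho> T v))
      = (\<Prod>v\<in>T. of_bool (quot_rel \<rho>' (inputs T v) = quot_rel \<rho> (inputs T v)) :: 'k)"
    by (rule prod.cong[OF refl])
       (simp add: basis_decoration_def coord_basis[OF realizable_quot_inputs[OF A \<rho>]])
  also have "\<dots> = of_bool (\<forall>v\<in>T. quot_rel \<rho>' (inputs T v) = quot_rel \<rho> (inputs T v))"
  proof (cases "\<forall>v\<in>T. quot_rel \<rho>' (inputs T v) = quot_rel \<rho> (inputs T v)")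
    case False
    then show ?thesis using finT by (subst prod_zero) auto
  qed simp
  also have "(\<forall>v\<in>T. quot_rel \<rho>' (inputs T v) = quot_rel \<rho> (inputs T v)) \<longleftrightarrow> \<rho> = \<rho>'"
    using quot_rel_inj[OF A \<rho> \<rho>'] by auto
  finally show ?thesis .
qed

section \<open>Exactness of the cobar complex\<close>

text \<open>Trees whose vertices are modules are the simplices of the flag complex, an order of the
  internal edges being an order of the simplex. The root \<open>A\<close> belongs to every tree and
  is left out of the list.\<close>

lemma edge_order_adapted_iff:
  assumes "2 \<le> card A"
  shows "edge_order A k es \<and> adapted A \<rho> (insert A (set es)) \<longleftrightarrow> flag (proper_modules A \<rho>) k es"
proof -
  have c: "compat u v" "compat v u" if "u \<subseteq> v" for u v :: "'a set" using that by (simp_all add: compat_def)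
  have "is_tree A (insert A S) \<longleftrightarrow> (\<forall>v\<in>S. v \<subseteq> A \<and> 2 \<le> card v) \<and> (\<forall>u\<in>S. \<forall>v\<in>S. compat u v)" for S
    unfolding is_tree_def compat_def[symmetric] using assms c by auto
  then show ?thesis unfolding edge_order_def adapted_def flag_def proper_modules_def by auto
qed

lemma edge_order_delete:
  assumes "edge_order A (Suc k) es" "i < Suc k"
  shows "edge_order A k (take i es @ drop (Suc i) es)"
    and "insert A (set (take i es @ drop (Suc i) es)) = insert A (set es) - {es ! i}"
    and "es ! i \<in> insert A (set es)" "es ! i \<noteq> A"
proof -
  have i: "i < length es" and d: "distinct es" and A: "A \<notin> set es" using assms by (auto simp: edge_order_def)
  have es: "es = take i es @ es ! i # drop (Suc i) es" using i by (rule id_take_nth_drop)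
  have "set (take i es @ drop (Suc i) es) = set es - {es ! i}"
    using d by (subst (3) es, subst (asm) es) auto
  moreover show ne: "es ! i \<in> insert A (set es)" "es ! i \<noteq> A" using i A by auto
  ultimately show S: "insert A (set (take i es @ drop (Suc i) es)) = insert A (set es) - {es ! i}" by auto
  have "distinct (take i es @ drop (Suc i) es)" using d by (subst (asm) es) auto
  moreover have "is_tree A (insert A (set (take i es @ drop (Suc i) es)))"
    unfolding S by (rule is_tree_delete) (use assms ne in \<open>auto simp: edge_order_def\<close>)
  moreover have "A \<notin> set (take i es @ drop (Suc i) es)" using A by (auto dest: in_set_takeD in_set_dropD)
  ultimately show "edge_order A k (take i es @ drop (Suc i) es)"
    using assms by (auto simp: edge_order_def)
qed

lemma cobar_d_basis_decoration:
  assumes A: "finite A" "2 \<le> card A" and \<rho>: "realizable A \<rho>" and es: "flag (proper_modules A \<rho>) (Suc k) es"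
  shows "cobar_d multi_as A \<phi> es (basis_decoration \<rho> (insert A (set es)))
    = cob (\<lambda>es. \<phi> es (basis_decoration \<rho> (insert A (set es)))) es"
  unfolding cobar_d_def cob_def
proof (rule sum.cong[OF refl])
  fix i assume "i \<in> {..<length es}"
  have eo: "edge_order A (Suc k) es" and ad: "adapted A \<rho> (insert A (set es))"
    using es edge_order_adapted_iff[OF A(2)] by blast+
  then have i: "i < Suc k" using \<open>i \<in> _\<close> by (simp add: edge_order_def)
  note del = edge_order_delete[OF eo i]
  show "(- 1) ^ i * \<phi> (take i es @ drop (Suc i) es) (contract multi_as (insert A (set es)) (es ! i) (basis_decoration \<rho> (insert A (set es))))
    = (- 1) ^ i * \<phi> (take i es @ drop (Suc i) es) (basis_decoration \<rho> (insert A (set (take i es @ drop (Suc i) es))))"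
    unfolding contract_basis_decoration[OF A(1) \<rho> ad del(3,4)] del(2) ..
qed

lemma multilinear_form_cobar_d:
  assumes P: "operad P" and A: "finite A" and \<psi>: "cochain P A k \<psi>" and es: "edge_order A (Suc k) es"
  shows "multilinear_form P (insert A (set es)) (cobar_d P A \<psi> es)"
  unfolding cobar_d_def
proof (rule multilinear_form_sum, rule multilinear_form_scale)
  fix i assume "i \<in> {..<length es}"
  then have i: "i < Suc k" using es by (simp add: edge_order_def)
  note del = edge_order_delete[OF es i]
  have "multilinear_form P (insert A (set es) - {es ! i}) (\<psi> (take i es @ drop (Suc i) es))"
    using \<psi> del(1) unfolding cochain_def del(2)[symmetric] by blast
  then show "multilinear_form P (insert A (set es))
      (\<lambda>x. \<psi> (take i es @ drop (Suc i) es) (contract P (insert A (set es)) (es ! i) x))"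
    using multilinear_form_contract[OF P A _ del(3,4)] es by (simp add: edge_order_def)
qed

theorem cobar_exact_multi_as:
  fixes A :: "'x set"
  assumes A: "finite A" "2 \<le> card A" and k: "k \<noteq> card A - 2"
  shows "cobar_exact_at (multi_as :: ('k::field, 'x set, (('g::finite, 'x set) monomial \<Rightarrow>\<^sub>0 'k) set) operad_data) A k"
  unfolding cobar_exact_at_def
proof (intro allI impI, elim conjE)
  let ?P = "multi_as :: ('k, 'x set, (('g, 'x set) monomial \<Rightarrow>\<^sub>0 'k) set) operad_data"
  fix \<phi> assume \<phi>: "cochain ?P A k \<phi>" and closed: "cochain_eq ?P A (Suc k) (cobar_d ?P A \<phi>) (\<lambda>_ _. 0)"
  \<comment> \<open>The component of \<open>\<phi>\<close> at \<open>\<rho>\<close>, a cochain on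
    the flag complex of proper modules of \<open>\<rho>\<close>.\<close>
  define \<Phi> where "\<Phi> \<rho> es = \<phi> es (basis_decoration \<rho> (insert A (set es)))" for \<rho> :: "('g \<times> 'x \<times> 'x) set" and es
  have bd: "basis_decoration \<rho> (insert A (set es)) \<in> decorations ?P (insert A (set es))"
    if "realizable A \<rho>" "flag (proper_modules A \<rho>) l es" for \<rho> l es
    using basis_decoration_in_decorations[OF A(1) that(1)] edge_order_adapted_iff[OF A(2)] that(2) by blast
  have alt: "alternating (proper_modules A \<rho>) k (\<Phi> \<rho>)" if \<rho>: "realizable A \<rho>" for \<rho>
    unfolding alternating_def
  proof (intro allI impI)
    fix es1 e e' es2 assume fl: "flag (proper_modules A \<rho>) k (es1 @ e # e' # es2)"
    have "insert A (set (es1 @ e' # e # es2)) = insert A (set (es1 @ e # e' # es2))" by auto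
    moreover have "edge_order A k (es1 @ e # e' # es2)" using edge_order_adapted_iff[OF A(2)] fl by blast
    ultimately show "\<Phi> \<rho> (es1 @ e' # e # es2) = - \<Phi> \<rho> (es1 @ e # e' # es2)"
      using \<phi> bd[OF \<rho> fl] unfolding cochain_def \<Phi>_def by metis
  qed
  have cl: "cob (\<Phi> \<rho>) es = 0" if \<rho>: "realizable A \<rho>" and es: "flag (proper_modules A \<rho>) (Suc k) es" for \<rho> es
  proof -
    have "edge_order A (Suc k) es" using edge_order_adapted_iff[OF A(2)] es by blast
    then have "cobar_d ?P A \<phi> es (basis_decoration \<rho> (insert A (set es))) = 0"
      using closed bd[OF \<rho> es] unfolding cochain_eq_def by blast
    then show ?thesis unfolding cobar_d_basis_decoration[OF A \<rho> es] \<Phi>_def .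
  qed
  have ml\<phi>: "multilinear_form ?P (insert A (set es)) (\<phi> es)" if "edge_order A k es" for es
    using \<phi> that unfolding cochain_def by blast
  show "case k of 0 \<Rightarrow> cochain_eq ?P A 0 \<phi> (\<lambda>_ _. 0)
    | Suc j \<Rightarrow> \<exists>\<psi>. cochain ?P A j \<psi> \<and> cochain_eq ?P A k \<phi> (cobar_d ?P A \<psi>)"
  proof (cases k)
    case 0
    have "\<phi> [] x = 0" if eo: "edge_order A 0 []" and x: "x \<in> decorations ?P {A}" for x
    proof (rule multilinear_form_eqI[OF A _ _ multilinear_form_zero _ x])
      show "is_tree A {A}" using eo by (simp add: edge_order_def)
      show "multilinear_form ?P {A} (\<phi> [])" using ml\<phi>[of "[]"] eo 0 by simp
      fix \<rho> :: "('g \<times> 'x \<times> 'x) set" assume "realizable A \<rho>"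
      then have "\<Phi> \<rho> [] = 0"
        using flag_exact_proper_modules[OF _ A(2) k, where K = "TYPE('k)"] alt cl 0 unfolding flag_exact_def by fastforce
      then show "\<phi> [] (basis_decoration \<rho> {A}) = 0" by (simp add: \<Phi>_def)
    qed
    then show ?thesis using 0 by (auto simp: cochain_eq_def edge_order_def)
  next
    case (Suc j)
    have "\<exists>\<psi>. alternating (proper_modules A \<rho>) j \<psi> \<and> (\<forall>es. flag (proper_modules A \<rho>) k es \<longrightarrow> \<Phi> \<rho> es = cob \<psi> es)"
      if "realizable A \<rho>" for \<rho> :: "('g \<times> 'x \<times> 'x) set"
      using flag_exact_proper_modules[OF that A(2) k, where K = "TYPE('k)"] alt[OF that] cl[OF that]
      unfolding flag_exact_def Suc by fastforce
    then obtain \<Psi> where \<Psi>: "\<And>\<rho>. realizable A \<rho> \<Longrightarrow> alternating (proper_modules A \<rho>) j (\<Psi> \<rho>)"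
      "\<And>\<rho> es. realizable A \<rho> \<Longrightarrow> flag (proper_modules A \<rho>) k es \<Longrightarrow> \<Phi> \<rho> es = cob (\<Psi> \<rho>) es"
      by metis
    \<comment> \<open>The primitives of the components are put together by means of the dual basis,
      so that the component of \<open>\<psi>\<close> at \<open>\<rho>\<close> is
      \<open>\<Psi> \<rho>\<close> again. The sum is finite because only finitely many relations on
      \<open>A\<close> are realizable.\<close>
    define \<psi> where "\<psi> es x = (\<Sum>\<rho> | realizable A \<rho> \<and> adapted A \<rho> (insert A (set es)).
      \<Psi> \<rho> es * (\<Prod>v\<in>insert A (set es). coord (quot_rel \<rho> (inputs (insert A (set es)) v)) (x v)))"
      for es and x :: "'x set \<Rightarrow> (('g, 'x set) monomial \<Rightarrow>\<^sub>0 'k) set"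
    have fin: "finite {\<rho> :: ('g \<times> 'x \<times> 'x) set. realizable A \<rho> \<and> adapted A \<rho> T}" for T
      by (rule finite_subset[OF _ finite_realizable[OF A(1)]]) auto
    have val: "\<psi> es (basis_decoration \<rho> (insert A (set es))) = \<Psi> \<rho> es"
      if \<rho>: "realizable A \<rho>" "adapted A \<rho> (insert A (set es))" for \<rho> es
    proof -
      have "\<psi> es (basis_decoration \<rho> (insert A (set es)))
        = (\<Sum>\<rho>' | realizable A \<rho>' \<and> adapted A \<rho>' (insert A (set es)). if \<rho> = \<rho>' then \<Psi> \<rho>' es else 0)"
        unfolding \<psi>_def
        by (rule sum.cong[OF refl]) (simp add: prod_coord_basis_decoration[OF A(1) \<rho>])
      also have "\<dots> = \<Psi> \<rho> es" using \<rho> fin by (simp add: sum.delta')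
      finally show ?thesis .
    qed
    have \<psi>: "cochain ?P A j \<psi>"
      unfolding cochain_def
    proof (intro conjI allI impI ballI)
      fix es assume "edge_order A j es"
      show "multilinear_form ?P (insert A (set es)) (\<psi> es)"
        unfolding \<psi>_def
        by (intro multilinear_form_sum multilinear_form_scale multilinear_form_prod_coord) simp
    next
      fix es1 e e' es2 x assume eo: "edge_order A j (es1 @ e # e' # es2)"
      have S: "set (es1 @ e' # e # es2) = set (es1 @ e # e' # es2)" by auto
      show "\<psi> (es1 @ e' # e # es2) x = - \<psi> (es1 @ e # e' # es2) x"
        unfolding \<psi>_def S sum_negf[symmetric]
      proof (rule sum.cong[OF refl])
        fix \<rho> :: "('g \<times> 'x \<times> 'x) set" assume "\<rho> \<in> {\<rho>. realizable A \<rho> \<and> adapted A \<rho> (insert A (set (es1 @ e # e' # es2)))}"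
        then have \<rho>: "realizable A \<rho>" "adapted A \<rho> (insert A (set (es1 @ e # e' # es2)))" by blast+
        then have "flag (proper_modules A \<rho>) j (es1 @ e # e' # es2)"
          using eo edge_order_adapted_iff[OF A(2)] by blast
        with \<rho>(1) have "\<Psi> \<rho> (es1 @ e' # e # es2) = - \<Psi> \<rho> (es1 @ e # e' # es2)"
          using alternatingD[OF \<Psi>(1)] by blast
        then show "\<Psi> \<rho> (es1 @ e' # e # es2) * (\<Prod>v\<in>insert A (set (es1 @ e # e' # es2)). coord (quot_rel \<rho> (inputs (insert A (set (es1 @ e # e' # es2))) v)) (x v))
          = - (\<Psi> \<rho> (es1 @ e # e' # es2) * (\<Prod>v\<in>insert A (set (es1 @ e # e' # es2)). coord (quot_rel \<rho> (inputs (insert A (set (es1 @ e # e' # es2))) v)) (x v)))"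
          by simp
      qed
    qed
    moreover have "cochain_eq ?P A k \<phi> (cobar_d ?P A \<psi>)"
      unfolding cochain_eq_def
    proof (intro allI impI ballI)
      fix es x assume eo: "edge_order A k es" and x: "x \<in> decorations ?P (insert A (set es))"
      have T: "is_tree A (insert A (set es))" using eo by (simp add: edge_order_def)
      show "\<phi> es x = cobar_d ?P A \<psi> es x"
      \<comment> \<open>Both sides are multilinear, so it suffices to compare them on basis
        decorations, where the equation is the one solved by \<open>\<Psi>\<close>.\<close>
      proof (rule multilinear_form_eqI[OF A T ml\<phi>[OF eo] _ _ x])
        show "multilinear_form ?P (insert A (set es)) (cobar_d ?P A \<psi> es)"
          by (rule multilinear_form_cobar_d[OF operad_presented A(1) \<psi>]) (use eo Suc in simp)
        fix \<rho> :: "('g \<times> 'x \<times> 'x) set" assume \<rho>: "realizable A \<rho>" "adapted A \<rho> (insert A (set es))"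
        then have fl: "flag (proper_modules A \<rho>) k es" using eo edge_order_adapted_iff[OF A(2)] by blast
        have "\<phi> es (basis_decoration \<rho> (insert A (set es))) = cob (\<Psi> \<rho>) es"
          using \<Psi>(2)[OF \<rho>(1) fl] by (simp add: \<Phi>_def)
        also have "\<dots> = cob (\<lambda>es. \<psi> es (basis_decoration \<rho> (insert A (set es)))) es"
        proof (rule cob_cong)
          fix xs y ys assume "es = xs @ y # ys"
          then have "flag (proper_modules A \<rho>) j (xs @ ys)" using fl flag_drop_mid Suc by blast
          then have "adapted A \<rho> (insert A (set (xs @ ys)))" using edge_order_adapted_iff[OF A(2)] by blast
          from val[OF \<rho>(1) this] show "\<Psi> \<rho> (xs @ ys) = \<psi> (xs @ ys) (basis_decoration \<rho> (insert A (set (xs @ ys))))" by simp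
        qed
        also have "\<dots> = cobar_d ?P A \<psi> es (basis_decoration \<rho> (insert A (set es)))"
          using cobar_d_basis_decoration[OF A \<rho>(1), of j es \<psi>] fl Suc by simp
        finally show "\<phi> es (basis_decoration \<rho> (insert A (set es))) = cobar_d ?P A \<psi> es (basis_decoration \<rho> (insert A (set es)))" .
      qed
    qed
    ultimately show ?thesis unfolding Suc by auto
  qed
qed

lemma quadratic_multi_as:
  "quadratic_operad (multi_as :: ('k::field, 'l, (('g::finite, 'l) monomial \<Rightarrow>\<^sub>0 'k) set) operad_data)"
  unfolding quadratic_operad_def
proof (rule exI[of _ assoc_relators], intro conjI ballI refl)
  fix r :: "('g, 'l) monomial \<Rightarrow>\<^sub>0 'k" assume "r \<in> assoc_relators"
  then obtain g x y z where r: "r = associator g x y z" "distinct [x, y, z]" by (auto simp: assoc_relators_def)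
  have "r \<in> free_comps {x, y, z}"
    unfolding r(1) associator_def by (intro free_comps_diff free_comps_single) (use r(2) in \<open>auto simp: valid_def\<close>)
  moreover have "card {x, y, z} = 3" using r(2) by simp
  ultimately show "\<exists>A. card A \<in> {2, 3} \<and> r \<in> free_comps A" by (intro exI[of _ "{x, y, z}"]) simp
qed

theorem koszul_multi_as:
  "koszul_operad (multi_as :: ('k::field, 'x set, (('g::finite, 'x set) monomial \<Rightarrow>\<^sub>0 'k) set) operad_data)"
  unfolding koszul_operad_def using operad_presented quadratic_multi_as cobar_exact_multi_as by blast

text \<open>With leaves taken from \<open>nat\<close> there are leaf sets \<open>A\<close> of every
  finite size, so all arities are covered.\<close>

theorem proposition5p10:
  "koszul_operad (two_as :: ('k::field, nat set, ((two_ops, nat set) monomial \<Rightarrow>\<^sub>0 'k) set) operad_data)"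
proof -
  have "two_as_relators = (assoc_relators :: ((two_ops, nat set) monomial \<Rightarrow>\<^sub>0 'k) set)"
    by (simp add: two_as_relators_def assoc_relators_def)
  then show ?thesis using koszul_multi_as unfolding two_as_def by simp
qed

end
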